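(* Let $(W,S)$ be a finite Coxeter system realized in $V$, with longest element $w_0$, and let $T>0$. If $\pi$ and $\bar\pi$ are two dominant paths in $C_T^0(V)$ such that $\pi(T)=\bar\pi(T)$, then the continuous crystals $L_\pi$ and $L_{\bar\pi}$ are isomorphic.
   Context: **Realization.** $V$ is a finite-dimensional real vector space with dual $V^\vee$, on which the finite Coxeter group $W$ (generated by the finite set of involutions $S$) acts so that $s(x)=x-\alpha_s^\vee(x)\alpha_s$ for $s\in S$, where $(\alpha_s,\alpha_s^\vee)\in V\times V^\vee$, $\alpha_s^\vee(\alpha_s)=2$. With $m(s,s')$ the order of $ss'$, as is standard, for $s\neq s'$: $\alpha_s^\vee(\alpha_{s'})=\alpha_{s'}^\vee(\alpha_s)=0$ if $m(s,s')=2$, otherwise both are negative with product $4\cos^2(\pi/m(s,s'))$. $\Sigma=\{\alpha_s\}$; for $\alpha=\alpha_s$, $\alpha^\vee=\alpha_s^\vee$. $\overline C=\{v\in V:\alpha^\vee(v)\ge0\ \forall\alpha\in\Sigma\}$. **Paths and Pitman transforms.** $C_T^0(V)$ is the set of continuous paths $\eta:[0,T]\to V$ with $\eta(0)=0$. A path is dominant if it takes values in $\overline C$. For $\alpha\in\Sigma$, $\mathcal P_\alpha\eta(t)=\eta(t)-\inf_{0\le s\le t}\alpha^\vee(\eta(s))\,\alpha$. For a reduced decomposition $w_0=s_1\cdots s_q$, $\mathcal P_{w_0}=\mathcal P_{\alpha_{s_1}}\cdots\mathcal P_{\alpha_{s_q}}$ (independent of the decomposition). For $\pi$ dominant, $L_\pi=\{\eta\in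 C_T^0(V):\mathcal P_{w_0}\eta=\pi\}$. **Crystal structure.** For $\eta\in C_T^0(V)$: $wt(\eta)=\eta(T)$, $\varepsilon_\alpha(\eta)=-\inf_{0\le t\le T}\alpha^\vee(\eta(t))$, $\varphi_\alpha(\eta)=\alpha^\vee(\eta(T))-\inf_{0\le t\le T}\alpha^\vee(\eta(t))$, and, for $x\in\mathbb R$, $e_\alpha^x\eta=\mathcal E_\alpha^x\eta$, where for $-\varphi_\alpha(\eta)\le x\le\varepsilon_\alpha(\eta)$, $\mathcal E_\alpha^x\eta$ is the unique path in $C^0_T(V)$ with $\mathcal P_\alpha\mathcal E_\alpha^x\eta=\mathcal P_\alpha\eta$ and $\mathcal E_\alpha^x\eta(T)=\eta(T)+x\alpha$, and $\mathcal E_\alpha^x\eta=\mathbf 0$ (a ghost element) otherwise. Each $L_\pi\cup\{\mathbf 0\}$ is stable under these operators, and $L_\pi$ is equipped with the restricted structure. **Isomorphism.** A crystal morphism $B_1\to B_2$ is a map $\psi:B_1\cup\{\mathbf 0\}\to B_2\cup\{\mathbf 0\}$ with $\psi(\mathbf 0)=\mathbf 0$, preserving $wt,\varepsilon_\alpha,\varphi_\alpha$ on $B_1$ for all $\alpha\in\Sigma$, and with $e_\alpha^r(\psi(b))=\psi(e_\alpha^r(b))$ whenever $e_\alpha^r(b)\in B_1$. An isomorphism is a morphism with a two-sided inverse morphism. *)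

theory Defs
  imports "HOL-Algebra.Multiplicative_Group" "HOL-Algebra.Group_Action" "HOL-Analysis.Analysis"
begin

section \<open>Coxeter systems\<close>

definition word_prod :: "('w, 'm) monoid_scheme \<Rightarrow> 'w list \<Rightarrow> 'w" where
  "word_prod G ws = foldr (\<lambda>s w. s \<otimes>\<^bsub>G\<^esub> w) ws \<one>\<^bsub>G\<^esub>"

text \<open>
  The congruence on words over \<open>S\<close> generated by the relations \<open>(s t)^m(s,t) = 1\<close>, where \<open>m(s,t)\<close>
  is the order of \<open>s t\<close>. The case \<open>s = t\<close> gives \<open>s s = 1\<close>, so that the quotient of the free monoid
  by this congruence is already the group presented by these relations. If \<open>s t\<close> has infinite
  order, then \<open>group.ord\<close> is \<open>0\<close> and the relation is void.
\<close>

inductive coxeter_cong :: "('w, 'm) monoid_scheme \<Rightarrow> 'w set \<Rightarrow> 'w list \<Rightarrow> 'w list \<Rightarrow> bool"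
  for G S where
  refl: "u \<in> lists S \<Longrightarrow> coxeter_cong G S u u"
| sym: "coxeter_cong G S u v \<Longrightarrow> coxeter_cong G S v u"
| trans: "coxeter_cong G S u v \<Longrightarrow> coxeter_cong G S v w \<Longrightarrow> coxeter_cong G S u w"
| relation: "u \<in> lists S \<Longrightarrow> v \<in> lists S \<Longrightarrow> s \<in> S \<Longrightarrow> t \<in> S \<Longrightarrow>
    coxeter_cong G S (u @ concat (replicate (group.ord G (s \<otimes>\<^bsub>G\<^esub> t)) [s, t]) @ v) (u @ v)"

locale coxeter_system = group G for G :: "('w, 'm) monoid_scheme" (structure) +
  fixes S :: "'w set"
  assumes finite_S: "finite S"
    and S_subset: "S \<subseteq> carrier G"
    and involution: "s \<in> S \<Longrightarrow> s \<noteq> \<one> \<and> s \<otimes> s = \<one>"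
    and generates: "generate G S = carrier G"
    and presentation: "u \<in> lists S \<Longrightarrow> v \<in> lists S \<Longrightarrow> word_prod G u = word_prod G v \<Longrightarrow>
      coxeter_cong G S u v"

definition word_length :: "('w, 'm) monoid_scheme \<Rightarrow> 'w set \<Rightarrow> 'w \<Rightarrow> nat" where
  "word_length G S w = (LEAST n. \<exists>ws\<in>lists S. word_prod G ws = w \<and> length ws = n)"

definition reduced_decomposition ::
  "('w, 'm) monoid_scheme \<Rightarrow> 'w set \<Rightarrow> 'w list \<Rightarrow> 'w \<Rightarrow> bool" where
  "reduced_decomposition G S ws w \<longleftrightarrow>
     ws \<in> lists S \<and> word_prod G ws = w \<and> length ws = word_length G S w"

definition longest_element :: "('w, 'm) monoid_scheme \<Rightarrow> 'w set \<Rightarrow> 'w \<Rightarrow> bool" where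
  "longest_element G S w0 \<longleftrightarrow>
     w0 \<in> carrier G \<and> (\<forall>w\<in>carrier G. word_length G S w \<le> word_length G S w0)"

section \<open>Realizations\<close>

text \<open>
  \<open>\<alpha> s\<close> is the simple root and \<open>\<alpha>v s\<close> the simple coroot attached to \<open>s \<in> S\<close>; elements of the dual
  space are linear maps to \<open>real\<close>. The inner product of the type class is never used.
\<close>

locale finite_coxeter_realization = coxeter_system G S
  for G :: "('w, 'm) monoid_scheme" (structure) and S :: "'w set" +
  fixes \<rho> :: "'w \<Rightarrow> 'v::euclidean_space \<Rightarrow> 'v"
    and \<alpha> :: "'w \<Rightarrow> 'v"
    and \<alpha>v :: "'w \<Rightarrow> 'v \<Rightarrow> real"
  assumes finite_W: "finite (carrier G)"
    and action: "group_action G UNIV \<rho>"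
    and linear_action: "w \<in> carrier G \<Longrightarrow> linear (\<rho> w)"
    and linear_coroot: "s \<in> S \<Longrightarrow> linear (\<alpha>v s)"
    and coroot_root: "s \<in> S \<Longrightarrow> \<alpha>v s (\<alpha> s) = 2"
    and reflection: "s \<in> S \<Longrightarrow> \<rho> s x = x - \<alpha>v s x *\<^sub>R \<alpha> s"
    and cartan_orthogonal: "s \<in> S \<Longrightarrow> t \<in> S \<Longrightarrow> s \<noteq> t \<Longrightarrow> ord (s \<otimes> t) = 2 \<Longrightarrow>
      \<alpha>v s (\<alpha> t) = 0 \<and> \<alpha>v t (\<alpha> s) = 0"
    and cartan_negative: "s \<in> S \<Longrightarrow> t \<in> S \<Longrightarrow> s \<noteq> t \<Longrightarrow> ord (s \<otimes> t) \<noteq> 2 \<Longrightarrow>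
      \<alpha>v s (\<alpha> t) < 0 \<and> \<alpha>v t (\<alpha> s) < 0 \<and>
      \<alpha>v s (\<alpha> t) * \<alpha>v t (\<alpha> s) = 4 * (cos (pi / real (ord (s \<otimes> t))))\<^sup>2"

definition closed_chamber :: "'i set \<Rightarrow> ('i \<Rightarrow> 'v \<Rightarrow> real) \<Rightarrow> 'v set" where
  "closed_chamber S \<alpha>v = {v. \<forall>s\<in>S. \<alpha>v s v \<ge> 0}"

section \<open>Paths and Pitman transforms\<close>

text \<open>
  Paths on \<open>[0, T]\<close> are extensional functions, so that equality of paths is equality on \<open>[0, T]\<close>.
\<close>

definition path_space :: "real \<Rightarrow> (real \<Rightarrow> 'v::real_normed_vector) set" where
  "path_space T = {\<eta> \<in> extensional {0..T}. continuous_on {0..T} \<eta> \<and> \<eta> 0 = 0}"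

definition dominant_path ::
  "real \<Rightarrow> 'i set \<Rightarrow> ('i \<Rightarrow> 'v \<Rightarrow> real) \<Rightarrow> (real \<Rightarrow> 'v::real_normed_vector) \<Rightarrow> bool" where
  "dominant_path T S \<alpha>v \<eta> \<longleftrightarrow> \<eta> \<in> path_space T \<and> (\<forall>t\<in>{0..T}. \<eta> t \<in> closed_chamber S \<alpha>v)"

definition pitman ::
  "real \<Rightarrow> ('i \<Rightarrow> 'v) \<Rightarrow> ('i \<Rightarrow> 'v \<Rightarrow> real) \<Rightarrow> 'i \<Rightarrow>
   (real \<Rightarrow> 'v::real_normed_vector) \<Rightarrow> (real \<Rightarrow> 'v)" where
  "pitman T \<alpha> \<alpha>v s \<eta> = (\<lambda>t\<in>{0..T}. \<eta> t - (INF r\<in>{0..t}. \<alpha>v s (\<eta> r)) *\<^sub>R \<alpha> s)"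

definition pitman_word ::
  "real \<Rightarrow> ('i \<Rightarrow> 'v) \<Rightarrow> ('i \<Rightarrow> 'v \<Rightarrow> real) \<Rightarrow> 'i list \<Rightarrow>
   (real \<Rightarrow> 'v::real_normed_vector) \<Rightarrow> (real \<Rightarrow> 'v)" where
  "pitman_word T \<alpha> \<alpha>v ws = foldr (pitman T \<alpha> \<alpha>v) ws"

section \<open>Crystals\<close>

text \<open>
  The structure maps of a crystal with weights in \<open>'v\<close>; the ghost element is \<open>None\<close>. The simple
  roots are indexed by \<open>'i\<close>.
\<close>

record ('i, 'v, 'b) crystal =
  elems :: "'b set"
  wt :: "'b \<Rightarrow> 'v"
  eps :: "'i \<Rightarrow> 'b \<Rightarrow> real"
  phi :: "'i \<Rightarrow> 'b \<Rightarrow> real"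
  cop :: "'i \<Rightarrow> real \<Rightarrow> 'b option \<Rightarrow> 'b option"

definition with_ghost :: "('i, 'v, 'b) crystal \<Rightarrow> 'b option set" where
  "with_ghost B = insert None (Some ` elems B)"

definition crystal_morphism ::
  "'i set \<Rightarrow> ('i, 'v, 'b) crystal \<Rightarrow> ('i, 'v, 'c) crystal \<Rightarrow> ('b option \<Rightarrow> 'c option) \<Rightarrow> bool" where
  "crystal_morphism S B1 B2 \<psi> \<longleftrightarrow>
     \<psi> ` with_ghost B1 \<subseteq> with_ghost B2 \<and>
     \<psi> None = None \<and>
     (\<forall>b\<in>elems B1. \<exists>c\<in>elems B2. \<psi> (Some b) = Some c \<and> wt B2 c = wt B1 b \<and>
        (\<forall>s\<in>S. eps B2 s c = eps B1 s b \<and> phi B2 s c = phi B1 s b)) \<and>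
     (\<forall>s\<in>S. \<forall>r. \<forall>b\<in>elems B1. cop B1 s r (Some b) \<in> Some ` elems B1 \<longrightarrow>
        cop B2 s r (\<psi> (Some b)) = \<psi> (cop B1 s r (Some b)))"

definition crystal_isomorphic ::
  "'i set \<Rightarrow> ('i, 'v, 'b) crystal \<Rightarrow> ('i, 'v, 'c) crystal \<Rightarrow> bool" where
  "crystal_isomorphic S B1 B2 \<longleftrightarrow>
     (\<exists>\<psi> \<psi>'. crystal_morphism S B1 B2 \<psi> \<and> crystal_morphism S B2 B1 \<psi>' \<and>
        (\<forall>b\<in>with_ghost B1. \<psi>' (\<psi> b) = b) \<and> (\<forall>c\<in>with_ghost B2. \<psi> (\<psi>' c) = c))"

section \<open>The path crystal\<close>

definition path_eps ::
  "real \<Rightarrow> ('i \<Rightarrow> 'v \<Rightarrow> real) \<Rightarrow> 'i \<Rightarrow> (real \<Rightarrow> 'v) \<Rightarrow> real" where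
  "path_eps T \<alpha>v s \<eta> = - (INF t\<in>{0..T}. \<alpha>v s (\<eta> t))"

definition path_phi ::
  "real \<Rightarrow> ('i \<Rightarrow> 'v \<Rightarrow> real) \<Rightarrow> 'i \<Rightarrow> (real \<Rightarrow> 'v) \<Rightarrow> real" where
  "path_phi T \<alpha>v s \<eta> = \<alpha>v s (\<eta> T) - (INF t\<in>{0..T}. \<alpha>v s (\<eta> t))"

definition path_op ::
  "real \<Rightarrow> ('i \<Rightarrow> 'v) \<Rightarrow> ('i \<Rightarrow> 'v \<Rightarrow> real) \<Rightarrow> 'i \<Rightarrow> real \<Rightarrow>
   (real \<Rightarrow> 'v::real_normed_vector) option \<Rightarrow> (real \<Rightarrow> 'v) option" where
  "path_op T \<alpha> \<alpha>v s x b = (case b of None \<Rightarrow> None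
     | Some \<eta> \<Rightarrow>
         if - path_phi T \<alpha>v s \<eta> \<le> x \<and> x \<le> path_eps T \<alpha>v s \<eta>
         then Some (THE \<eta>'. \<eta>' \<in> path_space T \<and>
                      pitman T \<alpha> \<alpha>v s \<eta>' = pitman T \<alpha> \<alpha>v s \<eta> \<and> \<eta>' T = \<eta> T + x *\<^sub>R \<alpha> s)
         else None)"

definition path_crystal ::
  "real \<Rightarrow> ('i \<Rightarrow> 'v) \<Rightarrow> ('i \<Rightarrow> 'v \<Rightarrow> real) \<Rightarrow>
   ('i, 'v::real_normed_vector, real \<Rightarrow> 'v) crystal" where
  "path_crystal T \<alpha> \<alpha>v =
     \<lparr>elems = path_space T, wt = (\<lambda>\<eta>. \<eta> T), eps = path_eps T \<alpha>v, phi = path_phi T \<alpha>v,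
      cop = path_op T \<alpha> \<alpha>v\<rparr>"

text \<open>\<open>L_crystal T \<alpha> \<alpha>v ws \<pi>\<close> is \<open>L\<^sub>\<pi>\<close> when \<open>ws\<close> is a reduced decomposition of the longest element.\<close>

definition L_crystal ::
  "real \<Rightarrow> ('i \<Rightarrow> 'v) \<Rightarrow> ('i \<Rightarrow> 'v \<Rightarrow> real) \<Rightarrow> 'i list \<Rightarrow>
   (real \<Rightarrow> 'v::real_normed_vector) \<Rightarrow> ('i, 'v, real \<Rightarrow> 'v) crystal" where
  "L_crystal T \<alpha> \<alpha>v ws \<pi> =
     (path_crystal T \<alpha> \<alpha>v)\<lparr>elems := {\<eta> \<in> path_space T. pitman_word T \<alpha> \<alpha>v ws \<eta> = \<pi>}\<rparr>"

end

theory Submission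
  imports Defs
begin

text \<open>
  Record for a path \<open>\<eta>\<close> the string of depths \<open>\<epsilon>\<close> met while applying the Pitman transforms along a word
  of the longest element. Together with the dominant end product, the string determines \<open>\<eta>\<close>, so it
  suffices that matching paths by their strings commutes with every crystal operator. The operator
  for \<open>s\<close> changes only one entry of a string whose word starts its transforms with \<open>s\<close>; by
  Matsumoto's theorem all words are linked by braid moves, and it remains to see that in rank two the
  string for one of the two alternating words determines the string for the other.

  For this, consider infima of \<open>c\<^sub>1 a(\<eta>(t\<^sub>1)) + c\<^sub>2 b(\<eta>(t\<^sub>2)) + c\<^sub>3 a(\<eta>(t\<^sub>3)) + \<dots>\<close> over
  \<open>t\<^sub>1 \<ge> t\<^sub>2 \<ge> t\<^sub>3 \<ge> \<dots>\<close>, where \<open>a\<close>, \<open>b\<close> are the two coroots and the coefficients are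
  \<open>sin(k\<theta>) / sin \<theta>\<close>, \<open>\<theta> = \<pi> / m\<close>. With increasing coefficients (\<open>A\<close>-chains) they give the strings of
  \<open>\<eta>\<close> and are carried along by the Pitman transforms; with decreasing coefficients (\<open>D\<close>-chains) their
  values on \<open>\<eta>\<close> are determined by \<open>\<epsilon>\<close> and the values on a Pitman transform of \<open>\<eta>\<close>, hence by any string
  that ends at a dominant path. Time reversal exchanges the two kinds.
\<close>

section \<open>Running infima\<close>

text \<open>The transition between the two rank two strings is piecewise linear and grows
  complicated with m. It is never computed: only the implication from equal strings to equal strings
  is carried along, as a relation between two paths. Both directions of time enter because values of
  \<open>A\<close>-chains pass from a path to its transforms, values of \<open>D\<close>-chains from
  a transform back to the path. The coefficients are forced. Under the transform for a, the coroot a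
  gains 2 g and b loses 2 cos(theta) g for some function g. In an infimum over ordered times the
  gain of an a-letter can be split between the two neighbouring times, where it cancels the loss of
  b exactly if 2 cos(theta) c_(k+1) = c_k + c_(k+2). The solution starting with 0, 1 is 0 again at k
  = m, so finitely many chains form a closed system.\<close>

definition run_inf :: "(real \<Rightarrow> real) \<Rightarrow> real \<Rightarrow> real" where
  "run_inf f t = (INF s\<in>{0..t}. f s)"

lemma le_INF_interval_iff:
  fixes f :: "real \<Rightarrow> real"
  assumes "continuous_on {p..q} f" "p \<le> q"
  shows "c \<le> (INF s\<in>{p..q}. f s) \<longleftrightarrow> (\<forall>s\<in>{p..q}. c \<le> f s)"
proof -
  have "bdd_below (f ` {p..q})"
    using assms by (intro bounded_imp_bdd_below compact_imp_bounded compact_continuous_image) auto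
  then show ?thesis
    using assms(2) by (intro le_cINF_iff) auto
qed

lemma le_run_inf_iff:
  assumes "continuous_on {0..T} f" "0 \<le> t" "t \<le> T"
  shows "c \<le> run_inf f t \<longleftrightarrow> (\<forall>s\<in>{0..t}. c \<le> f s)"
  unfolding run_inf_def using assms
  by (intro le_INF_interval_iff) (auto intro: continuous_on_subset)

text \<open>Infima are compared throughout by their lower bounds: each bound becomes a bounded
  universal statement, and exchanging nested infima becomes exchanging quantifiers.\<close>

lemma real_eq_by_lower_bounds: "(\<And>c::real. c \<le> a \<longleftrightarrow> c \<le> b) \<Longrightarrow> a = b"
  by (meson order.refl antisym)

lemma run_inf_cong: "(\<And>s. 0 \<le> s \<Longrightarrow> s \<le> t \<Longrightarrow> f s = g s) \<Longrightarrow> run_inf f t = run_inf g t"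
  unfolding run_inf_def by (intro INF_cong) auto

context
  fixes f :: "real \<Rightarrow> real" and T :: real
  assumes cont: "continuous_on {0..T} f"
begin

lemma run_inf_le: "0 \<le> s \<Longrightarrow> s \<le> t \<Longrightarrow> t \<le> T \<Longrightarrow> run_inf f t \<le> f s"
  using le_run_inf_iff[OF cont, of t "run_inf f t"] by auto

lemma run_inf_antimono: "0 \<le> s \<Longrightarrow> s \<le> t \<Longrightarrow> t \<le> T \<Longrightarrow> run_inf f t \<le> run_inf f s"
  using le_run_inf_iff[OF cont, of s "run_inf f t"] run_inf_le by auto

lemma run_inf_attained: "0 \<le> t \<Longrightarrow> t \<le> T \<Longrightarrow> \<exists>s\<in>{0..t}. run_inf f t = f s"
proof -
  assume t: "0 \<le> t" "t \<le> T"
  have "continuous_on {0..t} f" using cont t by (auto intro: continuous_on_subset)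
  from continuous_attains_inf[OF _ _ this] t
  obtain s where s: "s \<in> {0..t}" "\<forall>y\<in>{0..t}. f s \<le> f y" by auto
  have "f s \<le> run_inf f t" using le_run_inf_iff[OF cont t] s by auto
  moreover have "run_inf f t \<le> f s" using run_inf_le s t by auto
  ultimately show ?thesis using s by (intro bexI[of _ s]) auto
qed

lemma run_inf_nonpos: "f 0 = 0 \<Longrightarrow> 0 \<le> t \<Longrightarrow> t \<le> T \<Longrightarrow> run_inf f t \<le> 0"
  using run_inf_le[of 0 t] by auto

lemma continuous_run_inf: "continuous_on {0..T} (run_inf f)"
  unfolding continuous_on_iff
proof (intro ballI allI impI)
  fix t e :: real assume t: "t \<in> {0..T}" and e: "e > 0"
  have "uniformly_continuous_on {0..T} f"
    using cont by (intro compact_uniformly_continuous) auto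
  then obtain d where d: "d > 0"
    "\<And>x y. x \<in> {0..T} \<Longrightarrow> y \<in> {0..T} \<Longrightarrow> dist y x < d \<Longrightarrow> dist (f y) (f x) < e / 2"
    unfolding uniformly_continuous_on_def using e by (metis half_gt_zero)
  \<comment> \<open>The modulus of uniform continuity of \<open>f\<close> also serves for
    \<open>run_inf f\<close>: a value undercutting the old infimum is taken after time
    \<open>r\<close>, hence is close to \<open>f r\<close>, which lies above that infimum.\<close>
  have key: "run_inf f r - e / 2 \<le> run_inf f r'" if "0 \<le> r" "r \<le> r'" "r' \<le> T" "r' - r < d" for r r'
  proof -
    have "run_inf f r - e / 2 \<le> f s" if s: "0 \<le> s" "s \<le> r'" for s
    proof (cases "s \<le> r")
      case True
      then show ?thesis using run_inf_le[of s r] s \<open>r \<le> r'\<close> \<open>r' \<le> T\<close> e by auto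
    next
      case False
      then have "dist (f s) (f r) < e / 2" using d(2)[of r s] that s \<open>r' - r < d\<close> \<open>0 \<le> r\<close> \<open>r' \<le> T\<close>
        by (auto simp: dist_real_def)
      moreover have "run_inf f r \<le> f r" using run_inf_le[of r r] \<open>0 \<le> r\<close> \<open>r \<le> r'\<close> \<open>r' \<le> T\<close> by auto
      ultimately show ?thesis unfolding dist_real_def by linarith
    qed
    then show ?thesis using le_run_inf_iff[OF cont, of r'] that by auto
  qed
  show "\<exists>d>0. \<forall>t'\<in>{0..T}. dist t' t < d \<longrightarrow> dist (run_inf f t') (run_inf f t) < e"
  proof (intro exI[of _ d] conjI ballI impI)
    fix t' assume t': "t' \<in> {0..T}" "dist t' t < d"
    show "dist (run_inf f t') (run_inf f t) < e"
    proof (cases "t \<le> t'")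
      case True
      then show ?thesis
        using key[of t t'] run_inf_antimono[of t t'] t t' e unfolding dist_real_def by force
    next
      case False
      then show ?thesis
        using key[of t' t] run_inf_antimono[of t' t] t t' e unfolding dist_real_def by force
    qed
  qed (fact d(1))
qed

text \<open>The witness is the first time in \<open>{p..q}\<close> at which \<open>f\<close> falls
  to its old infimum. By the intermediate value theorem that level is hit exactly, and nothing lower
  has occurred before.\<close>

lemma run_inf_first_passage:
  assumes pq: "0 \<le> p" "p \<le> q" "q \<le> T" and less: "run_inf f q < run_inf f p"
  shows "\<exists>s\<in>{p..q}. f s = run_inf f p \<and> run_inf f s = run_inf f p"
proof -
  let ?K = "{s \<in> {p..q}. f s \<le> run_inf f p}"
  have cpq: "continuous_on {p..q} f" using cont pq by (auto intro: continuous_on_subset)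
  have "compact ?K"
    using continuous_closed_preimage[OF cpq, of "{..run_inf f p}"]
    by (auto simp: compact_eq_bounded_closed vimage_def Int_def conj_commute
        intro: bounded_subset[of "{p..q}"])
  moreover have "?K \<noteq> {}"
  proof -
    obtain s where s: "s \<in> {0..q}" "run_inf f q = f s"
      using run_inf_attained[of q] pq by auto
    with less pq have "\<not> s \<le> p" using run_inf_le[of s p] by auto
    with s less show ?thesis by auto
  qed
  ultimately obtain s0 where s0: "s0 \<in> ?K" "\<And>s. s \<in> ?K \<Longrightarrow> s0 \<le> s"
    using compact_attains_inf[of ?K] by blast
  have "run_inf f p \<le> f p" using run_inf_le pq by auto
  moreover have "continuous_on {p..s0} f" using cpq s0(1) by (auto intro: continuous_on_subset)
  ultimately obtain s1 where "p \<le> s1" "s1 \<le> s0" "f s1 = run_inf f p"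
    using IVT2'[of f s0 "run_inf f p" p] s0(1) by auto
  then have eq: "f s0 = run_inf f p" using s0(2)[of s1] s0(1) by auto
  have "run_inf f p \<le> f s" if "0 \<le> s" "s \<le> s0" for s
  proof (cases "s \<le> p")
    case True then show ?thesis using run_inf_le that pq by auto
  next
    case False
    then show ?thesis using s0(2)[of s] s0(1) that eq by force
  qed
  then have "run_inf f p \<le> run_inf f s0"
    using le_run_inf_iff[OF cont, of s0] s0(1) pq by auto
  moreover have "run_inf f s0 \<le> run_inf f p" using run_inf_antimono s0(1) pq by auto
  ultimately show ?thesis using eq s0(1) by (intro bexI[of _ s0]) auto
qed

end

text \<open>Equality of the infima of \<open>f + 2 g\<close> and of \<open>f + g p + g q\<close> over \<open>[p, q]\<close>, phrased by lower bounds.\<close>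

definition reflecting_shift :: "real \<Rightarrow> (real \<Rightarrow> real) \<Rightarrow> (real \<Rightarrow> real) \<Rightarrow> bool" where
  "reflecting_shift T f g \<longleftrightarrow> (\<forall>p q y. 0 \<le> p \<longrightarrow> p \<le> q \<longrightarrow> q \<le> T \<longrightarrow>
     (\<forall>s\<in>{p..q}. y \<le> f s + 2 * g s) = (\<forall>s\<in>{p..q}. y \<le> f s + g p + g q))"

text \<open>Write m for the running infimum. If m is constant on \<open>{p..q}\<close>, both sides
  agree. Otherwise f reaches m(q) inside the interval, so inf f - m(p) - m(q) is -m(p); and f - 2m
  is at least -m, hence at least -m(p), with equality at the first passage of the level
  m(p).\<close>

lemma reflecting_shift_run_inf:
  assumes cont: "continuous_on {0..T} f"
  shows "reflecting_shift T f (\<lambda>t. - run_inf f t)"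
  unfolding reflecting_shift_def
proof (intro allI impI iffI ballI)
  fix p q y s
  assume pq: "0 \<le> p" "p \<le> q" "q \<le> T" and s: "s \<in> {p..q}"
  note anti = run_inf_antimono[OF cont] and le = run_inf_le[OF cont]
  {
    assume y: "\<forall>s\<in>{p..q}. y \<le> f s + 2 * - run_inf f s"
    show "y \<le> f s + - run_inf f p + - run_inf f q"
    proof (cases "run_inf f q = run_inf f p")
      case True
      then have "run_inf f s = run_inf f p" using anti[of p s] anti[of s q] pq s by auto
      then show ?thesis using y s True by force
    next
      case False
      then have "run_inf f q < run_inf f p" using anti[of p q] pq by auto
      from run_inf_first_passage[OF cont pq this] obtain s0 where
        "s0 \<in> {p..q}" "f s0 = run_inf f p" "run_inf f s0 = run_inf f p" by auto
      then have "y \<le> - run_inf f p" using y by force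
      moreover have "run_inf f q \<le> f s" using le s pq by auto
      ultimately show ?thesis by auto
    qed
  next
    assume y: "\<forall>s\<in>{p..q}. y \<le> f s + - run_inf f p + - run_inf f q"
    have ps: "run_inf f s \<le> run_inf f p" "run_inf f s \<le> f s"
      using anti[of p s] le[of s s] pq s by auto
    show "y \<le> f s + 2 * - run_inf f s"
    proof (cases "run_inf f q = run_inf f s")
      case True
      then show ?thesis using y s ps by force
    next
      case False
      then have less: "run_inf f q < run_inf f s" using anti[of s q] s pq by auto
      obtain s' where s': "s' \<in> {0..q}" "run_inf f q = f s'"
        using run_inf_attained[OF cont, of q] pq by auto
      with less have "\<not> s' \<le> s" using le[of s' s] s pq by auto
      then have "s' \<in> {p..q}" using s s' by auto
      then show ?thesis using y s' ps by force
    qed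
  }
qed

text \<open>Replacing \<open>y\<close> by \<open>y + g p + g q\<close> undoes the shift. This allows
  chains of a path to be expressed by those of its Pitman transform, the direction taken by
  \<open>D\<close>-chains.\<close>

lemma reflecting_shift_inverse:
  assumes "reflecting_shift T f g"
  shows "reflecting_shift T (\<lambda>t. f t + 2 * g t) (\<lambda>t. - g t)"
  unfolding reflecting_shift_def
proof (intro allI impI)
  fix p q y assume pq: "0 \<le> p" "p \<le> q" "q \<le> T"
  have "(\<forall>s\<in>{p..q}. y + g p + g q \<le> f s + 2 * g s) = (\<forall>s\<in>{p..q}. y + g p + g q \<le> f s + g p + g q)"
    using assms pq unfolding reflecting_shift_def by blast
  then show "(\<forall>s\<in>{p..q}. y \<le> f s + 2 * g s + 2 * - g s) = (\<forall>s\<in>{p..q}. y \<le> f s + 2 * g s + - g p + - g q)"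
    by (auto simp: algebra_simps)
qed

lemma reflecting_shift_scaled:
  assumes "reflecting_shift T f g" "0 \<le> p" "p \<le> q" "q \<le> T" "0 \<le> k"
  shows "(\<forall>s\<in>{p..q}. y \<le> k * (f s + 2 * g s)) = (\<forall>s\<in>{p..q}. y \<le> k * (f s + g p + g q))"
proof (cases "k = 0")
  case False
  then have *: "y \<le> k * z \<longleftrightarrow> y / k \<le> z" for z using assms(5) by (auto simp: field_simps)
  show ?thesis unfolding * using assms(1-4) unfolding reflecting_shift_def by blast
qed auto

text \<open>Inversion of the one-dimensional Pitman transform: -m(s) is the minimum of -m(T) and the
  infimum of f - 2m over \<open>{s..T}\<close>. If m still drops after s, the reflecting shift makes
  that infimum equal to -m(s); if not, then m(s) = m(T) and the infimum is at least -m(s).\<close>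

lemma run_inf_recover:
  assumes cont: "continuous_on {0..T} f" and s: "0 \<le> s" "s \<le> T"
  shows "y \<le> - run_inf f s \<longleftrightarrow> y \<le> - run_inf f T \<and> (\<forall>r\<in>{s..T}. y \<le> f r - 2 * run_inf f r)"
proof -
  let ?m = "run_inf f"
  have anti: "?m T \<le> ?m s" using run_inf_antimono[OF cont] s by auto
  have rf: "(\<forall>r\<in>{s..T}. y \<le> f r - 2 * ?m r) = (\<forall>r\<in>{s..T}. y \<le> f r - ?m s - ?m T)"
    using reflecting_shift_run_inf[OF cont] s unfolding reflecting_shift_def by (simp add: algebra_simps)
  have ge: "?m T \<le> f r" if "r \<in> {s..T}" for r using run_inf_le[OF cont] that s by auto
  show ?thesis
  proof (cases "?m T = ?m s")
    case True
    then show ?thesis unfolding rf using ge by fastforce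
  next
    case False
    then have less: "?m T < ?m s" using anti by auto
    obtain s' where s': "s' \<in> {0..T}" "?m T = f s'"
      using run_inf_attained[OF cont, of T] s by auto
    with less have "\<not> s' \<le> s" using run_inf_le[OF cont, of s' s] s by auto
    then have "s' \<in> {s..T}" using s' by auto
    then show ?thesis unfolding rf using ge s' anti by fastforce
  qed
qed

section \<open>Chain functionals\<close>

text \<open>The weight \<open>w 0\<close> belongs to the earliest time; the letter at the latest time is \<open>x\<close>, so which letter
  comes earliest depends on the parity of the length.\<close>

primrec chain :: "nat \<Rightarrow> (nat \<Rightarrow> real) \<Rightarrow> (real \<Rightarrow> real) \<Rightarrow> (real \<Rightarrow> real) \<Rightarrow> real \<Rightarrow> real" where
  "chain 0 w x y = (\<lambda>t. 0)"
| "chain (Suc n) w x y = run_inf (\<lambda>s. w n * x s + chain n w y x s)"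

lemma continuous_chain:
  "continuous_on {0..T} x \<Longrightarrow> continuous_on {0..T} y \<Longrightarrow> continuous_on {0..T} (chain n w x y)"
  by (induction n arbitrary: x y) (auto intro!: continuous_run_inf continuous_intros)

lemma chain_cong:
  assumes "\<And>i. i < n \<Longrightarrow> w i = w' i"
    and "\<And>s. 0 \<le> s \<Longrightarrow> s \<le> t \<Longrightarrow> x s = x' s" "\<And>s. 0 \<le> s \<Longrightarrow> s \<le> t \<Longrightarrow> y s = y' s"
  shows "chain n w x y t = chain n w' x' y' t"
  using assms
proof (induction n arbitrary: x y x' y' t)
  case (Suc n)
  have "w n * x s + chain n w y x s = w' n * x' s + chain n w' y' x' s" if "0 \<le> s" "s \<le> t" for s
    using Suc.IH[of s y y' x x'] Suc.prems that by auto
  then show ?case by (auto intro!: run_inf_cong)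
qed auto

lemma le_chain_Suc_iff:
  assumes "continuous_on {0..T} x" "continuous_on {0..T} y" "0 \<le> t" "t \<le> T"
  shows "c \<le> chain (Suc n) w x y t \<longleftrightarrow> (\<forall>s\<in>{0..t}. c \<le> w n * x s + chain n w y x s)"
  unfolding chain.simps using assms
  by (intro le_run_inf_iff[where T = T]) (auto intro!: continuous_intros continuous_chain)

lemma chain_antimono:
  assumes "continuous_on {0..T} x" "continuous_on {0..T} y" "0 \<le> s" "s \<le> t" "t \<le> T"
  shows "chain n w x y t \<le> chain n w x y s"
proof (cases n)
  case (Suc k)
  then show ?thesis unfolding Suc chain.simps using assms
    by (intro run_inf_antimono[where T = T]) (auto intro!: continuous_intros continuous_chain)
qed auto

lemma run_inf_eq_0:
  assumes "\<And>s. 0 \<le> s \<Longrightarrow> s \<le> t \<Longrightarrow> 0 \<le> f s" "f 0 = 0" "0 \<le> t"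
  shows "run_inf f t = 0"
proof (rule antisym)
  have "bdd_below (f ` {0..t})" using assms(1) by (intro bdd_belowI[of _ 0]) auto
  then show "run_inf f t \<le> 0" unfolding run_inf_def using assms cINF_lower[of f "{0..t}" 0] by auto
  show "0 \<le> run_inf f t" unfolding run_inf_def using assms by (intro cINF_greatest) auto
qed

lemma chain_eq_0:
  assumes "\<And>i. i < n \<Longrightarrow> 0 \<le> w i" "\<And>s. 0 \<le> s \<Longrightarrow> s \<le> t \<Longrightarrow> 0 \<le> x s" "x 0 = 0"
    "\<And>s. 0 \<le> s \<Longrightarrow> s \<le> t \<Longrightarrow> 0 \<le> y s" "y 0 = 0" "0 \<le> t"
  shows "chain n w x y t = 0"
  using assms
proof (induction n arbitrary: x y t)
  case (Suc n)
  have *: "chain n w y x s = 0" if "0 \<le> s" "s \<le> t" for s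
    using that Suc.prems by (intro Suc.IH) auto
  show ?case unfolding chain.simps using Suc.prems * by (intro run_inf_eq_0) auto
qed auto

text \<open>The earliest time is bounded above only by the next one, so it may be moved to 0, where
  its nonnegative term vanishes. The parity of \<open>n\<close> decides which letter stands
  there.\<close>

lemma chain_drop_first:
  assumes "\<And>s. 0 \<le> s \<Longrightarrow> s \<le> t \<Longrightarrow> 0 \<le> w 0 * (if even n then x else y) s"
    and "(if even n then x else y) 0 = 0" "0 \<le> t"
  shows "chain (Suc n) w x y t = chain n (\<lambda>i. w (Suc i)) x y t"
  using assms
proof (induction n arbitrary: x y t)
  case 0
  then have "run_inf (\<lambda>s. w 0 * x s + 0) t = 0" by (intro run_inf_eq_0) simp_all
  then show ?case by simp
next
  case (Suc n)
  have sw: "(if even (Suc n) then x else y) = (if even n then y else x)" by simp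
  have "chain (Suc n) w y x s = chain n (\<lambda>i. w (Suc i)) y x s" if "0 \<le> s" "s \<le> t" for s
    by (rule Suc.IH) (use Suc.prems that in \<open>simp_all only: sw order.trans[OF _ that(2)]\<close>)
  then show ?case
    unfolding chain.simps(2)[of "Suc n" w] chain.simps(2)[of n "\<lambda>i. w (Suc i)"]
    by (intro run_inf_cong) simp
qed

text \<open>By the reflecting shift, an x-letter of weight w between times p and q hands w g(p) and
  w g(q) to its neighbours. An inner y-letter thus receives g times the sum of the neighbouring
  weights, which the recurrence cancels against its own loss. At the early end nothing is left if
  the letter is x, since g(0) = 0, or if c w(0) = w(1); hence the parity conditions. The late end
  leaves w(i) g(t) for x and, for y, minus the share of the missing neighbour. The two claims feed
  each other in the induction.\<close>

lemma chain_move: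
  fixes x y g :: "real \<Rightarrow> real" and c :: real
  defines "x' \<equiv> \<lambda>s. x s + 2 * g s" and "y' \<equiv> \<lambda>s. y s - c * g s"
  assumes cont: "continuous_on {0..T} x" "continuous_on {0..T} y" "continuous_on {0..T} g"
    and g0: "g 0 = 0" and shift: "reflecting_shift T x g"
    and nonneg: "\<And>i. i < n \<Longrightarrow> 0 \<le> w i"
    and rec: "\<And>i. Suc (Suc i) \<le> n \<Longrightarrow> c * w (Suc i) = w i + w (Suc (Suc i))"
  shows "Suc i \<le> n \<Longrightarrow> 0 \<le> t \<Longrightarrow> t \<le> T \<Longrightarrow>
      (c * w 0 = w 1 \<or> even i \<longrightarrow>
        chain (Suc i) w x' y' t = chain (Suc i) w x y t + w i * g t) \<and>
      (c * w 0 = w 1 \<or> odd i \<longrightarrow>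
        chain (Suc i) w y' x' t = run_inf (\<lambda>s. w i * y s + chain i w x y s - w (Suc i) * g s) t)"
proof (induction i arbitrary: t)
  have cont': "continuous_on {0..T} x'" "continuous_on {0..T} y'"
    unfolding x'_def y'_def using cont by (auto intro!: continuous_intros)
  note conts = cont cont'
  {
    case (0 t)
    have "chain (Suc 0) w x' y' t = chain (Suc 0) w x y t + w 0 * g t"
    proof (rule real_eq_by_lower_bounds)
      fix b
      have "b \<le> chain (Suc 0) w x' y' t \<longleftrightarrow> (\<forall>s\<in>{0..t}. b \<le> w 0 * (x s + 2 * g s))"
        using le_chain_Suc_iff[OF cont' 0(2,3), of b 0 w] by (simp add: x'_def del: chain.simps(2))
      also have "\<dots> \<longleftrightarrow> (\<forall>s\<in>{0..t}. b \<le> w 0 * (x s + g 0 + g t))"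
        using 0 nonneg by (intro reflecting_shift_scaled[OF shift]) auto
      also have "\<dots> \<longleftrightarrow> (\<forall>s\<in>{0..t}. b - w 0 * g t \<le> w 0 * x s + chain 0 w y x s)"
        by (simp add: algebra_simps g0)
      also have "\<dots> \<longleftrightarrow> b - w 0 * g t \<le> chain (Suc 0) w x y t"
        using le_chain_Suc_iff[OF cont(1,2) 0(2,3), of "b - w 0 * g t" 0 w] by (simp del: chain.simps(2))
      finally show "b \<le> chain (Suc 0) w x' y' t \<longleftrightarrow> b \<le> chain (Suc 0) w x y t + w 0 * g t" by auto
    qed
    moreover have "w 0 * y' s + chain 0 w x' y' s = w 0 * y s + chain 0 w x y s - w (Suc 0) * g s"
      if "c * w 0 = w 1" for s
    proof -
      have "w (Suc 0) = c * w 0" using that by simp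
      then show ?thesis by (simp add: y'_def algebra_simps)
    qed
    ultimately show ?case unfolding chain.simps(2)[of 0] by auto
  next
    case (Suc i t)
    let ?h = "\<lambda>r. w i * y r + chain i w x y r"
    have h: "continuous_on {0..T} ?h" using conts by (auto intro!: continuous_intros continuous_chain)
    have "chain (Suc (Suc i)) w x' y' t = chain (Suc (Suc i)) w x y t + w (Suc i) * g t"
      if par: "c * w 0 = w 1 \<or> even (Suc i)"
    proof (rule real_eq_by_lower_bounds)
      fix b
      have eq: "chain (Suc i) w y' x' s = run_inf (\<lambda>s. ?h s - w (Suc i) * g s) s" if "0 \<le> s" "s \<le> t" for s
        using Suc.IH[of s] Suc.prems that par by auto
      have "b \<le> chain (Suc (Suc i)) w x' y' t \<longleftrightarrow>
          (\<forall>s\<in>{0..t}. b - w (Suc i) * x' s \<le> chain (Suc i) w y' x' s)"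
        using le_chain_Suc_iff[OF cont' Suc.prems(2,3), of b "Suc i" w]
        by (simp add: diff_le_eq add.commute del: chain.simps(2))
      also have "\<dots> \<longleftrightarrow> (\<forall>s\<in>{0..t}. b - w (Suc i) * x' s \<le> run_inf (\<lambda>s. ?h s - w (Suc i) * g s) s)"
        using eq by (intro ball_cong) (auto simp del: chain.simps(2))
      also have "\<dots> \<longleftrightarrow> (\<forall>s\<in>{0..t}. \<forall>r\<in>{0..s}. b - w (Suc i) * x' s \<le> ?h r - w (Suc i) * g r)"
        using Suc.prems h cont by (intro ball_cong HOL.refl le_run_inf_iff[where T = T]) (auto intro!: continuous_intros)
      \<comment> \<open>With r fixed, the x-time s runs over \<open>{r..t}\<close>, an interval to
        which \<open>shift\<close> applies.\<close>
      also have "\<dots> \<longleftrightarrow> (\<forall>r\<in>{0..t}. \<forall>s\<in>{r..t}. b - w (Suc i) * x' s \<le> ?h r - w (Suc i) * g r)"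
        by (meson atLeastAtMost_iff order.trans)
      also have "\<dots> \<longleftrightarrow> (\<forall>r\<in>{0..t}. \<forall>s\<in>{r..t}. b + w (Suc i) * g r - ?h r \<le> w (Suc i) * (x s + 2 * g s))"
      proof -
        have "b - k \<le> l - m \<longleftrightarrow> b + m - l \<le> k" for k l m :: real by linarith
        then show ?thesis by (simp only: x'_def)
      qed
      also have "\<dots> \<longleftrightarrow> (\<forall>r\<in>{0..t}. \<forall>s\<in>{r..t}. b + w (Suc i) * g r - ?h r \<le> w (Suc i) * (x s + g r + g t))"
        using Suc.prems nonneg by (intro ball_cong HOL.refl reflecting_shift_scaled[OF shift]) auto
      also have "\<dots> \<longleftrightarrow> (\<forall>r\<in>{0..t}. \<forall>s\<in>{r..t}. b - w (Suc i) * g t - w (Suc i) * x s \<le> ?h r)"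
        by (intro ball_cong HOL.refl) (auto simp: algebra_simps)
      also have "\<dots> \<longleftrightarrow> (\<forall>s\<in>{0..t}. \<forall>r\<in>{0..s}. b - w (Suc i) * g t - w (Suc i) * x s \<le> ?h r)"
        by (meson atLeastAtMost_iff order.trans)
      also have "\<dots> \<longleftrightarrow> (\<forall>s\<in>{0..t}. b - w (Suc i) * g t - w (Suc i) * x s \<le> chain (Suc i) w y x s)"
        using Suc.prems le_chain_Suc_iff[OF cont(2,1)] by (intro ball_cong) (auto simp del: chain.simps(2))
      also have "\<dots> \<longleftrightarrow> (\<forall>s\<in>{0..t}. b - w (Suc i) * g t \<le> w (Suc i) * x s + chain (Suc i) w y x s)"
      proof -
        have "k - l \<le> m \<longleftrightarrow> k \<le> l + m" for k l m :: real by linarith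
        then show ?thesis by (simp only:)
      qed
      also have "\<dots> \<longleftrightarrow> b - w (Suc i) * g t \<le> chain (Suc (Suc i)) w x y t"
        using le_chain_Suc_iff[OF cont(1,2) Suc.prems(2,3), of "b - w (Suc i) * g t" "Suc i" w] by blast
      finally show "b \<le> chain (Suc (Suc i)) w x' y' t \<longleftrightarrow>
          b \<le> chain (Suc (Suc i)) w x y t + w (Suc i) * g t" by (simp only: diff_le_eq)
    qed
    moreover have "w (Suc i) * y' s + chain (Suc i) w x' y' s =
        w (Suc i) * y s + chain (Suc i) w x y s - w (Suc (Suc i)) * g s"
      if "0 \<le> s" "s \<le> t" "c * w 0 = w 1 \<or> odd (Suc i)" for s
    proof -
      have "chain (Suc i) w x' y' s = chain (Suc i) w x y s + w i * g s"
        using Suc.IH[of s] Suc.prems that by auto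
      moreover have "c * w (Suc i) * g s = (w i + w (Suc (Suc i))) * g s"
        using rec[of i] Suc.prems by simp
      ultimately show ?thesis unfolding y'_def by (simp add: algebra_simps del: chain.simps(2))
    qed
    ultimately show ?case unfolding chain.simps(2)[of "Suc i"] by (auto intro!: run_inf_cong)
  }
qed

text \<open>The recursion singles out the latest time; time reversal has to act on the symmetric
  description by ordered tuples of times.\<close>

lemma le_chain_iff:
  assumes "continuous_on {0..T} x" "continuous_on {0..T} y" "0 \<le> t" "t \<le> T"
  shows "c \<le> chain n w x y t \<longleftrightarrow> (\<forall>\<sigma>. (\<forall>i<n. 0 \<le> \<sigma> i \<and> \<sigma> i \<le> t) \<and> (\<forall>i j. i \<le> j \<longrightarrow> j < n \<longrightarrow> \<sigma> i \<le> \<sigma> j) \<longrightarrow>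
    c \<le> (\<Sum>i<n. w i * (if even (n - Suc i) then x (\<sigma> i) else y (\<sigma> i))))"
  using assms
proof (induction n arbitrary: x y t c)
  case 0
  then show ?case by auto
next
  case (Suc n)
  let ?adm = "\<lambda>n t (\<sigma> :: nat \<Rightarrow> real). (\<forall>i<n. 0 \<le> \<sigma> i \<and> \<sigma> i \<le> t) \<and> (\<forall>i j. i \<le> j \<longrightarrow> j < n \<longrightarrow> \<sigma> i \<le> \<sigma> j)"
  let ?S = "\<lambda>n x y \<sigma>. \<Sum>i<n. w i * (if even (n - Suc i) then x (\<sigma> i) else y (\<sigma> i))"
  have sum: "?S (Suc n) x y \<sigma> = ?S n y x \<sigma> + w n * x (\<sigma> n)" for \<sigma>
  proof -
    have "(\<Sum>i<n. w i * (if even (Suc n - Suc i) then x (\<sigma> i) else y (\<sigma> i))) = ?S n y x \<sigma>"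
      by (intro sum.cong) (auto simp: Suc_diff_Suc[symmetric])
    then show ?thesis by simp
  qed
  have "c \<le> chain (Suc n) w x y t \<longleftrightarrow> (\<forall>s\<in>{0..t}. c - w n * x s \<le> chain n w y x s)"
    using le_chain_Suc_iff[OF Suc.prems] by (simp add: algebra_simps del: chain.simps(2))
  also have "\<dots> \<longleftrightarrow> (\<forall>s\<in>{0..t}. \<forall>\<sigma>. ?adm n s \<sigma> \<longrightarrow> c - w n * x s \<le> ?S n y x \<sigma>)"
    using Suc.prems by (intro ball_cong HOL.refl Suc.IH) auto
  also have "\<dots> \<longleftrightarrow> (\<forall>\<sigma>. ?adm (Suc n) t \<sigma> \<longrightarrow> c \<le> ?S (Suc n) x y \<sigma>)" (is "?L \<longleftrightarrow> ?R")
  proof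
    assume L: ?L
    show ?R
    proof (intro allI impI)
      fix \<sigma> assume a: "?adm (Suc n) t \<sigma>"
      then have "\<sigma> n \<in> {0..t}" "?adm n (\<sigma> n) \<sigma>" by auto
      then have "c - w n * x (\<sigma> n) \<le> ?S n y x \<sigma>" using L by blast
      then show "c \<le> ?S (Suc n) x y \<sigma>" unfolding sum by linarith
    qed
  next
    assume R: ?R
    show ?L
    proof (intro ballI allI impI)
      fix s \<sigma> assume s: "s \<in> {0..t}" and a: "?adm n s \<sigma>"
      let ?\<sigma> = "\<sigma>(n := s)"
      have "?adm (Suc n) t ?\<sigma>"
      proof (intro conjI allI impI)
        fix i j assume "i \<le> j" "j < Suc n"
        then show "?\<sigma> i \<le> ?\<sigma> j" using a by (cases "j = n") auto
      qed (use a s in \<open>auto simp: less_Suc_eq intro: order.trans\<close>)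
      then have "c \<le> ?S (Suc n) x y ?\<sigma>" using R by blast
      moreover have "?S n y x ?\<sigma> = ?S n y x \<sigma>" by (intro sum.cong) auto
      ultimately show "c - w n * x s \<le> ?S n y x \<sigma>" unfolding sum by simp
    qed
  qed
  finally show ?case .
qed

text \<open>Reverse the tuple and subtract it from T. The latest letter of the new chain is the
  earliest one of the old chain, which is x for odd n; the subtracted end values contribute a
  constant.\<close>

lemma chain_reverse:
  assumes cont: "continuous_on {0..T} x" "continuous_on {0..T} y" and T: "0 \<le> T"
  shows "chain n w (\<lambda>t. x (T - t) - x T) (\<lambda>t. y (T - t) - y T) T =
    chain n (\<lambda>i. w (n - Suc i)) (if odd n then x else y) (if odd n then y else x) T
    - (\<Sum>i<n. w i * (if even (n - Suc i) then x T else y T))"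
proof (rule real_eq_by_lower_bounds)
  fix c
  let ?x = "\<lambda>t. x (T - t) - x T" and ?y = "\<lambda>t. y (T - t) - y T"
  let ?X = "if odd n then x else y" and ?Y = "if odd n then y else x"
  let ?adm = "\<lambda>(\<sigma> :: nat \<Rightarrow> real). (\<forall>i<n. 0 \<le> \<sigma> i \<and> \<sigma> i \<le> T) \<and> (\<forall>i j. i \<le> j \<longrightarrow> j < n \<longrightarrow> \<sigma> i \<le> \<sigma> j)"
  let ?e = "\<Sum>i<n. w i * (if even (n - Suc i) then x T else y T)"
  let ?S = "\<lambda>\<sigma>. \<Sum>i<n. w i * (if even (n - Suc i) then ?x (\<sigma> i) else ?y (\<sigma> i))"
  let ?R = "\<lambda>\<sigma>. \<Sum>i<n. w (n - Suc i) * (if even (n - Suc i) then ?X (\<sigma> i) else ?Y (\<sigma> i))"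
  let ?rev = "\<lambda>\<sigma> i. T - \<sigma> (n - Suc i)"
  have c: "continuous_on {0..T} (\<lambda>t. z (T - t) - z T)" if "continuous_on {0..T} z" for z :: "real \<Rightarrow> real"
  proof -
    have "continuous_on {0..T} (\<lambda>t. z (T - t))"
      by (rule continuous_on_compose2[OF that]) (auto intro!: continuous_intros)
    then show ?thesis by (intro continuous_intros)
  qed
  have adm: "?adm (?rev \<sigma>)" if "?adm \<sigma>" for \<sigma>
  proof (intro conjI allI impI)
    fix i j assume ij: "i \<le> j" "j < n"
    then have "\<sigma> (n - Suc j) \<le> \<sigma> (n - Suc i)" using that by auto
    then show "?rev \<sigma> i \<le> ?rev \<sigma> j" by simp
  qed (use that in auto)
  have SR: "?S (?rev \<sigma>) = ?R \<sigma> - ?e" for \<sigma>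
  proof -
    have "?R \<sigma> = (\<Sum>i<n. w (n - Suc (n - Suc i)) * (if even (n - Suc (n - Suc i)) then ?X (\<sigma> (n - Suc i)) else ?Y (\<sigma> (n - Suc i))))"
      by (rule sum.nat_diff_reindex[symmetric])
    also have "\<dots> = (\<Sum>i<n. w i * (if even (n - Suc i) then x (\<sigma> (n - Suc i)) else y (\<sigma> (n - Suc i))))"
      by (intro sum.cong HOL.refl) auto
    finally have R: "?R \<sigma> = (\<Sum>i<n. w i * (if even (n - Suc i) then x (\<sigma> (n - Suc i)) else y (\<sigma> (n - Suc i))))" .
    have pt: "w i * (if even (n - Suc i) then x (\<sigma> (n - Suc i)) else y (\<sigma> (n - Suc i))) -
          w i * (if even (n - Suc i) then x T else y T) =
        w i * (if even (n - Suc i) then ?x (?rev \<sigma> i) else ?y (?rev \<sigma> i))" for i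
      by (cases "even (n - Suc i)") (simp_all add: right_diff_distrib)
    show ?thesis unfolding R sum_subtractf[symmetric] pt ..
  qed
  have SR2: "?S \<sigma> = ?R (?rev \<sigma>) - ?e" for \<sigma>
  proof -
    have "?S \<sigma> = ?S (?rev (?rev \<sigma>))" by (intro sum.cong) simp_all
    also have "\<dots> = ?R (?rev \<sigma>) - ?e" by (rule SR)
    finally show ?thesis .
  qed
  have all: "(\<forall>\<sigma>. ?adm \<sigma> \<longrightarrow> c \<le> ?S \<sigma>) \<longleftrightarrow> (\<forall>\<sigma>. ?adm \<sigma> \<longrightarrow> c + ?e \<le> ?R \<sigma>)"
  proof -
    define adm S R e rev where defs: "adm = ?adm" "S = ?S" "R = ?R" "e = ?e" "rev = ?rev"
    have "adm \<sigma> \<Longrightarrow> adm (rev \<sigma>)" "S (rev \<sigma>) = R \<sigma> - e" "S \<sigma> = R (rev \<sigma>) - e" for \<sigma>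
      unfolding defs by (fact adm, fact SR, fact SR2)
    then have "(\<forall>\<sigma>. adm \<sigma> \<longrightarrow> c \<le> S \<sigma>) \<longleftrightarrow> (\<forall>\<sigma>. adm \<sigma> \<longrightarrow> c + e \<le> R \<sigma>)"
      by (metis le_diff_eq)
    then show ?thesis unfolding defs .
  qed
  have "c \<le> chain n w ?x ?y T \<longleftrightarrow> (\<forall>\<sigma>. ?adm \<sigma> \<longrightarrow> c \<le> ?S \<sigma>)"
    by (rule le_chain_iff[OF c[OF cont(1)] c[OF cont(2)] T order.refl])
  also have "\<dots> \<longleftrightarrow> c + ?e \<le> chain n (\<lambda>i. w (n - Suc i)) ?X ?Y T"
    unfolding all by (rule le_chain_iff[symmetric, OF _ _ T order.refl]) (use cont in simp_all)
  finally show "c \<le> chain n w ?x ?y T \<longleftrightarrow> c \<le> chain n (\<lambda>i. w (n - Suc i)) ?X ?Y T - ?e"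
    by (simp only: le_diff_eq)
qed

section \<open>Chains with dihedral coefficients\<close>

text \<open>The value U_(k-1)(cos(pi/m)) of a Chebyshev polynomial of the second kind. Consecutive
  values are the coordinates of the roots of the dihedral group of order 2m in two simple roots of
  equal length.\<close>

definition sin_ratio :: "nat \<Rightarrow> nat \<Rightarrow> real" where
  "sin_ratio m k = sin (real k * (pi / real m)) / sin (pi / real m)"

context
  fixes m :: nat
  assumes m: "2 \<le> m"
begin

lemma sin_pi_over_pos: "0 < sin (pi / real m)"
  using m by (intro sin_gt_zero) (auto simp: field_simps)

lemma sin_ratio_0 [simp]: "sin_ratio m 0 = 0"
  by (simp add: sin_ratio_def)

lemma sin_ratio_1 [simp]: "sin_ratio m (Suc 0) = 1"
  using sin_pi_over_pos by (simp add: sin_ratio_def)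

lemma sin_ratio_self [simp]: "sin_ratio m m = 0"
  using m by (simp add: sin_ratio_def)

lemma sin_ratio_nonneg: "k \<le> m \<Longrightarrow> 0 \<le> sin_ratio m k"
  unfolding sin_ratio_def using m sin_pi_over_pos
  by (intro divide_nonneg_pos sin_ge_zero) (auto simp: field_simps)

lemma sin_ratio_rec:
  "2 * cos (pi / real m) * sin_ratio m (Suc k) = sin_ratio m k + sin_ratio m (Suc (Suc k))"
proof -
  define \<theta> where "\<theta> = pi / real m"
  have "sin (real k * \<theta>) + sin (real (Suc (Suc k)) * \<theta>) = 2 * cos \<theta> * sin (real (Suc k) * \<theta>)"
    by (simp add: sin_plus_sin algebra_simps add_divide_distrib diff_divide_distrib)
  then show ?thesis unfolding sin_ratio_def \<theta>_def[symmetric] by (simp add: add_divide_distrib[symmetric])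
qed

end

text \<open>Counting weights from the late end makes the weight with index n equal to 0, which
  removes the remainder in the second formula of \<open>chain_move\<close>. In \<open>chainD\<close>
  they are counted from the early end, so that c w(0) = w(1) holds for c = 2 cos(pi/m) and both
  parities are covered.\<close>

definition chainA :: "nat \<Rightarrow> nat \<Rightarrow> (real \<Rightarrow> real) \<Rightarrow> (real \<Rightarrow> real) \<Rightarrow> real \<Rightarrow> real" where
  "chainA m n = chain n (\<lambda>i. sin_ratio m (n - i))"

definition chainD :: "nat \<Rightarrow> nat \<Rightarrow> (real \<Rightarrow> real) \<Rightarrow> (real \<Rightarrow> real) \<Rightarrow> real \<Rightarrow> real" where
  "chainD m n = chain n (\<lambda>i. sin_ratio m (Suc i))"

lemma chainA_cong:
  assumes "\<And>s. 0 \<le> s \<Longrightarrow> s \<le> t \<Longrightarrow> x s = x' s" "\<And>s. 0 \<le> s \<Longrightarrow> s \<le> t \<Longrightarrow> y s = y' s"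
  shows "chainA m n x y t = chainA m n x' y' t"
  unfolding chainA_def using assms by (intro chain_cong) auto

lemma chainD_cong:
  assumes "\<And>s. 0 \<le> s \<Longrightarrow> s \<le> t \<Longrightarrow> x s = x' s" "\<And>s. 0 \<le> s \<Longrightarrow> s \<le> t \<Longrightarrow> y s = y' s"
  shows "chainD m n x y t = chainD m n x' y' t"
  unfolding chainD_def using assms by (intro chain_cong) auto

lemma chainA_drop_first:
  assumes "\<And>s. 0 \<le> s \<Longrightarrow> s \<le> t \<Longrightarrow> 0 \<le> sin_ratio m (Suc n) * (if even n then x else y) s"
    and "(if even n then x else y) 0 = 0" "0 \<le> t"
  shows "chainA m (Suc n) x y t = chainA m n x y t"
  unfolding chainA_def using chain_drop_first[of t "\<lambda>i. sin_ratio m (Suc n - i)" n x y] assms by simp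

text \<open>At length m the earliest letter has weight sin(pi) / sin(pi/m) = 0. This closes the list
  of \<open>A\<close>-chains and is the source of the braid relation.\<close>

lemma chainA_self:
  assumes "2 \<le> m" "x 0 = 0" "y 0 = 0" "0 \<le> t"
  shows "chainA m m x y t = chainA m (m - 1) x y t"
  using chainA_drop_first[of t m "m - 1" x y] assms by simp

text \<open>Here x and y stand for the two coroots along a path, x' and y' for the same coroots
  along its Pitman transform in the direction of x.\<close>

context
  fixes m :: nat and T :: real and x y x' y' g :: "real \<Rightarrow> real"
  assumes m: "2 \<le> m"
    and cont: "continuous_on {0..T} x" "continuous_on {0..T} y"
    and at_0: "x 0 = 0" "y 0 = 0"
    and x': "x' = (\<lambda>t. x t - 2 * run_inf x t)"
    and y': "y' = (\<lambda>t. y t + 2 * cos (pi / real m) * run_inf x t)"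
begin

lemma run_inf_at_0: "run_inf x 0 = 0"
  unfolding run_inf_def by (simp add: at_0)

lemma reflected_cont: "continuous_on {0..T} x'" "continuous_on {0..T} y'"
  unfolding x' y' using cont by (auto intro!: continuous_intros continuous_run_inf)

lemma reflected_nonneg: "0 \<le> t \<Longrightarrow> t \<le> T \<Longrightarrow> 0 \<le> x' t"
  using run_inf_le[OF cont(1), of t t] run_inf_nonpos[OF cont(1) at_0(1), of t] by (auto simp: x')

lemma reflected_at_0: "x' 0 = 0" "y' 0 = 0"
  by (simp_all add: x' y' run_inf_at_0 at_0)

text \<open>\<open>chain_move\<close> with g = -\<open>run_inf x\<close>, for chains whose earliest
  letter is x. The latest weight is 1, whence the bare \<open>run_inf x t\<close>; if y is latest,
  the remainder carries the weight 0.\<close>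

lemma chainA_reflect_same:
  assumes n: "n \<le> m" and t: "0 \<le> t" "t \<le> T"
  shows "odd n \<Longrightarrow> chainA m n x' y' t = chainA m n x y t - run_inf x t"
    and "even n \<Longrightarrow> chainA m n y' x' t = chainA m n y x t"
proof -
  let ?w = "\<lambda>i. sin_ratio m (n - i)"
  have rec: "2 * cos (pi / real m) * ?w (Suc i) = ?w i + ?w (Suc (Suc i))" if "Suc (Suc i) \<le> n" for i
    using sin_ratio_rec[OF m, of "n - Suc (Suc i)"] that by (simp add: Suc_diff_Suc)
  have *: "x' = (\<lambda>t. x t + 2 * - run_inf x t)"
    "y' = (\<lambda>t. y t - 2 * cos (pi / real m) * - run_inf x t)" by (simp_all add: x' y')
  have nonneg: "0 \<le> ?w i" for i using n sin_ratio_nonneg[OF m, of "n - i"] by simp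
  note move = chain_move[where w = ?w and n = n and T = T, OF cont
      continuous_on_minus[OF continuous_run_inf[OF cont(1)]] _
      reflecting_shift_run_inf[OF cont(1)] nonneg rec, folded *]
  show "chainA m n x' y' t = chainA m n x y t - run_inf x t" if odd: "odd n"
  proof -
    obtain i where i: "n = Suc i" using odd by (cases n) auto
    have "chain (Suc i) ?w x' y' t = chain (Suc i) ?w x y t + ?w i * - run_inf x t"
      using move[of i t] odd t run_inf_at_0 i by simp
    then show ?thesis using i m by (simp add: chainA_def del: chain.simps(2))
  qed
  show "chainA m n y' x' t = chainA m n y x t" if even: "even n"
  proof (cases n)
    case (Suc i)
    have "chain (Suc i) ?w y' x' t = run_inf (\<lambda>s. ?w i * y s + chain i ?w x y s - ?w (Suc i) * - run_inf x s) t"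
      using move[of i t] even t run_inf_at_0 Suc by simp
    then show ?thesis using Suc m by (simp add: chainA_def)
  qed (simp add: chainA_def)
qed

text \<open>The earliest letter is now y', so the parity condition of \<open>chain_move\<close>
  fails. One more x'-letter at the early end leaves the value unchanged, because x' is nonnegative,
  and the longer chain has the right parity.\<close>

lemma chainA_reflect_other:
  assumes n: "Suc n \<le> m" and t: "0 \<le> t" "t \<le> T"
  shows "even n \<Longrightarrow> chainA m n x' y' t = chainA m (Suc n) x y t - run_inf x t"
    and "odd n \<Longrightarrow> chainA m n y' x' t = chainA m (Suc n) y x t"
proof -
  have nonneg: "0 \<le> sin_ratio m (Suc n) * x' s" if "0 \<le> s" "s \<le> t" for s
    using sin_ratio_nonneg[OF m n] reflected_nonneg that t by simp
  show "even n \<Longrightarrow> chainA m n x' y' t = chainA m (Suc n) x y t - run_inf x t"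
    using chainA_drop_first[of t m n x' y'] nonneg reflected_at_0 t chainA_reflect_same(1)[OF n t] by simp
  show "odd n \<Longrightarrow> chainA m n y' x' t = chainA m (Suc n) y x t"
    using chainA_drop_first[of t m n y' x'] nonneg reflected_at_0 t chainA_reflect_same(2)[OF n t] by simp
qed

text \<open>\<open>chain_move\<close> read from the transform back to the path. If y is latest, the
  remainder contains -\<open>run_inf x s\<close> at an inner time s; \<open>run_inf_recover\<close>
  turns it into the minimum of its end value and a future infimum of x'. The latter acts as a new
  latest letter with the next weight, so the length grows by one.\<close>

lemma chainD_reflect:
  assumes n: "Suc n < m" and T: "0 \<le> T"
  shows "chainD m (Suc n) x y T = chainD m (Suc n) x' y' T + sin_ratio m (Suc n) * run_inf x T"
    and "chainD m (Suc n) y x T =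
      min (chainD m (Suc n) y' x' T - sin_ratio m (Suc (Suc n)) * run_inf x T) (chainD m (Suc (Suc n)) x' y' T)"
proof -
  let ?w = "\<lambda>i. sin_ratio m (Suc i)"
  have rec: "2 * cos (pi / real m) * ?w (Suc i) = ?w i + ?w (Suc (Suc i))" for i
    by (rule sin_ratio_rec[OF m])
  have w0: "2 * cos (pi / real m) * ?w 0 = ?w 1"
    using sin_ratio_rec[OF m, of 0] m by simp
  have *: "x = (\<lambda>t. x' t + 2 * run_inf x t)" "y = (\<lambda>t. y' t - 2 * cos (pi / real m) * run_inf x t)"
    by (simp_all add: x' y')
  have shift: "reflecting_shift T x' (run_inf x)"
    using reflecting_shift_inverse[OF reflecting_shift_run_inf[OF cont(1)]] by (simp add: x')
  have nonneg: "i < m \<Longrightarrow> 0 \<le> ?w i" for i using sin_ratio_nonneg[OF m, of "Suc i"] by simp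
  have move: "chain (Suc n) ?w x y T = chain (Suc n) ?w x' y' T + ?w n * run_inf x T"
    "chain (Suc n) ?w y x T = run_inf (\<lambda>s. ?w n * y' s + chain n ?w x' y' s - ?w (Suc n) * run_inf x s) T"
    using chain_move[where w = ?w and n = m and T = T and c = "2 * cos (pi / real m)" and i = n and t = T,
      OF reflected_cont continuous_run_inf[OF cont(1)] run_inf_at_0 shift nonneg rec] n T w0
    unfolding *[symmetric] by auto
  show "chainD m (Suc n) x y T = chainD m (Suc n) x' y' T + sin_ratio m (Suc n) * run_inf x T"
    using move(1) by (simp add: chainD_def)
  let ?h = "\<lambda>s. ?w n * y' s + chain n ?w x' y' s"
  let ?k = "?w (Suc n)" and ?N = "\<lambda>s. - run_inf x s"
  have k: "0 \<le> ?k" using n by (intro nonneg) simp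
  have h: "continuous_on {0..T} ?h" using reflected_cont by (auto intro!: continuous_intros continuous_chain)
  show "chainD m (Suc n) y x T =
      min (chainD m (Suc n) y' x' T - sin_ratio m (Suc (Suc n)) * run_inf x T) (chainD m (Suc (Suc n)) x' y' T)"
  proof (rule real_eq_by_lower_bounds)
    fix b
    \<comment> \<open>\<open>run_inf_recover\<close> multiplied by the weight, which is 0 when
      \<open>Suc (Suc n) = m\<close>.\<close>
    have kN: "b - ?h s \<le> ?k * ?N s \<longleftrightarrow> b - ?h s \<le> ?k * ?N T \<and> (\<forall>r\<in>{s..T}. b - ?h s \<le> ?k * x' r)"
      if s: "s \<in> {0..T}" for s
    proof (cases "?k = 0")
      case False
      then have *: "z \<le> ?k * u \<longleftrightarrow> z / ?k \<le> u" for z u using k by (auto simp: field_simps)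
      show ?thesis unfolding * using run_inf_recover[OF cont(1), of s "(b - ?h s) / ?k"] s by (simp add: x')
    qed (use s in auto)
    have "b \<le> chainD m (Suc n) y x T \<longleftrightarrow> (\<forall>s\<in>{0..T}. b \<le> ?h s - ?k * run_inf x s)"
      unfolding chainD_def move(2) using T h cont
      by (intro le_run_inf_iff[where T = T]) (auto intro!: continuous_intros continuous_run_inf)
    also have "\<dots> \<longleftrightarrow> (\<forall>s\<in>{0..T}. b - ?h s \<le> ?k * ?N s)"
      by (simp add: algebra_simps)
    also have "\<dots> \<longleftrightarrow> (\<forall>s\<in>{0..T}. b - ?h s \<le> ?k * ?N T) \<and>
        (\<forall>s\<in>{0..T}. \<forall>r\<in>{s..T}. b - ?h s \<le> ?k * x' r)"
      using kN by (simp only: ball_conj_distrib cong: ball_cong)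
    also have "(\<forall>s\<in>{0..T}. b - ?h s \<le> ?k * ?N T) \<longleftrightarrow>
        (\<forall>s\<in>{0..T}. b - ?k * ?N T \<le> ?w n * y' s + chain n ?w x' y' s)"
    proof -
      have "b - z \<le> u \<longleftrightarrow> b - u \<le> z" for u z :: real by linarith
      then show ?thesis by blast
    qed
    also have "(\<forall>s\<in>{0..T}. b - ?k * ?N T \<le> ?w n * y' s + chain n ?w x' y' s) \<longleftrightarrow>
        b - ?k * ?N T \<le> chainD m (Suc n) y' x' T"
      unfolding chainD_def by (rule le_chain_Suc_iff[OF reflected_cont(2,1) T order.refl, symmetric])
    also have "(\<forall>s\<in>{0..T}. \<forall>r\<in>{s..T}. b - ?h s \<le> ?k * x' r) \<longleftrightarrow>
        (\<forall>r\<in>{0..T}. \<forall>s\<in>{0..r}. b - ?h s \<le> ?k * x' r)"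
      by (meson atLeastAtMost_iff order.trans)
    also have "\<dots> \<longleftrightarrow> (\<forall>r\<in>{0..T}. \<forall>s\<in>{0..r}. b - ?k * x' r \<le> ?w n * y' s + chain n ?w x' y' s)"
    proof -
      have "b - z \<le> u \<longleftrightarrow> b - u \<le> z" for u z :: real by linarith
      then show ?thesis by (simp only:)
    qed
    also have "\<dots> \<longleftrightarrow> (\<forall>r\<in>{0..T}. b - ?k * x' r \<le> chain (Suc n) ?w y' x' r)"
      using le_chain_Suc_iff[OF reflected_cont(2,1)] by (intro ball_cong) (auto simp del: chain.simps(2))
    also have "\<dots> \<longleftrightarrow> (\<forall>r\<in>{0..T}. b \<le> ?k * x' r + chain (Suc n) ?w y' x' r)"
      by (simp only: diff_le_eq add.commute)
    also have "\<dots> \<longleftrightarrow> b \<le> chainD m (Suc (Suc n)) x' y' T"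
      unfolding chainD_def by (rule le_chain_Suc_iff[OF reflected_cont T order.refl, symmetric])
    finally show "b \<le> chainD m (Suc n) y x T \<longleftrightarrow> b \<le> min (chainD m (Suc n) y' x' T -
        sin_ratio m (Suc (Suc n)) * run_inf x T) (chainD m (Suc (Suc n)) x' y' T)"
      by (simp add: algebra_simps)
  qed
qed

end

text \<open>The latest letter has weight 0 at length m. What remains is a chain with the other
  letter latest, and its infimum over the end time is attained at T because chains decrease in
  time.\<close>

lemma chainD_self:
  assumes m: "2 \<le> m" and cont: "continuous_on {0..T} x" "continuous_on {0..T} y" and T: "0 \<le> T"
  shows "chainD m m x y T = chainD m (m - 1) y x T"
proof -
  obtain k where k: "m = Suc k" using m by (cases m) auto
  let ?w = "\<lambda>i. sin_ratio m (Suc i)"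
  have wk: "?w k = 0" using m k by simp
  show ?thesis
  proof (rule real_eq_by_lower_bounds)
    fix b
    have "b \<le> chain (Suc k) ?w x y T \<longleftrightarrow> (\<forall>s\<in>{0..T}. b \<le> chain k ?w y x s)"
      using le_chain_Suc_iff[OF cont T order.refl, of b k ?w] wk by simp
    also have "\<dots> \<longleftrightarrow> b \<le> chain k ?w y x T"
      using chain_antimono[OF cont(2,1), of _ T k ?w] T by (auto intro: order.trans)
    finally show "b \<le> chainD m m x y T \<longleftrightarrow> b \<le> chainD m (m - 1) y x T"
      using k by (simp add: chainD_def del: chain.simps)
  qed
qed

section \<open>Paths in rank two\<close>

lemma pitman_apply:
  "0 \<le> t \<Longrightarrow> t \<le> T \<Longrightarrow>
    pitman T \<alpha> \<alpha>v s \<eta> t = \<eta> t - run_inf (\<lambda>r. \<alpha>v s (\<eta> r)) t *\<^sub>R \<alpha> s"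
  by (simp add: pitman_def run_inf_def)

lemma path_eps_eq: "path_eps T \<alpha>v s \<eta> = - run_inf (\<lambda>r. \<alpha>v s (\<eta> r)) T"
  by (simp add: path_eps_def run_inf_def)

lemma path_space_0: "\<eta> \<in> path_space T \<Longrightarrow> \<eta> 0 = 0"
  by (simp add: path_space_def)

lemma continuous_linear_path:
  fixes \<eta> :: "real \<Rightarrow> 'v::euclidean_space" and f :: "'v \<Rightarrow> real"
  assumes "\<eta> \<in> path_space T" "linear f"
  shows "continuous_on {0..T} (\<lambda>t. f (\<eta> t))"
  using assms linear_continuous_on_compose[of "{0..T}" \<eta> f] by (simp add: path_space_def)

lemma path_space_eqI:
  assumes "\<eta> \<in> path_space T" "\<eta>' \<in> path_space T" "\<And>t. 0 \<le> t \<Longrightarrow> t \<le> T \<Longrightarrow> \<eta> t = \<eta>' t"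
  shows "\<eta> = \<eta>'"
  using assms by (intro extensionalityI[of _ "{0..T}"]) (auto simp: path_space_def)

lemma restrict_in_path_space:
  assumes "continuous_on {0..T} f" "f 0 = 0" "0 \<le> T"
  shows "restrict f {0..T} \<in> path_space T"
proof -
  have "continuous_on {0..T} (restrict f {0..T})"
    using assms(1) by (rule continuous_on_cong[THEN iffD1, rotated -1]) auto
  then show ?thesis using assms by (simp add: path_space_def)
qed

lemma pitman_in_path_space:
  fixes \<eta> :: "real \<Rightarrow> 'v::euclidean_space"
  assumes "\<eta> \<in> path_space T" "linear (\<alpha>v s)" "0 \<le> T"
  shows "pitman T \<alpha> \<alpha>v s \<eta> \<in> path_space T"
  unfolding pitman_def run_inf_def[symmetric]
proof (rule restrict_in_path_space)
  show "continuous_on {0..T} (\<lambda>t. \<eta> t - run_inf (\<lambda>r. \<alpha>v s (\<eta> r)) t *\<^sub>R \<alpha> s)"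
    using assms continuous_linear_path[OF assms(1,2)]
    by (auto intro!: continuous_intros continuous_run_inf simp: path_space_def)
  show "\<eta> 0 - run_inf (\<lambda>r. \<alpha>v s (\<eta> r)) 0 *\<^sub>R \<alpha> s = 0"
    using assms by (simp add: run_inf_def path_space_0 linear_0)
qed (fact assms)

lemma pitman_word_simps [simp]:
  "pitman_word T \<alpha> \<alpha>v [] \<eta> = \<eta>"
  "pitman_word T \<alpha> \<alpha>v (s # ws) \<eta> = pitman T \<alpha> \<alpha>v s (pitman_word T \<alpha> \<alpha>v ws \<eta>)"
  "pitman_word T \<alpha> \<alpha>v (us @ vs) \<eta> = pitman_word T \<alpha> \<alpha>v us (pitman_word T \<alpha> \<alpha>v vs \<eta>)"
  by (simp_all add: pitman_word_def)

lemma pitman_word_in_path_space: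
  fixes \<eta> :: "real \<Rightarrow> 'v::euclidean_space"
  assumes "\<eta> \<in> path_space T" "\<And>s. s \<in> set ws \<Longrightarrow> linear (\<alpha>v s)" "0 \<le> T"
  shows "pitman_word T \<alpha> \<alpha>v ws \<eta> \<in> path_space T"
  using assms by (induction ws) (auto intro!: pitman_in_path_space)

text \<open>As in \<^term>\<open>pitman_word\<close>, the last letter of the word acts first.\<close>

primrec strings ::
  "real \<Rightarrow> ('i \<Rightarrow> 'v) \<Rightarrow> ('i \<Rightarrow> 'v \<Rightarrow> real) \<Rightarrow> 'i list \<Rightarrow> (real \<Rightarrow> 'v::real_normed_vector) \<Rightarrow> real list" where
  "strings T \<alpha> \<alpha>v [] \<eta> = []"
| "strings T \<alpha> \<alpha>v (s # ws) \<eta> = path_eps T \<alpha>v s (pitman_word T \<alpha> \<alpha>v ws \<eta>) # strings T \<alpha> \<alpha>v ws \<eta>"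

lemma length_strings [simp]: "length (strings T \<alpha> \<alpha>v ws \<eta>) = length ws"
  by (induction ws) auto

lemma strings_append:
  "strings T \<alpha> \<alpha>v (us @ vs) \<eta> = strings T \<alpha> \<alpha>v us (pitman_word T \<alpha> \<alpha>v vs \<eta>) @ strings T \<alpha> \<alpha>v vs \<eta>"
  by (induction us) auto

lemma strings_append_eq_iff:
  "strings T \<alpha> \<alpha>v (us @ vs) \<eta> = strings T \<alpha> \<alpha>v (us @ vs) \<eta>' \<longleftrightarrow>
    strings T \<alpha> \<alpha>v us (pitman_word T \<alpha> \<alpha>v vs \<eta>) = strings T \<alpha> \<alpha>v us (pitman_word T \<alpha> \<alpha>v vs \<eta>') \<and>
    strings T \<alpha> \<alpha>v vs \<eta> = strings T \<alpha> \<alpha>v vs \<eta>'"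
  by (simp add: strings_append)

section \<open>Alternating words and time reversal of paths\<close>

primrec alt_word :: "nat \<Rightarrow> 'a \<Rightarrow> 'a \<Rightarrow> 'a list" where
  "alt_word 0 s t = []"
| "alt_word (Suc k) s t = alt_word k t s @ [s]"

lemma length_alt_word [simp]: "length (alt_word k s t) = k"
  by (induction k arbitrary: s t) auto

lemma alt_word_in_lists: "s \<in> A \<Longrightarrow> t \<in> A \<Longrightarrow> alt_word k s t \<in> lists A"
  by (induction k arbitrary: s t) auto

lemma alt_word_Cons: "alt_word (Suc k) s t = (if even k then s else t) # alt_word k s t"
  by (induction k arbitrary: s t) auto

definition reverse_path :: "real \<Rightarrow> (real \<Rightarrow> 'v::real_normed_vector) \<Rightarrow> real \<Rightarrow> 'v" where
  "reverse_path T \<eta> = (\<lambda>t\<in>{0..T}. \<eta> (T - t) - \<eta> T)"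

lemma reverse_path_in_path_space:
  assumes "\<eta> \<in> path_space T" "0 \<le> T"
  shows "reverse_path T \<eta> \<in> path_space T"
  unfolding reverse_path_def
proof (rule restrict_in_path_space)
  have "continuous_on {0..T} (\<lambda>t. \<eta> (T - t))"
    by (rule continuous_on_compose2[of "{0..T}" \<eta>])
      (use assms in \<open>auto intro!: continuous_intros simp: path_space_def\<close>)
  then show "continuous_on {0..T} (\<lambda>t. \<eta> (T - t) - \<eta> T)" by (intro continuous_intros)
qed (use assms in auto)

lemma reverse_path_reverse_path:
  assumes "\<eta> \<in> path_space T" "0 \<le> T"
  shows "reverse_path T (reverse_path T \<eta>) = \<eta>"
  using assms
  by (intro path_space_eqI[of _ T] reverse_path_in_path_space)
    (auto simp: reverse_path_def path_space_0)

text \<open>Equal Cartan entries let both letters obey the same recurrence of coefficients, so that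
  a and b play symmetric roles. The value m = 2 is included, with both entries 0.\<close>

locale dihedral_paths =
  fixes T :: real and \<alpha> :: "'i \<Rightarrow> 'v::euclidean_space" and \<alpha>v :: "'i \<Rightarrow> 'v \<Rightarrow> real"
    and a b :: 'i and m :: nat
  assumes T: "0 \<le> T" and m: "2 \<le> m"
    and lin: "linear (\<alpha>v a)" "linear (\<alpha>v b)"
    and two: "\<alpha>v a (\<alpha> a) = 2" "\<alpha>v b (\<alpha> b) = 2"
    and cartan: "\<alpha>v a (\<alpha> b) = - 2 * cos (pi / real m)" "\<alpha>v b (\<alpha> a) = - 2 * cos (pi / real m)"
begin

lemma swapped: "dihedral_paths T \<alpha> \<alpha>v b a m"
  using T m lin two cartan by (simp add: dihedral_paths_def)

abbreviation co :: "'i \<Rightarrow> (real \<Rightarrow> 'v) \<Rightarrow> real \<Rightarrow> real" where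
  "co s \<eta> \<equiv> \<lambda>t. \<alpha>v s (\<eta> t)"

lemma co_continuous:
  "\<eta> \<in> path_space T \<Longrightarrow> continuous_on {0..T} (co a \<eta>)"
  "\<eta> \<in> path_space T \<Longrightarrow> continuous_on {0..T} (co b \<eta>)"
  using continuous_linear_path lin by blast+

lemma co_0: "\<eta> \<in> path_space T \<Longrightarrow> co a \<eta> 0 = 0" "\<eta> \<in> path_space T \<Longrightarrow> co b \<eta> 0 = 0"
  using lin by (simp_all add: path_space_0 linear_0)

lemma co_pitman:
  assumes "0 \<le> t" "t \<le> T"
  shows "co a (pitman T \<alpha> \<alpha>v a \<eta>) t = co a \<eta> t - 2 * run_inf (co a \<eta>) t"
    and "co b (pitman T \<alpha> \<alpha>v a \<eta>) t = co b \<eta> t + 2 * cos (pi / real m) * run_inf (co a \<eta>) t"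
  using assms lin two cartan by (simp_all add: pitman_apply linear_diff linear_cmul)

lemma co_pitman_nonneg:
  assumes "\<eta> \<in> path_space T" "0 \<le> t" "t \<le> T"
  shows "0 \<le> co a (pitman T \<alpha> \<alpha>v a \<eta>) t"
  using reflected_nonneg[OF m co_continuous[OF assms(1)] co_0[OF assms(1)] HOL.refl HOL.refl assms(2,3)]
  by (simp add: co_pitman[OF assms(2,3)])

lemma pitman_path: "\<eta> \<in> path_space T \<Longrightarrow> pitman T \<alpha> \<alpha>v a \<eta> \<in> path_space T"
  by (intro pitman_in_path_space lin T)

lemma pitman_word_path:
  "\<eta> \<in> path_space T \<Longrightarrow> ws \<in> lists {a, b} \<Longrightarrow> pitman_word T \<alpha> \<alpha>v ws \<eta> \<in> path_space T"
  using lin T by (intro pitman_word_in_path_space) auto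

lemma chainA_pitman:
  fixes n
  assumes \<eta>: "\<eta> \<in> path_space T" and t: "0 \<le> t" "t \<le> T"
  defines "\<eta>' \<equiv> pitman T \<alpha> \<alpha>v a \<eta>"
  shows "n \<le> m \<Longrightarrow> odd n \<Longrightarrow>
      chainA m n (co a \<eta>') (co b \<eta>') t = chainA m n (co a \<eta>) (co b \<eta>) t - run_inf (co a \<eta>) t"
    and "n \<le> m \<Longrightarrow> even n \<Longrightarrow>
      chainA m n (co b \<eta>') (co a \<eta>') t = chainA m n (co b \<eta>) (co a \<eta>) t"
    and "Suc n \<le> m \<Longrightarrow> even n \<Longrightarrow>
      chainA m n (co a \<eta>') (co b \<eta>') t = chainA m (Suc n) (co a \<eta>) (co b \<eta>) t - run_inf (co a \<eta>) t"
    and "Suc n \<le> m \<Longrightarrow> odd n \<Longrightarrow>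
      chainA m n (co b \<eta>') (co a \<eta>') t = chainA m (Suc n) (co b \<eta>) (co a \<eta>) t"
proof -
  define x y where "x = (\<lambda>t. co a \<eta> t - 2 * run_inf (co a \<eta>) t)"
    and "y = (\<lambda>t. co b \<eta> t + 2 * cos (pi / real m) * run_inf (co a \<eta>) t)"
  have eq: "co a \<eta>' s = x s" "co b \<eta>' s = y s" if "0 \<le> s" "s \<le> t" for s
    unfolding \<eta>'_def x_def y_def using that t by (intro co_pitman; simp)+
  have cong: "chainA m n (co a \<eta>') (co b \<eta>') t = chainA m n x y t"
    "chainA m n (co b \<eta>') (co a \<eta>') t = chainA m n y x t"
    using eq by (auto intro!: chainA_cong)
  note same = chainA_reflect_same[OF m co_continuous[OF \<eta>] co_0[OF \<eta>] x_def y_def _ t]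
    and other = chainA_reflect_other[OF m co_continuous[OF \<eta>] co_0[OF \<eta>] x_def y_def _ t]
  show "n \<le> m \<Longrightarrow> odd n \<Longrightarrow>
      chainA m n (co a \<eta>') (co b \<eta>') t = chainA m n (co a \<eta>) (co b \<eta>) t - run_inf (co a \<eta>) t"
    "n \<le> m \<Longrightarrow> even n \<Longrightarrow> chainA m n (co b \<eta>') (co a \<eta>') t = chainA m n (co b \<eta>) (co a \<eta>) t"
    "Suc n \<le> m \<Longrightarrow> even n \<Longrightarrow>
      chainA m n (co a \<eta>') (co b \<eta>') t = chainA m (Suc n) (co a \<eta>) (co b \<eta>) t - run_inf (co a \<eta>) t"
    "Suc n \<le> m \<Longrightarrow> odd n \<Longrightarrow>
      chainA m n (co b \<eta>') (co a \<eta>') t = chainA m (Suc n) (co b \<eta>) (co a \<eta>) t"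
    unfolding cong using same other by auto
qed

text \<open>Only values at T are compared. With a relation between two paths in place of a formula
  for strings in terms of chains, the minima and differences above are harmless: equal inputs give
  equal outputs.\<close>

definition A_equal :: "(real \<Rightarrow> 'v) \<Rightarrow> (real \<Rightarrow> 'v) \<Rightarrow> bool" where
  "A_equal \<eta> \<eta>' \<longleftrightarrow> (\<forall>n<m. chainA m n (co a \<eta>) (co b \<eta>) T = chainA m n (co a \<eta>') (co b \<eta>') T \<and>
     chainA m n (co b \<eta>) (co a \<eta>) T = chainA m n (co b \<eta>') (co a \<eta>') T)"

definition D_equal :: "(real \<Rightarrow> 'v) \<Rightarrow> (real \<Rightarrow> 'v) \<Rightarrow> bool" where
  "D_equal \<eta> \<eta>' \<longleftrightarrow> (\<forall>n<m. chainD m n (co a \<eta>) (co b \<eta>) T = chainD m n (co a \<eta>') (co b \<eta>') T \<and>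
     chainD m n (co b \<eta>) (co a \<eta>) T = chainD m n (co b \<eta>') (co a \<eta>') T)"

text \<open>Length m reduces to m - 1 by \<open>chainA_self\<close>. It matters because a chain of a
  transform may correspond to a chain of the path with one letter more.\<close>

lemma A_equal_le:
  assumes "A_equal \<eta> \<eta>'" "n \<le> m" "\<eta> \<in> path_space T" "\<eta>' \<in> path_space T"
  shows "chainA m n (co a \<eta>) (co b \<eta>) T = chainA m n (co a \<eta>') (co b \<eta>') T"
    "chainA m n (co b \<eta>) (co a \<eta>) T = chainA m n (co b \<eta>') (co a \<eta>') T"
proof -
  have "m - 1 < m" using m by simp
  then show "chainA m n (co a \<eta>) (co b \<eta>) T = chainA m n (co a \<eta>') (co b \<eta>') T"
    "chainA m n (co b \<eta>) (co a \<eta>) T = chainA m n (co b \<eta>') (co a \<eta>') T"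
    using assms chainA_self[OF m, of "co a \<eta>" "co b \<eta>" T] chainA_self[OF m, of "co b \<eta>" "co a \<eta>" T]
      chainA_self[OF m, of "co a \<eta>'" "co b \<eta>'" T] chainA_self[OF m, of "co b \<eta>'" "co a \<eta>'" T] co_0 T
    unfolding A_equal_def by (cases "n = m"; simp)+
qed

lemma D_equal_le:
  assumes "D_equal \<eta> \<eta>'" "n \<le> m" "\<eta> \<in> path_space T" "\<eta>' \<in> path_space T"
  shows "chainD m n (co a \<eta>) (co b \<eta>) T = chainD m n (co a \<eta>') (co b \<eta>') T"
    "chainD m n (co b \<eta>) (co a \<eta>) T = chainD m n (co b \<eta>') (co a \<eta>') T"
proof -
  have "m - 1 < m" using m by simp
  then show "chainD m n (co a \<eta>) (co b \<eta>) T = chainD m n (co a \<eta>') (co b \<eta>') T"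
    "chainD m n (co b \<eta>) (co a \<eta>) T = chainD m n (co b \<eta>') (co a \<eta>') T"
    using assms chainD_self[OF m _ _ T] co_continuous
    unfolding D_equal_def by (cases "n = m"; simp)+
qed

lemma chainA_1: "chainA m (Suc 0) x y = run_inf x"
  using m by (simp add: chainA_def)

lemma A_equal_eps:
  assumes "A_equal \<eta> \<eta>'" "\<eta> \<in> path_space T" "\<eta>' \<in> path_space T"
  shows "path_eps T \<alpha>v a \<eta> = path_eps T \<alpha>v a \<eta>'"
  using A_equal_le(1)[OF assms(1) _ assms(2,3), of 1] m chainA_1 by (simp add: path_eps_eq)

lemma A_equal_pitman:
  assumes A: "A_equal \<eta> \<eta>'" and \<eta>: "\<eta> \<in> path_space T" "\<eta>' \<in> path_space T"
  shows "A_equal (pitman T \<alpha> \<alpha>v a \<eta>) (pitman T \<alpha> \<alpha>v a \<eta>')"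
  unfolding A_equal_def
proof (intro allI impI)
  fix n assume n: "n < m"
  have eps: "run_inf (co a \<eta>) T = run_inf (co a \<eta>') T"
    using A_equal_eps[OF A \<eta>] by (simp add: path_eps_eq)
  note p = chainA_pitman[OF \<eta>(1) T order.refl, of n] chainA_pitman[OF \<eta>(2) T order.refl, of n]
  show "chainA m n (co a (pitman T \<alpha> \<alpha>v a \<eta>)) (co b (pitman T \<alpha> \<alpha>v a \<eta>)) T =
        chainA m n (co a (pitman T \<alpha> \<alpha>v a \<eta>')) (co b (pitman T \<alpha> \<alpha>v a \<eta>')) T \<and>
      chainA m n (co b (pitman T \<alpha> \<alpha>v a \<eta>)) (co a (pitman T \<alpha> \<alpha>v a \<eta>)) T =
        chainA m n (co b (pitman T \<alpha> \<alpha>v a \<eta>')) (co a (pitman T \<alpha> \<alpha>v a \<eta>')) T"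
    using n p A_equal_le[OF A _ \<eta>, of n] A_equal_le[OF A _ \<eta>, of "Suc n"] eps
    by (cases "even n") simp_all
qed

lemma D_equal_unpitman:
  assumes D: "D_equal (pitman T \<alpha> \<alpha>v a \<eta>) (pitman T \<alpha> \<alpha>v a \<eta>')"
    and eps: "path_eps T \<alpha>v a \<eta> = path_eps T \<alpha>v a \<eta>'"
    and \<eta>: "\<eta> \<in> path_space T" "\<eta>' \<in> path_space T"
  shows "D_equal \<eta> \<eta>'"
  unfolding D_equal_def
proof (intro allI impI)
  fix n assume n: "n < m"
  have eps': "run_inf (co a \<eta>) T = run_inf (co a \<eta>') T"
    using eps by (simp add: path_eps_eq)
  show "chainD m n (co a \<eta>) (co b \<eta>) T = chainD m n (co a \<eta>') (co b \<eta>') T \<and>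
      chainD m n (co b \<eta>) (co a \<eta>) T = chainD m n (co b \<eta>') (co a \<eta>') T"
  proof (cases n)
    case 0
    then show ?thesis by (simp add: chainD_def)
  next
    case (Suc k)
    have *: "chainD m (Suc k) (co a \<zeta>) (co b \<zeta>) T =
          chainD m (Suc k) (co a (pitman T \<alpha> \<alpha>v a \<zeta>)) (co b (pitman T \<alpha> \<alpha>v a \<zeta>)) T
            + sin_ratio m (Suc k) * run_inf (co a \<zeta>) T \<and>
        chainD m (Suc k) (co b \<zeta>) (co a \<zeta>) T =
          min (chainD m (Suc k) (co b (pitman T \<alpha> \<alpha>v a \<zeta>)) (co a (pitman T \<alpha> \<alpha>v a \<zeta>)) T
              - sin_ratio m (Suc (Suc k)) * run_inf (co a \<zeta>) T)
            (chainD m (Suc (Suc k)) (co a (pitman T \<alpha> \<alpha>v a \<zeta>)) (co b (pitman T \<alpha> \<alpha>v a \<zeta>)) T)"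
      if \<zeta>: "\<zeta> \<in> path_space T" for \<zeta>
    proof -
      let ?x = "\<lambda>t. co a \<zeta> t - 2 * run_inf (co a \<zeta>) t"
        and ?y = "\<lambda>t. co b \<zeta> t + 2 * cos (pi / real m) * run_inf (co a \<zeta>) t"
      have cong: "chainD m i (co a (pitman T \<alpha> \<alpha>v a \<zeta>)) (co b (pitman T \<alpha> \<alpha>v a \<zeta>)) T = chainD m i ?x ?y T"
        "chainD m i (co b (pitman T \<alpha> \<alpha>v a \<zeta>)) (co a (pitman T \<alpha> \<alpha>v a \<zeta>)) T = chainD m i ?y ?x T" for i
        using co_pitman[of _ \<zeta>] by (auto intro!: chainD_cong)
      show ?thesis unfolding cong
        using chainD_reflect[OF m co_continuous[OF \<zeta>] co_0[OF \<zeta>] HOL.refl HOL.refl _ T, of k] n Suc by simp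
    qed
    have P: "pitman T \<alpha> \<alpha>v a \<eta> \<in> path_space T" "pitman T \<alpha> \<alpha>v a \<eta>' \<in> path_space T"
      using \<eta> by (auto intro: pitman_path)
    show ?thesis
      unfolding Suc using *[OF \<eta>(1)] *[OF \<eta>(2)] D_equal_le[OF D _ P, of "Suc k"]
        D_equal_le[OF D _ P, of "Suc (Suc k)"] n Suc eps' by simp
  qed
qed

lemma chainD_dominant:
  assumes "\<eta> \<in> path_space T" "\<And>t. 0 \<le> t \<Longrightarrow> t \<le> T \<Longrightarrow> 0 \<le> co a \<eta> t \<and> 0 \<le> co b \<eta> t" "n < m"
  shows "chainD m n (co a \<eta>) (co b \<eta>) T = 0"
  unfolding chainD_def using assms co_0[OF assms(1)] sin_ratio_nonneg[OF m] T by (intro chain_eq_0) auto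

text \<open>Reversing the order of the weights \<open>sin_ratio m (n - i)\<close> gives
  \<open>sin_ratio m (Suc i)\<close>, the weights of a \<open>D\<close>-chain. The additive constant
  depends on the path only through its end point.\<close>

lemma A_equal_reverse:
  assumes D: "D_equal \<eta> \<eta>'" and end_eq: "\<eta> T = \<eta>' T" and \<eta>: "\<eta> \<in> path_space T" "\<eta>' \<in> path_space T"
  shows "A_equal (reverse_path T \<eta>) (reverse_path T \<eta>')"
  unfolding A_equal_def
proof (intro allI impI)
  fix n assume n: "n < m"
  have key: "chainA m n (co s (reverse_path T \<zeta>)) (co t (reverse_path T \<zeta>)) T =
      chainD m n (if odd n then co s \<zeta> else co t \<zeta>) (if odd n then co t \<zeta> else co s \<zeta>) T
      - (\<Sum>i<n. sin_ratio m (n - i) * (if even (n - Suc i) then co s \<zeta> T else co t \<zeta> T))"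
    if \<zeta>: "\<zeta> \<in> path_space T" and st: "s \<in> {a, b}" "t \<in> {a, b}" for s t \<zeta>
  proof -
    have "linear (\<alpha>v s)" "linear (\<alpha>v t)" using st lin by auto
    then have "chainA m n (co s (reverse_path T \<zeta>)) (co t (reverse_path T \<zeta>)) T =
        chainA m n (\<lambda>r. co s \<zeta> (T - r) - co s \<zeta> T) (\<lambda>r. co t \<zeta> (T - r) - co t \<zeta> T) T"
      by (intro chainA_cong) (auto simp: reverse_path_def linear_diff)
    also have "\<dots> = chain n (\<lambda>i. sin_ratio m (n - (n - Suc i)))
          (if odd n then co s \<zeta> else co t \<zeta>) (if odd n then co t \<zeta> else co s \<zeta>) T
        - (\<Sum>i<n. sin_ratio m (n - i) * (if even (n - Suc i) then co s \<zeta> T else co t \<zeta> T))"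
      unfolding chainA_def using st co_continuous[OF \<zeta>] by (intro chain_reverse T) auto
    also have "chain n (\<lambda>i. sin_ratio m (n - (n - Suc i)))
          (if odd n then co s \<zeta> else co t \<zeta>) (if odd n then co t \<zeta> else co s \<zeta>) T =
        chainD m n (if odd n then co s \<zeta> else co t \<zeta>) (if odd n then co t \<zeta> else co s \<zeta>) T"
      unfolding chainD_def by (intro chain_cong) auto
    finally show ?thesis .
  qed
  show "chainA m n (co a (reverse_path T \<eta>)) (co b (reverse_path T \<eta>)) T =
        chainA m n (co a (reverse_path T \<eta>')) (co b (reverse_path T \<eta>')) T \<and>
      chainA m n (co b (reverse_path T \<eta>)) (co a (reverse_path T \<eta>)) T =
        chainA m n (co b (reverse_path T \<eta>')) (co a (reverse_path T \<eta>')) T"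
    using D n end_eq by (simp add: key \<eta> D_equal_def cong: if_cong)
qed

end

text \<open>The letter p acts last. In the induction a acts first: \<open>chainA_pitman\<close>
  rewrites chains of its transform as chains of the path with one letter more, and the running
  infimum that appears cancels the one subtracted by the transform. For k = 0 the truncated
  \<open>k - 1\<close> gives an empty chain.\<close>

lemma pitman_alt_word:
  fixes \<alpha> :: "'i \<Rightarrow> 'v::euclidean_space"
  assumes "dihedral_paths T \<alpha> \<alpha>v a b m" "k \<le> m" "\<eta> \<in> path_space T" "0 \<le> t" "t \<le> T"
    and "(p, q) = (if odd k then (a, b) else (b, a))"
  shows "pitman_word T \<alpha> \<alpha>v (alt_word k a b) \<eta> t = \<eta> t
    - chainA m k (\<lambda>r. \<alpha>v p (\<eta> r)) (\<lambda>r. \<alpha>v q (\<eta> r)) t *\<^sub>R \<alpha> p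
    - chainA m (k - 1) (\<lambda>r. \<alpha>v q (\<eta> r)) (\<lambda>r. \<alpha>v p (\<eta> r)) t *\<^sub>R \<alpha> q"
  using assms
proof (induction k arbitrary: a b \<eta>)
  case 0
  then show ?case by (simp add: chainA_def)
next
  case (Suc k)
  interpret dihedral_paths T \<alpha> \<alpha>v a b m by fact
  have pq: "(p, q) = (if odd k then (b, a) else (a, b))" using Suc.prems(6) by auto
  have "pitman_word T \<alpha> \<alpha>v (alt_word (Suc k) a b) \<eta> t =
      pitman T \<alpha> \<alpha>v a \<eta> t
      - chainA m k (co p (pitman T \<alpha> \<alpha>v a \<eta>)) (co q (pitman T \<alpha> \<alpha>v a \<eta>)) t *\<^sub>R \<alpha> p
      - chainA m (k - 1) (co q (pitman T \<alpha> \<alpha>v a \<eta>)) (co p (pitman T \<alpha> \<alpha>v a \<eta>)) t *\<^sub>R \<alpha> q"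
    using Suc.IH[OF swapped _ pitman_path[OF Suc.prems(3)] Suc.prems(4,5) pq] Suc.prems(2) by simp
  also have "\<dots> = \<eta> t - chainA m (Suc k) (co p \<eta>) (co q \<eta>) t *\<^sub>R \<alpha> p - chainA m k (co q \<eta>) (co p \<eta>) t *\<^sub>R \<alpha> q"
  proof -
    note p = chainA_pitman[OF Suc.prems(3-5)]
    note ap = pitman_apply[OF Suc.prems(4,5), of \<alpha> \<alpha>v a \<eta>]
    show ?thesis
    proof (cases k)
      case 0
      then show ?thesis using p(3)[of 0] Suc.prems(2) pq by (simp add: chainA_def ap)
    next
      case (Suc j)
      show ?thesis
      proof (cases "odd k")
        case True
        then show ?thesis using pq \<open>Suc k \<le> m\<close> Suc
          by (simp add: p(3)[of j] p(4)[of "Suc j"] ap scaleR_left_diff_distrib)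
      next
        case False
        then show ?thesis using pq \<open>Suc k \<le> m\<close> Suc
          by (simp add: p(3)[of "Suc j"] p(4)[of j] ap scaleR_left_diff_distrib)
      qed
    qed
  qed
  finally show ?case by simp
qed

context dihedral_paths
begin

interpretation sw: dihedral_paths T \<alpha> \<alpha>v b a m
  by (rule swapped)

lemma A_equal_swapped: "sw.A_equal \<eta> \<eta>' \<longleftrightarrow> A_equal \<eta> \<eta>'"
  unfolding A_equal_def sw.A_equal_def by auto

lemma D_equal_swapped: "sw.D_equal \<eta> \<eta>' \<longleftrightarrow> D_equal \<eta> \<eta>'"
  unfolding D_equal_def sw.D_equal_def by auto

text \<open>At k = m the chains of length m and m - 1 have equal values by
  \<open>chainA_self\<close>, so the formula of \<open>pitman_alt_word\<close> becomes symmetric in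
  the two letters.\<close>

lemma pitman_braid:
  assumes \<eta>: "\<eta> \<in> path_space T"
  shows "pitman_word T \<alpha> \<alpha>v (alt_word m a b) \<eta> = pitman_word T \<alpha> \<alpha>v (alt_word m b a) \<eta>"
proof (rule path_space_eqI[of _ T])
  fix t assume t: "0 \<le> t" "t \<le> T"
  obtain p q where pq: "(p, q) = (if odd m then (a, b) else (b, a))" by (cases "odd m") auto
  then have qp: "(q, p) = (if odd m then (b, a) else (a, b))" by (auto split: if_splits)
  have "co p \<eta> 0 = 0" "co q \<eta> 0 = 0" using pq co_0[OF \<eta>] by (auto split: if_splits)
  then show "pitman_word T \<alpha> \<alpha>v (alt_word m a b) \<eta> t = pitman_word T \<alpha> \<alpha>v (alt_word m b a) \<eta> t"
    using pitman_alt_word[OF dihedral_paths_axioms order.refl \<eta> t pq]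
      pitman_alt_word[OF swapped order.refl \<eta> t qp]
      chainA_self[OF m, of "co p \<eta>" "co q \<eta>" t] chainA_self[OF m, of "co q \<eta>" "co p \<eta>" t] t(1)
    by (simp add: diff_right_commute)
qed (intro pitman_word_path \<eta> alt_word_in_lists; simp)+

text \<open>By \<open>pitman_braid\<close> the transform acting last can be taken to be the one for
  a or the one for b, and each makes its own coroot nonnegative.\<close>

lemma alt_word_top_nonneg:
  assumes \<eta>: "\<eta> \<in> path_space T" and t: "0 \<le> t" "t \<le> T"
  shows "0 \<le> co a (pitman_word T \<alpha> \<alpha>v (alt_word m a b) \<eta>) t \<and>
    0 \<le> co b (pitman_word T \<alpha> \<alpha>v (alt_word m a b) \<eta>) t"
proof -
  obtain k where k: "m = Suc k" using m by (cases m) auto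
  let ?\<xi> = "\<lambda>a b. pitman_word T \<alpha> \<alpha>v (alt_word k a b) \<eta>"
  have path: "?\<xi> a b \<in> path_space T" "?\<xi> b a \<in> path_space T"
    by (intro pitman_word_path \<eta> alt_word_in_lists; simp)+
  have eqs: "pitman_word T \<alpha> \<alpha>v (alt_word m a b) \<eta> = pitman T \<alpha> \<alpha>v (if even k then a else b) (?\<xi> a b)"
    "pitman_word T \<alpha> \<alpha>v (alt_word m a b) \<eta> = pitman T \<alpha> \<alpha>v (if even k then b else a) (?\<xi> b a)"
    using pitman_braid[OF \<eta>] unfolding k alt_word_Cons by simp_all
  have "\<exists>\<xi>\<in>path_space T. pitman_word T \<alpha> \<alpha>v (alt_word m a b) \<eta> = pitman T \<alpha> \<alpha>v a \<xi>"
    "\<exists>\<xi>\<in>path_space T. pitman_word T \<alpha> \<alpha>v (alt_word m a b) \<eta> = pitman T \<alpha> \<alpha>v b \<xi>"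
  proof -
    show "\<exists>\<xi>\<in>path_space T. pitman_word T \<alpha> \<alpha>v (alt_word m a b) \<eta> = pitman T \<alpha> \<alpha>v a \<xi>"
    proof (cases "even k")
      case True
      show ?thesis by (rule bexI[OF _ path(1)]) (rule eqs(1)[unfolded if_P[OF True]])
    next
      case False
      show ?thesis by (rule bexI[OF _ path(2)]) (rule eqs(2)[unfolded if_not_P[OF False]])
    qed
    show "\<exists>\<xi>\<in>path_space T. pitman_word T \<alpha> \<alpha>v (alt_word m a b) \<eta> = pitman T \<alpha> \<alpha>v b \<xi>"
    proof (cases "even k")
      case True
      show ?thesis by (rule bexI[OF _ path(2)]) (rule eqs(2)[unfolded if_P[OF True]])
    next
      case False
      show ?thesis by (rule bexI[OF _ path(1)]) (rule eqs(1)[unfolded if_not_P[OF False]])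
    qed
  qed
  then show ?thesis using co_pitman_nonneg[OF _ t] sw.co_pitman_nonneg[OF _ t] by metis
qed

lemma A_equal_strings:
  assumes "A_equal \<eta> \<eta>'" "\<eta> \<in> path_space T" "\<eta>' \<in> path_space T" "ws \<in> lists {a, b}"
  shows "strings T \<alpha> \<alpha>v ws \<eta> = strings T \<alpha> \<alpha>v ws \<eta>'"
  using assms
proof (induction ws arbitrary: \<eta> \<eta>' rule: rev_induct)
  case (snoc s ws)
  have "path_eps T \<alpha>v s \<eta> = path_eps T \<alpha>v s \<eta>' \<and>
      A_equal (pitman T \<alpha> \<alpha>v s \<eta>) (pitman T \<alpha> \<alpha>v s \<eta>') \<and>
      pitman T \<alpha> \<alpha>v s \<eta> \<in> path_space T \<and> pitman T \<alpha> \<alpha>v s \<eta>' \<in> path_space T"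
    using snoc.prems A_equal_eps A_equal_pitman pitman_path
      sw.A_equal_eps sw.A_equal_pitman sw.pitman_path unfolding A_equal_swapped by auto
  with snoc show ?case by (simp add: strings_append)
qed simp

lemma strings_D_equal:
  assumes "strings T \<alpha> \<alpha>v ws \<eta> = strings T \<alpha> \<alpha>v ws \<eta>'" "\<eta> \<in> path_space T" "\<eta>' \<in> path_space T"
    "ws \<in> lists {a, b}"
    and "D_equal (pitman_word T \<alpha> \<alpha>v ws \<eta>) (pitman_word T \<alpha> \<alpha>v ws \<eta>')"
  shows "D_equal \<eta> \<eta>'"
  using assms
proof (induction ws arbitrary: \<eta> \<eta>' rule: rev_induct)
  case (snoc s ws)
  have paths: "pitman T \<alpha> \<alpha>v s \<eta> \<in> path_space T" "pitman T \<alpha> \<alpha>v s \<eta>' \<in> path_space T"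
    using snoc.prems pitman_path sw.pitman_path by auto
  have "D_equal (pitman T \<alpha> \<alpha>v s \<eta>) (pitman T \<alpha> \<alpha>v s \<eta>')"
    by (rule snoc.IH) (use snoc.prems paths in \<open>simp_all add: strings_append\<close>)
  moreover have "path_eps T \<alpha>v s \<eta> = path_eps T \<alpha>v s \<eta>'"
    using snoc.prems(1) by (simp add: strings_append)
  moreover have "s = a \<or> s = b" using snoc.prems(4) by simp
  ultimately show ?case
    using snoc.prems(2,3) D_equal_unpitman sw.D_equal_unpitman[unfolded D_equal_swapped] by blast
qed simp

lemma strings_alt_word_D_equal:
  assumes "strings T \<alpha> \<alpha>v (alt_word m a b) \<eta> = strings T \<alpha> \<alpha>v (alt_word m a b) \<eta>'"
    "\<eta> \<in> path_space T" "\<eta>' \<in> path_space T"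
  shows "D_equal \<eta> \<eta>'"
proof (rule strings_D_equal[OF assms])
  show w: "alt_word m a b \<in> lists {a, b}" by (intro alt_word_in_lists; simp)+
  have *: "chainD m n (co a \<zeta>) (co b \<zeta>) T = 0" "chainD m n (co b \<zeta>) (co a \<zeta>) T = 0"
    if "n < m" "\<xi> \<in> path_space T" "\<zeta> = pitman_word T \<alpha> \<alpha>v (alt_word m a b) \<xi>" for n \<xi> \<zeta>
    using that alt_word_top_nonneg[OF that(2)] pitman_word_path[OF that(2) w]
    by (auto intro!: chainD_dominant sw.chainD_dominant)
  show "D_equal (pitman_word T \<alpha> \<alpha>v (alt_word m a b) \<eta>) (pitman_word T \<alpha> \<alpha>v (alt_word m a b) \<eta>')"
    unfolding D_equal_def using * assms(2,3) by simp
qed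

text \<open>The given string fixes the \<open>D\<close>-chains of the path, hence the \<open>A\<close>-chains and all strings of the
  reversed path, hence its \<open>D\<close>-chains, hence the \<open>A\<close>-chains of the path itself.\<close>

lemma strings_braid:
  assumes str: "strings T \<alpha> \<alpha>v (alt_word m a b) \<eta> = strings T \<alpha> \<alpha>v (alt_word m a b) \<eta>'"
    and end_eq: "\<eta> T = \<eta>' T" and \<eta>: "\<eta> \<in> path_space T" "\<eta>' \<in> path_space T"
  shows "strings T \<alpha> \<alpha>v (alt_word m b a) \<eta> = strings T \<alpha> \<alpha>v (alt_word m b a) \<eta>'"
proof -
  have words: "alt_word m a b \<in> lists {a, b}" "alt_word m b a \<in> lists {a, b}"
    by (intro alt_word_in_lists; simp)+
  let ?\<zeta> = "reverse_path T \<eta>" and ?\<zeta>' = "reverse_path T \<eta>'"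
  have \<zeta>: "?\<zeta> \<in> path_space T" "?\<zeta>' \<in> path_space T" using \<eta> T by (auto intro: reverse_path_in_path_space)
  have "A_equal ?\<zeta> ?\<zeta>'"
    by (rule A_equal_reverse[OF strings_alt_word_D_equal[OF str \<eta>] end_eq \<eta>])
  then have "D_equal ?\<zeta> ?\<zeta>'" using A_equal_strings[OF _ \<zeta> words(1)] \<zeta> by (intro strings_alt_word_D_equal)
  moreover have "?\<zeta> T = ?\<zeta>' T" using \<eta> end_eq T by (simp add: reverse_path_def path_space_0)
  ultimately have "A_equal (reverse_path T ?\<zeta>) (reverse_path T ?\<zeta>')" by (intro A_equal_reverse \<zeta>)
  then have "A_equal \<eta> \<eta>'" using \<eta> T by (simp add: reverse_path_reverse_path)
  then show ?thesis by (rule A_equal_strings[OF _ \<eta> words(2)])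
qed

end

section \<open>Reduced words\<close>

lemma word_prod_simps [simp]:
  "word_prod G [] = \<one>\<^bsub>G\<^esub>" "word_prod G (s # ws) = s \<otimes>\<^bsub>G\<^esub> word_prod G ws"
  by (simp_all add: word_prod_def)

lemma concat_replicate_eq_alt_word: "concat (replicate n [s, t]) = alt_word (2 * n) t s"
proof (induction n)
  case (Suc n)
  then have "concat (replicate (Suc n) [s, t]) = [s, t] @ alt_word (2 * n) t s" by simp
  also have "\<dots> = alt_word (Suc (Suc (2 * n))) t s" by (simp only: alt_word_Cons) simp
  finally show ?case by simp
qed simp

text \<open>There is no symmetry rule; where both directions are wanted, \<open>matsumoto\<close> is
  applied to the pair of words in either order.\<close>

inductive braid_eq :: "('w, 'm) monoid_scheme \<Rightarrow> 'w set \<Rightarrow> 'w list \<Rightarrow> 'w list \<Rightarrow> bool" for G S where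
  braid_refl: "u \<in> lists S \<Longrightarrow> braid_eq G S u u"
| braid_move: "u \<in> lists S \<Longrightarrow> v \<in> lists S \<Longrightarrow> s \<in> S \<Longrightarrow> t \<in> S \<Longrightarrow> s \<noteq> t \<Longrightarrow>
    braid_eq G S (u @ alt_word (group.ord G (s \<otimes>\<^bsub>G\<^esub> t)) s t @ v) (u @ alt_word (group.ord G (s \<otimes>\<^bsub>G\<^esub> t)) t s @ v)"
| braid_trans: "braid_eq G S u v \<Longrightarrow> braid_eq G S v w \<Longrightarrow> braid_eq G S u w"

lemma braid_eq_in_context:
  assumes "braid_eq G S u v" "x \<in> lists S" "y \<in> lists S"
  shows "braid_eq G S (x @ u @ y) (x @ v @ y)"
  using assms(1)
proof induction
  case (braid_move u v s t)
  then show ?case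
    using braid_eq.braid_move[of "x @ u" S "v @ y" s t G] assms(2,3) by simp
next
  case (braid_refl u)
  then show ?case using assms(2,3) by (intro braid_eq.braid_refl) simp
next
  case (braid_trans u v w)
  then show ?case by (blast intro: braid_eq.braid_trans)
qed

context coxeter_system
begin

lemma S_carrier [simp]: "s \<in> S \<Longrightarrow> s \<in> carrier G"
  using S_subset by auto

lemma S_square: "s \<in> S \<Longrightarrow> s \<otimes> s = \<one>"
  using involution by auto

lemma S_inv [simp]: "s \<in> S \<Longrightarrow> inv s = s"
  by (rule inv_equality) (auto simp: S_square)

lemma word_prod_closed [simp]: "ws \<in> lists S \<Longrightarrow> word_prod G ws \<in> carrier G"
  by (induction ws) auto

lemma word_prod_append:
  "u \<in> lists S \<Longrightarrow> v \<in> lists S \<Longrightarrow> word_prod G (u @ v) = word_prod G u \<otimes> word_prod G v"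
  by (induction u) (auto simp: m_assoc)

section \<open>Reflections of a word and the parity of their multiplicities\<close>

lemma pow_conj_shift:
  assumes "s \<in> carrier G" "t \<in> carrier G"
  shows "s \<otimes> (t \<otimes> s) [^] (j::nat) \<otimes> t = (s \<otimes> t) [^] Suc j"
proof (induction j)
  case (Suc j)
  have "s \<otimes> (t \<otimes> s) [^] Suc j \<otimes> t = (s \<otimes> (t \<otimes> s) [^] j \<otimes> t) \<otimes> (s \<otimes> t)"
    using assms by (simp add: m_assoc)
  then show ?case using Suc by simp
qed (use assms in simp)

text \<open>The entry of a letter is the reflection whose right multiplication deletes that letter
  from the product. Modulo 2 the multiplicities depend only on the product; this is the classical
  route from the presentation to the exchange condition.\<close>

primrec refls :: "'w list \<Rightarrow> 'w list" where
  "refls [] = []"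
| "refls (s # ws) = (inv (word_prod G ws) \<otimes> s \<otimes> word_prod G ws) # refls ws"

lemma length_refls [simp]: "length (refls ws) = length ws"
  by (induction ws) auto

lemma refls_carrier: "ws \<in> lists S \<Longrightarrow> set (refls ws) \<subseteq> carrier G"
  by (induction ws) auto

lemma refls_append:
  assumes "u \<in> lists S" "v \<in> lists S"
  shows "refls (u @ v) = map (\<lambda>r. inv (word_prod G v) \<otimes> r \<otimes> word_prod G v) (refls u) @ refls v"
  using assms(1)
proof (induction u)
  case (Cons s u)
  then show ?case using assms(2)
    by (auto simp: word_prod_append inv_mult_group m_assoc)
qed simp

lemma refls_alt_word:
  assumes "s \<in> S" "t \<in> S"
  shows "refls (alt_word k t s) = rev (map (\<lambda>j. t \<otimes> (s \<otimes> t) [^] j) [0..<k])"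
  using assms
proof (induction k arbitrary: s t)
  case (Suc k)
  have "refls (alt_word (Suc k) t s) = map (\<lambda>r. t \<otimes> r \<otimes> t) (refls (alt_word k s t)) @ [t]"
    using Suc.prems by (simp add: refls_append alt_word_in_lists del: in_lists_conv_set)
  also have "\<dots> = rev (map (\<lambda>j. t \<otimes> (s \<otimes> (t \<otimes> s) [^] j) \<otimes> t) [0..<k]) @ [t]"
    using Suc.IH[of t s] Suc.prems by (simp add: rev_map comp_def)
  also have "\<dots> = rev (map (\<lambda>j. t \<otimes> (s \<otimes> t) [^] Suc j) [0..<k]) @ [t]"
    using Suc.prems by (simp only: pow_conj_shift[symmetric] m_assoc S_carrier m_closed nat_pow_closed)
  also have "\<dots> = rev (map (\<lambda>j. t \<otimes> (s \<otimes> t) [^] j) [0..<Suc k])"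
    using Suc.prems by (simp only: map_upt_Suc) simp
  finally show ?case .
qed simp

lemma word_prod_alt_word_even:
  "s \<in> S \<Longrightarrow> t \<in> S \<Longrightarrow> word_prod G (alt_word (2 * n) t s) = (s \<otimes> t) [^] n"
proof (induction n)
  case (Suc n)
  then have "word_prod G (alt_word (Suc (Suc (2 * n))) t s) = (s \<otimes> t) [^] n \<otimes> (s \<otimes> t)"
    by (simp add: word_prod_append alt_word_in_lists m_assoc del: in_lists_conv_set)
  then show ?case by simp
qed simp

lemma coxeter_cong_length_parity: "coxeter_cong G S u v \<Longrightarrow> even (length u) = even (length v)"
  by (induction rule: coxeter_cong.induct) (auto simp: concat_replicate_eq_alt_word)

text \<open>The relator has product 1, so inserting it does not change the reflections of the
  letters before it. Its own reflections are, up to conjugation, \<open>t (s t)^j\<close> for j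
  below twice the order of \<open>s t\<close>: two full periods, so each occurs an even number of
  times.\<close>

lemma coxeter_cong_refls_parity:
  "coxeter_cong G S u v \<Longrightarrow> even (count_list (refls u) r) = even (count_list (refls v) r)"
proof (induction rule: coxeter_cong.induct)
  case (relation u v s t)
  let ?n = "ord (s \<otimes> t)" and ?f = "\<lambda>j. t \<otimes> (s \<otimes> t) [^] (j::nat)"
  let ?R = "alt_word (2 * ?n) t s" and ?c = "\<lambda>r. inv (word_prod G v) \<otimes> r \<otimes> word_prod G v"
  have R: "?R \<in> lists S" using relation by (simp add: alt_word_in_lists del: in_lists_conv_set)
  have one: "word_prod G ?R = \<one>" using relation by (simp add: word_prod_alt_word_even pow_ord_eq_1)
  have "map ?f [0..<2 * ?n] = map ?f [0..<?n] @ map ?f [?n..<?n + ?n]"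
    by (simp add: mult_2 upt_add_eq_append[of 0 ?n ?n] del: upt_conv_Cons)
  also have "map ?f [?n..<?n + ?n] = map ?f [0..<?n]"
  proof -
    have "?f (j + ?n) = ?f j" for j
      using relation nat_pow_mult[of "s \<otimes> t" j ?n, symmetric] by (simp add: pow_ord_eq_1)
    then show ?thesis by (subst map_add_upt[symmetric]) (simp add: comp_def)
  qed
  finally have "refls ?R = rev (map ?f [0..<?n] @ map ?f [0..<?n])"
    using relation by (simp add: refls_alt_word)
  then have "even (count_list (map ?c (refls ?R)) r)" by simp
  moreover have "refls (u @ ?R @ v) = map ?c (refls u) @ map ?c (refls ?R) @ refls v"
    using relation R one by (simp add: refls_append word_prod_append del: in_lists_conv_set)
  ultimately show ?case
    using relation by (simp add: refls_append concat_replicate_eq_alt_word del: in_lists_conv_set)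
qed auto

lemma refls_parity:
  "u \<in> lists S \<Longrightarrow> v \<in> lists S \<Longrightarrow> word_prod G u = word_prod G v \<Longrightarrow>
    even (count_list (refls u) r) = even (count_list (refls v) r)"
  using presentation coxeter_cong_refls_parity by blast

lemma length_parity:
  "u \<in> lists S \<Longrightarrow> v \<in> lists S \<Longrightarrow> word_prod G u = word_prod G v \<Longrightarrow> even (length u) = even (length v)"
  using presentation coxeter_cong_length_parity by blast

section \<open>Word length and the exchange condition\<close>

lemma word_length_le: "ws \<in> lists S \<Longrightarrow> word_length G S (word_prod G ws) \<le> length ws"
  unfolding word_length_def by (rule Least_le) auto

lemma ex_word:
  assumes "w \<in> carrier G"
  shows "\<exists>ws\<in>lists S. word_prod G ws = w"
proof -
  have "w \<in> generate G S" using assms generates by simp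
  then show ?thesis
  proof (induction rule: generate.induct)
    case one
    show ?case by (intro bexI[of _ "[]"]) auto
  next
    case (incl s)
    then show ?case by (intro bexI[of _ "[s]"]) auto
  next
    case (inv s)
    then show ?case by (intro bexI[of _ "[s]"]) auto
  next
    case (eng g h)
    then obtain u v where "u \<in> lists S" "v \<in> lists S" "word_prod G u = g" "word_prod G v = h" by auto
    then show ?case by (intro bexI[of _ "u @ v"]) (auto simp: word_prod_append)
  qed
qed

definition reduced :: "'w list \<Rightarrow> bool" where
  "reduced ws \<longleftrightarrow> ws \<in> lists S \<and> length ws = word_length G S (word_prod G ws)"

lemma reduced_lists: "reduced ws \<Longrightarrow> ws \<in> lists S"
  by (simp add: reduced_def)

lemma ex_reduced:
  assumes "w \<in> carrier G"
  shows "\<exists>ws. reduced ws \<and> word_prod G ws = w"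
proof -
  have "\<exists>n. \<exists>ws\<in>lists S. word_prod G ws = w \<and> length ws = n" using ex_word[OF assms] by auto
  from LeastI_ex[OF this] show ?thesis unfolding reduced_def word_length_def by auto
qed

lemma reduced_length_le:
  "reduced ws \<Longrightarrow> u \<in> lists S \<Longrightarrow> word_prod G u = word_prod G ws \<Longrightarrow> length ws \<le> length u"
  using word_length_le[of u] by (simp add: reduced_def)

lemma reduced_same_length:
  "reduced ws \<Longrightarrow> u \<in> lists S \<Longrightarrow> word_prod G u = word_prod G ws \<Longrightarrow> length u = length ws \<Longrightarrow> reduced u"
  by (simp add: reduced_def)

lemma reduced_prefix:
  assumes "reduced (u @ v)"
  shows "reduced u"
proof -
  have uv: "u \<in> lists S" "v \<in> lists S" using assms by (auto simp: reduced_def)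
  obtain u' where u': "reduced u'" "word_prod G u' = word_prod G u" using ex_reduced[OF word_prod_closed[OF uv(1)]] by blast
  then have "length (u @ v) \<le> length (u' @ v)"
    using uv by (intro reduced_length_le[OF assms]) (auto simp: reduced_def word_prod_append)
  then show ?thesis using u' uv word_length_le[OF uv(1)] by (simp add: reduced_def)
qed

lemma refls_mem_exchange:
  assumes "s \<in> set (refls ws)" "ws \<in> lists S" "s \<in> S"
  shows "\<exists>x r y. ws = x @ [r] @ y \<and> word_prod G (x @ y @ [s]) = word_prod G ws"
  using assms(1,2)
proof (induction ws)
  case (Cons r ws)
  show ?case
  proof (cases "s \<in> set (refls ws)")
    case True
    with Cons obtain x r' y where *: "ws = x @ [r'] @ y" "word_prod G (x @ y @ [s]) = word_prod G ws"
      by auto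
    then show ?thesis by (intro exI[of _ "r # x"] exI[of _ r'] exI[of _ y]) simp
  next
    case False
    then have s: "s = inv (word_prod G ws) \<otimes> r \<otimes> word_prod G ws" using Cons.prems by simp
    have ws: "ws \<in> lists S" "r \<in> S" using Cons.prems by auto
    have "word_prod G (ws @ [s]) = word_prod G ws \<otimes> s" using ws assms(3) by (simp add: word_prod_append)
    also have "\<dots> = word_prod G (r # ws)"
      by (subst s) (use ws in \<open>simp add: m_assoc[symmetric]\<close>)
    finally show ?thesis by (intro exI[of _ "[]"] exI[of _ r] exI[of _ ws]) simp
  qed
qed simp

lemma count_list_conj:
  assumes "s \<in> S" "set L \<subseteq> carrier G"
  shows "count_list (map (\<lambda>r. s \<otimes> r \<otimes> s) L) s = count_list L s"
  using assms(2)
proof (induction L)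
  case (Cons r L)
  have "s \<otimes> r \<otimes> s = s \<longleftrightarrow> r = s"
  proof
    assume "s \<otimes> r \<otimes> s = s"
    then have "s \<otimes> (s \<otimes> r \<otimes> s) \<otimes> s = s \<otimes> s \<otimes> s" by simp
    moreover have "s \<otimes> (s \<otimes> r \<otimes> s) \<otimes> s = (s \<otimes> s) \<otimes> r \<otimes> (s \<otimes> s)"
      using assms(1) Cons.prems by (simp add: m_assoc)
    ultimately show "r = s" using assms(1) Cons.prems by (simp add: S_square)
  qed (use assms(1) in \<open>simp add: S_square\<close>)
  with Cons show ?case by simp
qed simp

text \<open>Let u be a reduced word for the product times s, and compare \<open>ws\<close> with
  \<open>u @ [s]\<close>. If s were a reflection of u, deleting a letter of u would give a word for
  the same element as \<open>ws\<close> but shorter. So s occurs exactly once among the reflections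
  of \<open>u @ [s]\<close>, hence an odd number of times for \<open>ws\<close>, and a letter of
  \<open>ws\<close> can be traded for a final s.\<close>

lemma exchange:
  assumes ws: "reduced ws" and s: "s \<in> S"
    and less: "word_length G S (word_prod G ws \<otimes> s) < length ws"
  shows "\<exists>x r y. ws = x @ [r] @ y \<and> word_prod G (x @ y @ [s]) = word_prod G ws"
proof (rule refls_mem_exchange)
  show "s \<in> S" by fact
  show lists: "ws \<in> lists S" using ws by (rule reduced_lists)
  obtain u where u: "reduced u" "word_prod G u = word_prod G ws \<otimes> s"
    using ex_reduced[of "word_prod G ws \<otimes> s"] lists s by auto
  have us: "word_prod G (u @ [s]) = word_prod G ws"
    using u lists s by (simp add: reduced_def word_prod_append m_assoc S_square)
  have "s \<notin> set (refls u)"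
  proof
    assume "s \<in> set (refls u)"
    then obtain x r y where xy: "u = x @ [r] @ y" "word_prod G (x @ y @ [s]) = word_prod G u"
      using refls_mem_exchange u(1) s reduced_lists by blast
    then have xyS: "x \<in> lists S" "y \<in> lists S" using u(1) by (auto simp: reduced_def)
    have "word_prod G ws = word_prod G (x @ y) \<otimes> s \<otimes> s"
      using us xy(2) xyS s u(1) by (simp add: word_prod_append reduced_def m_assoc)
    then have "word_prod G (x @ y) = word_prod G ws" using xyS s by (simp add: m_assoc S_square)
    then have "length ws \<le> length (x @ y)" using xyS by (intro reduced_length_le[OF ws]) auto
    moreover have "length u < length ws" using u less by (simp add: reduced_def)
    ultimately show False using xy(1) by simp
  qed
  moreover have "refls (u @ [s]) = map (\<lambda>r. s \<otimes> r \<otimes> s) (refls u) @ [s]"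
    using u s by (simp add: refls_append reduced_def)
  ultimately have "count_list (refls (u @ [s])) s = 1"
    using count_list_conj[OF s refls_carrier] u s by (simp add: reduced_def)
  then have "odd (count_list (refls ws) s)"
    using refls_parity[of "u @ [s]" ws s] us lists u s by (simp add: reduced_def)
  then show "s \<in> set (refls ws)" by (metis count_notin even_zero)
qed

section \<open>Alternating words of two generators and Matsumoto's theorem\<close>

lemma ord_swap: "s \<in> S \<Longrightarrow> t \<in> S \<Longrightarrow> ord (t \<otimes> s) = ord (s \<otimes> t)"
  using ord_inv[of "s \<otimes> t"] by (simp add: inv_mult_group)

lemma word_prod_alt_word_swap:
  assumes "s \<in> S" "t \<in> S"
  shows "word_prod G (alt_word k s t) = word_prod G (alt_word k t s) \<otimes> (t \<otimes> s) [^] k"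
  using assms
proof (induction k arbitrary: s t)
  case (Suc k)
  note st = Suc.prems
  let ?A = "word_prod G (alt_word k s t)"
  have A: "?A \<in> carrier G" using st by (intro word_prod_closed alt_word_in_lists)
  have "word_prod G (alt_word (Suc k) s t) = word_prod G (alt_word k t s) \<otimes> s"
    using st by (simp add: word_prod_append alt_word_in_lists del: in_lists_conv_set)
  also have "\<dots> = ?A \<otimes> ((s \<otimes> t) [^] k \<otimes> s)"
    using Suc.IH[of t s] st A by (simp add: m_assoc)
  also have "(s \<otimes> t) [^] k \<otimes> s = t \<otimes> (t \<otimes> s) [^] Suc k"
  proof -
    have "t \<otimes> (t \<otimes> s) [^] Suc k = t \<otimes> (t \<otimes> (s \<otimes> t) [^] k \<otimes> s)"
      using pow_conj_shift[of t s k] st by simp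
    also have "\<dots> = (t \<otimes> t) \<otimes> ((s \<otimes> t) [^] k \<otimes> s)" using st by (simp add: m_assoc)
    finally show ?thesis using st by (simp add: S_square)
  qed
  also have "?A \<otimes> (t \<otimes> (t \<otimes> s) [^] Suc k) = word_prod G (alt_word (Suc k) t s) \<otimes> (t \<otimes> s) [^] Suc k"
    using st A by (simp add: word_prod_append alt_word_in_lists m_assoc del: in_lists_conv_set nat_pow_Suc)
  finally show ?case .
qed simp

lemma word_prod_alt_word_ord:
  "s \<in> S \<Longrightarrow> t \<in> S \<Longrightarrow>
    word_prod G (alt_word (ord (s \<otimes> t)) s t) = word_prod G (alt_word (ord (s \<otimes> t)) t s)"
  using word_prod_alt_word_swap[of s t "ord (s \<otimes> t)"] ord_swap[of s t] pow_ord_eq_1[of "t \<otimes> s"]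
  by (simp add: alt_word_in_lists del: in_lists_conv_set)

lemma count_list_distinct: "distinct L \<Longrightarrow> r \<in> set L \<Longrightarrow> count_list L r = 1"
  by (induction L) auto

text \<open>The k reflections are distinct because k does not exceed the order. Each has odd
  multiplicity, so it occurs for every other word with the same product, which therefore has at
  least k letters.\<close>

lemma reduced_alt_word:
  assumes st: "s \<in> S" "t \<in> S" and k: "k \<le> ord (s \<otimes> t)"
  shows "reduced (alt_word k t s)"
proof -
  have lists: "alt_word k t s \<in> lists S" using st by (intro alt_word_in_lists)
  obtain u where u: "reduced u" "word_prod G u = word_prod G (alt_word k t s)"
    using ex_reduced[OF word_prod_closed[OF lists]] by blast
  have "inj_on (\<lambda>j. t \<otimes> (s \<otimes> t) [^] j) {0..<k}"
  proof (rule inj_onI)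
    fix i j assume ij: "i \<in> {0..<k}" "j \<in> {0..<k}" "t \<otimes> (s \<otimes> t) [^] i = t \<otimes> (s \<otimes> t) [^] j"
    then have "(s \<otimes> t) [^] i = (s \<otimes> t) [^] j" using st by simp
    moreover have "i \<in> {0..ord (s \<otimes> t) - 1}" "j \<in> {0..ord (s \<otimes> t) - 1}" using ij k by auto
    ultimately show "i = j" using ord_inj[of "s \<otimes> t"] st by (auto dest: inj_onD)
  qed
  then have dist: "distinct (refls (alt_word k t s))"
    using st by (simp add: refls_alt_word distinct_map)
  have "set (refls (alt_word k t s)) \<subseteq> set (refls u)"
  proof
    fix r assume "r \<in> set (refls (alt_word k t s))"
    then have "count_list (refls (alt_word k t s)) r = 1"
      using dist by (intro count_list_distinct)
    then have "odd (count_list (refls u) r)"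
      using refls_parity[of u "alt_word k t s" r] u lists by (simp add: reduced_def del: in_lists_conv_set)
    then show "r \<in> set (refls u)" by (metis count_notin even_zero)
  qed
  then have "card (set (refls (alt_word k t s))) \<le> card (set (refls u))" by (intro card_mono) auto
  also have "\<dots> \<le> length u" using card_length[of "refls u"] by simp
  finally have "k \<le> length u" using distinct_card[OF dist] by simp
  then show ?thesis using u lists word_length_le[OF lists] by (simp add: reduced_def del: in_lists_conv_set)
qed

text \<open>If the suffix ends in p, exchange with the other letter q appends q and deletes a
  letter. If that letter stands before the suffix, the suffix has grown. Otherwise an alternating
  word of length k + 1 would equal a word of length k - 1, against \<open>reduced_alt_word\<close>.
  The roles of p and q swap at every step, so their assignment to s and t is left open.\<close>

lemma dihedral_suffix:
  assumes a: "reduced (a @ [s])" and st: "s \<in> S" "t \<in> S" "s \<noteq> t"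
    and desc: "word_length G S (word_prod G (a @ [s]) \<otimes> t) < length (a @ [s])"
    and k: "1 \<le> k" "k \<le> ord (s \<otimes> t)"
  shows "\<exists>c p q. (p = s \<and> q = t \<or> p = t \<and> q = s) \<and> reduced (c @ alt_word k p q) \<and>
    word_prod G (c @ alt_word k p q) = word_prod G (a @ [s])"
  using k
proof (induction k rule: dec_induct)
  case base
  show ?case using a by (intro exI[of _ a] exI[of _ s] exI[of _ t]) simp
next
  case (step k)
  let ?w = "word_prod G (a @ [s])"
  obtain c p q where pq: "p = s \<and> q = t \<or> p = t \<and> q = s"
    and red: "reduced (c @ alt_word k p q)" and w: "word_prod G (c @ alt_word k p q) = ?w"
    using step by auto
  have len: "length (c @ alt_word k p q) = length (a @ [s])"
    using red a w by (simp add: reduced_def)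
  have aS: "a \<in> lists S" and c: "c \<in> lists S" using a red by (auto simp: reduced_def)
  have pqS: "p \<in> S" "q \<in> S" using pq st by auto
  have alt: "alt_word i p q \<in> lists S" "alt_word i q p \<in> lists S" for i
    using pqS by (intro alt_word_in_lists; simp)+
  have "word_length G S (?w \<otimes> s) < length (a @ [s])"
  proof -
    have "?w \<otimes> s = word_prod G a" using aS st by (simp add: word_prod_append m_assoc S_square)
    then show ?thesis using word_length_le[OF aS] by simp
  qed
  then have "word_length G S (word_prod G (c @ alt_word k p q) \<otimes> q) < length (c @ alt_word k p q)"
    using desc pq unfolding w len by auto
  from exchange[OF red pqS(2) this] obtain x r y
    where xy: "c @ alt_word k p q = x @ [r] @ y"
      and prod: "word_prod G (x @ y @ [q]) = ?w" unfolding w by blast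
  have xyS: "x \<in> lists S" "y \<in> lists S" using c alt(1)[of k] xy by (metis append_in_lists_conv)+
  show ?case
  proof (cases "length x < length c")
    case True
    then have "c = x @ [r] @ drop (Suc (length x)) c \<and> y = drop (Suc (length x)) c @ alt_word k p q"
      using xy by (auto simp: append_eq_append_conv2 Cons_eq_append_conv append_eq_Cons_conv)
    then obtain z where z: "c = x @ [r] @ z" "y = z @ alt_word k p q" by blast
    have eq: "word_prod G ((x @ z) @ alt_word (Suc k) q p) = ?w" using prod z by simp
    have "reduced ((x @ z) @ alt_word (Suc k) q p)"
    proof (rule reduced_same_length[OF a _ eq])
      show "(x @ z) @ alt_word (Suc k) q p \<in> lists S"
        using c z(1) alt(2)[of "Suc k"] by (simp del: alt_word.simps)
      show "length ((x @ z) @ alt_word (Suc k) q p) = length (a @ [s])" using len z(1) by simp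
    qed
    then show ?thesis using eq pq by blast
  next
    case False
    then obtain x' where x': "x = c @ x'" "alt_word k p q = x' @ [r] @ y"
      using xy by (auto simp: append_eq_append_conv2)
    have x'S: "x' \<in> lists S" using xyS x' by simp
    have "word_prod G c \<otimes> word_prod G (x' @ y @ [q]) = word_prod G c \<otimes> word_prod G (alt_word k p q)"
      using prod w x' c x'S xyS pqS alt(1)[of k]
      by (simp add: word_prod_append del: in_lists_conv_set)
    then have "word_prod G (x' @ y @ [q]) = word_prod G (alt_word k p q)"
    proof -
      have "x' @ y @ [q] \<in> lists S" using x'S xyS pqS by simp
      then show ?thesis
        using \<open>word_prod G c \<otimes> _ = _\<close> Units_l_cancel[of "word_prod G c", unfolded Units_eq] word_prod_closed[OF c]
          word_prod_closed[OF alt(1)[of k]] word_prod_closed[of "x' @ y @ [q]"] by metis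
    qed
    then have eq: "word_prod G (x' @ y) \<otimes> q = word_prod G (alt_word k p q)"
      using word_prod_append[of "x' @ y" "[q]"] x'S xyS pqS by simp
    have "word_prod G (alt_word (Suc k) q p) = word_prod G (x' @ y) \<otimes> q \<otimes> q"
      unfolding eq using word_prod_append[OF alt(1)[of k], of "[q]"] pqS by simp
    also have "\<dots> = word_prod G (x' @ y)"
      using word_prod_closed[of "x' @ y"] x'S xyS pqS by (simp add: m_assoc S_square)
    finally have "word_prod G (x' @ y) = word_prod G (alt_word (Suc k) q p)" ..
    moreover have "reduced (alt_word (Suc k) q p)"
      using step pq pqS ord_swap[OF st(1,2)] by (intro reduced_alt_word) auto
    ultimately have "Suc k \<le> length (x' @ y)"
      using reduced_length_le[of "alt_word (Suc k) q p" "x' @ y"] x'S xyS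
      by (simp del: alt_word.simps)
    moreover have "k = Suc (length (x' @ y))" using arg_cong[OF x'(2), of length] by simp
    ultimately show ?thesis by simp
  qed
qed

text \<open>If the last letters s and t differ, the element is shortened by both, and
  \<open>dihedral_suffix\<close> supplies a word c followed by an alternating word of full length.
  One braid move switches its last letter between s and t; the two forms share their last letter
  with u and v respectively, and the induction hypothesis applies once it is removed.\<close>

lemma matsumoto:
  assumes fin: "finite (carrier G)"
  shows "reduced u \<Longrightarrow> reduced v \<Longrightarrow> word_prod G u = word_prod G v \<Longrightarrow> braid_eq G S u v"
proof (induction "length u" arbitrary: u v rule: less_induct)
  case less
  have len: "length u = length v" using less.prems by (simp add: reduced_def)
  show ?case
  proof (cases u rule: rev_cases)
    case Nil
    then show ?thesis using len by (auto intro: braid_refl)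
  next
    case u: (snoc a s)
    then obtain b t where v: "v = b @ [t]" using len by (cases v rule: rev_cases) auto
    have S: "a \<in> lists S" "b \<in> lists S" "s \<in> S" "t \<in> S" using less.prems u v by (auto simp: reduced_def)
    have red: "reduced a" "reduced b" using less.prems u v reduced_prefix by auto
    show ?thesis
    proof (cases "s = t")
      case True
      then have "word_prod G a = word_prod G b"
        using less.prems(3) S unfolding u v by (simp add: word_prod_append)
      then have "braid_eq G S a b" using less.hyps[of a b] red u by simp
      then show ?thesis using braid_eq_in_context[of G S a b "[]" "[s]"] S True u v by simp
    next
      case False
      let ?m = "ord (s \<otimes> t)"
      have m: "1 \<le> ?m" using ord_ge_1[OF fin] S by simp
      then obtain k where k: "?m = Suc k" by (cases ?m) auto
      have "word_prod G (a @ [s]) \<otimes> t = word_prod G b"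
        using less.prems(3) S unfolding u v by (simp add: word_prod_append m_assoc S_square)
      then have "word_length G S (word_prod G (a @ [s]) \<otimes> t) < length (a @ [s])"
        using word_length_le[OF S(2)] len u v by simp
      from dihedral_suffix[OF _ S(3,4) False this m order.refl] less.prems(1) u
      obtain c p q where c: "p = s \<and> q = t \<or> p = t \<and> q = s" "reduced (c @ alt_word ?m p q)"
        "word_prod G (c @ alt_word ?m p q) = word_prod G u" by auto
      have cS: "c \<in> lists S" using c(2) by (auto simp: reduced_def)
      have alt: "alt_word i s t \<in> lists S" "alt_word i t s \<in> lists S" for i
        using S by (intro alt_word_in_lists; simp)+
      have words: "word_prod G (c @ alt_word ?m s t) = word_prod G u"
        "word_prod G (c @ alt_word ?m t s) = word_prod G u"
        using c(1,3) word_prod_alt_word_ord[OF S(3,4)]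
          word_prod_append[OF cS alt(1)[of ?m]] word_prod_append[OF cS alt(2)[of ?m]] by auto
      have lenc: "length c + ?m = length u"
        using c(2,3) less.prems(1) by (simp add: reduced_def)
      have mid: "reduced (c @ alt_word k z y) \<and> word_prod G (c @ alt_word k z y) = word_prod G x"
        if x: "reduced x" "Suc (length x) = length u" "word_prod G (x @ [y]) = word_prod G u"
          and yz: "y = s \<and> z = t \<or> y = t \<and> z = s" for x y z
      proof -
        have altk: "c @ alt_word k z y \<in> lists S" and y: "y \<in> S" using yz alt S cS by auto
        have xS: "x \<in> lists S" using x(1) by (rule reduced_lists)
        have "word_prod G (c @ alt_word ?m y z) = word_prod G u" using words yz by auto
        then have "word_prod G ((c @ alt_word k z y) @ [y]) = word_prod G (x @ [y])"
          using x(3) unfolding k by simp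
        then have eq: "word_prod G (c @ alt_word k z y) = word_prod G x"
          using word_prod_append[OF altk, of "[y]"] word_prod_append[OF xS, of "[y]"] y
            word_prod_closed[OF altk] word_prod_closed[OF xS] by simp
        then show ?thesis
          using reduced_same_length[OF x(1) altk eq] x(2) lenc k by simp
      qed
      have "braid_eq G S a (c @ alt_word k t s)"
        using less.hyps[of a "c @ alt_word k t s"] mid[of a s t] red u by simp
      from braid_eq_in_context[OF this, of "[]" "[s]"] S
      have 1: "braid_eq G S u (c @ alt_word ?m s t)" unfolding u k by simp
      have "braid_eq G S (c @ alt_word k s t) b"
        using less.hyps[of "c @ alt_word k s t" b] mid[of b t s] red u v len lenc k less.prems(3) by simp
      from braid_eq_in_context[OF this, of "[]" "[t]"] S
      have 2: "braid_eq G S (c @ alt_word ?m t s) v" unfolding v k by simp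
      have "braid_eq G S (c @ alt_word ?m s t) (c @ alt_word ?m t s)"
        using braid_move[of c S "[]" s t G] cS S False by simp
      with 1 2 show ?thesis by (blast intro: braid_trans)
    qed
  qed
qed

text \<open>Multiplication by s changes the parity of the length and cannot lengthen
  \<open>w0\<close>, so it shortens it. Exchange then produces a reduced word ending in s.\<close>

lemma longest_word_ending:
  assumes fin: "finite (carrier G)" and w0: "longest_element G S w0"
    and ws: "reduced_decomposition G S ws w0" and s: "s \<in> S"
  shows "\<exists>v\<in>lists S. braid_eq G S ws (v @ [s]) \<and> braid_eq G S (v @ [s]) ws"
proof -
  have red: "reduced ws" and w: "word_prod G ws = w0"
    using ws by (auto simp: reduced_def reduced_decomposition_def)
  have w0G: "w0 \<in> carrier G" using w0 by (simp add: longest_element_def)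
  obtain u where u: "reduced u" "word_prod G u = w0 \<otimes> s" using ex_reduced[of "w0 \<otimes> s"] w0G s by auto
  have "word_prod G (u @ [s]) = word_prod G ws"
    using u w w0G s by (simp add: word_prod_append reduced_def m_assoc S_square)
  then have "even (length (u @ [s])) = even (length ws)"
    using u red s by (intro length_parity) (auto simp: reduced_def)
  then have "length u \<noteq> length ws" by auto
  moreover have "length u \<le> length ws"
    using u red w w0 s by (simp add: reduced_def longest_element_def)
  ultimately have "word_length G S (word_prod G ws \<otimes> s) < length ws"
    using u w by (simp add: reduced_def)
  from exchange[OF red s this] obtain x r y where
    xy: "ws = x @ [r] @ y" "word_prod G (x @ y @ [s]) = word_prod G ws" by blast
  have "x @ y \<in> lists S" using red xy(1) by (auto simp: reduced_def)
  moreover have "reduced ((x @ y) @ [s])"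
    using red xy s by (intro reduced_same_length[OF red]) (auto simp: reduced_def)
  ultimately show ?thesis
    using matsumoto[OF fin red] matsumoto[OF fin _ red] xy by (intro bexI[of _ "x @ y"]) simp_all
qed

end

section \<open>Single root operators\<close>

locale simple_root =
  fixes T :: real and \<alpha> :: "'i \<Rightarrow> 'v::euclidean_space" and \<alpha>v :: "'i \<Rightarrow> 'v \<Rightarrow> real" and s :: 'i
  assumes T: "0 \<le> T" and lin: "linear (\<alpha>v s)" and two: "\<alpha>v s (\<alpha> s) = 2"
begin

abbreviation "P \<equiv> pitman T \<alpha> \<alpha>v s"
abbreviation "co \<eta> \<equiv> \<lambda>t. \<alpha>v s (\<eta> t)"

lemma root_neq_0: "\<alpha> s \<noteq> 0"
  using two linear_0[OF lin] by auto

lemma co_continuous: "\<eta> \<in> path_space T \<Longrightarrow> continuous_on {0..T} (co \<eta>)"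
  using continuous_linear_path lin by blast

lemma co_0: "\<eta> \<in> path_space T \<Longrightarrow> co \<eta> 0 = 0"
  using linear_0[OF lin] by (simp add: path_space_0)

lemma pitman_path: "\<eta> \<in> path_space T \<Longrightarrow> P \<eta> \<in> path_space T"
  by (intro pitman_in_path_space lin T)

lemma co_pitman: "0 \<le> t \<Longrightarrow> t \<le> T \<Longrightarrow> co (P \<eta>) t = co \<eta> t - 2 * run_inf (co \<eta>) t"
  using two by (simp add: pitman_apply linear_diff[OF lin] linear_cmul[OF lin])

lemma run_inf_co_nonpos: "\<eta> \<in> path_space T \<Longrightarrow> 0 \<le> t \<Longrightarrow> t \<le> T \<Longrightarrow> run_inf (co \<eta>) t \<le> 0"
  using run_inf_nonpos[OF co_continuous[of \<eta>]] co_0[of \<eta>] by simp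

lemma co_pitman_nonneg: "\<eta> \<in> path_space T \<Longrightarrow> 0 \<le> t \<Longrightarrow> t \<le> T \<Longrightarrow> 0 \<le> co (P \<eta>) t"
  using run_inf_le[OF co_continuous[of \<eta>], of t t] run_inf_co_nonpos[of \<eta> t]
  by (simp add: co_pitman)

lemma pitman_end: "P \<eta> T = \<eta> T + path_eps T \<alpha>v s \<eta> *\<^sub>R \<alpha> s"
  using T by (simp add: pitman_apply path_eps_eq)

lemma path_eps_nonneg: "\<eta> \<in> path_space T \<Longrightarrow> 0 \<le> path_eps T \<alpha>v s \<eta>"
  using run_inf_co_nonpos T by (simp add: path_eps_eq)

lemma path_eps_le: "\<eta> \<in> path_space T \<Longrightarrow> path_eps T \<alpha>v s \<eta> \<le> co (P \<eta>) T"
  using run_inf_le[OF co_continuous[of \<eta>], of T T] T by (simp add: path_eps_eq co_pitman)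

lemma path_phi_eq: "path_phi T \<alpha>v s \<eta> = co \<eta> T + path_eps T \<alpha>v s \<eta>"
  by (simp add: path_phi_def path_eps_def)

lemma dominant_fixed:
  assumes "\<eta> \<in> path_space T" "\<And>t. 0 \<le> t \<Longrightarrow> t \<le> T \<Longrightarrow> 0 \<le> co \<eta> t"
  shows "P \<eta> = \<eta>" "path_eps T \<alpha>v s \<eta> = 0"
proof -
  have *: "run_inf (co \<eta>) t = 0" if "0 \<le> t" "t \<le> T" for t
    using that assms co_0 by (intro run_inf_eq_0) auto
  show "path_eps T \<alpha>v s \<eta> = 0" using * T by (simp add: path_eps_eq)
  show "P \<eta> = \<eta>"
    using assms(1) * by (intro path_space_eqI[OF pitman_path]) (auto simp: pitman_apply)
qed

lemma path_eps_0_imp_fixed: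
  assumes "\<eta> \<in> path_space T" "path_eps T \<alpha>v s \<eta> = 0"
  shows "P \<eta> = \<eta>"
proof (rule dominant_fixed(1)[OF assms(1)])
  fix t assume "0 \<le> t" "t \<le> T"
  then show "0 \<le> co \<eta> t"
    using run_inf_le[OF co_continuous[OF assms(1)], of t T] assms(2) by (simp add: path_eps_eq)
qed

lemma pitman_eps_inject:
  assumes \<eta>: "\<eta> \<in> path_space T" "\<eta>' \<in> path_space T"
    and P: "P \<eta> = P \<eta>'" and eps: "path_eps T \<alpha>v s \<eta> = path_eps T \<alpha>v s \<eta>'"
  shows "\<eta> = \<eta>'"
proof (rule path_space_eqI[OF \<eta>])
  fix t assume t: "0 \<le> t" "t \<le> T"
  have rec: "y \<le> - run_inf (co \<zeta>) t \<longleftrightarrow> y \<le> path_eps T \<alpha>v s \<zeta> \<and> (\<forall>r\<in>{t..T}. y \<le> co (P \<zeta>) r)"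
    if "\<zeta> \<in> path_space T" for \<zeta> y
    using run_inf_recover[OF co_continuous[OF that] t] t by (simp add: path_eps_eq co_pitman)
  have "- run_inf (co \<eta>) t = - run_inf (co \<eta>') t"
    by (rule real_eq_by_lower_bounds) (simp only: rec \<eta> P eps)
  then show "\<eta> t = \<eta>' t" using fun_cong[OF P, of t] t by (simp add: pitman_apply)
qed

lemma pitman_end_inject:
  assumes \<eta>: "\<eta> \<in> path_space T" "\<eta>' \<in> path_space T"
    and P: "P \<eta> = P \<eta>'" and end_eq: "\<eta> T = \<eta>' T"
  shows "\<eta> = \<eta>'"
proof (rule pitman_eps_inject[OF \<eta> P])
  have "path_eps T \<alpha>v s \<eta> *\<^sub>R \<alpha> s = path_eps T \<alpha>v s \<eta>' *\<^sub>R \<alpha> s"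
    using pitman_end[of \<eta>] pitman_end[of \<eta>'] P end_eq by auto
  then show "path_eps T \<alpha>v s \<eta> = path_eps T \<alpha>v s \<eta>'" using root_neq_0 by auto
qed

text \<open>The preimage is dictated by \<open>run_inf_recover\<close>: minus its running infimum
  must be M(t), the minimum of x and the future infimum J(t) of the coroot along the given path. The
  upper bound on x makes M(T) = x.\<close>

lemma pitman_surj:
  assumes \<zeta>: "\<zeta> \<in> path_space T" and fixed: "P \<zeta> = \<zeta>" and x: "0 \<le> x" "x \<le> co \<zeta> T"
  shows "\<exists>\<eta>\<in>path_space T. P \<eta> = \<zeta> \<and> path_eps T \<alpha>v s \<eta> = x"
proof -
  define u where "u = co \<zeta>"
  have u: "continuous_on {0..T} u" unfolding u_def by (rule co_continuous[OF \<zeta>])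
  have u0: "u 0 = 0" unfolding u_def by (rule co_0[OF \<zeta>])
  have u_nonneg: "0 \<le> u t" if "0 \<le> t" "t \<le> T" for t
    using co_pitman_nonneg[OF \<zeta> that] by (simp add: fixed u_def)
  \<comment> \<open>A future infimum, written as the running infimum of the reversed function so
    that continuity is inherited.\<close>
  define J where "J = (\<lambda>t. run_inf (\<lambda>r. u (T - r)) (T - t))"
  define M where "M = (\<lambda>t. min x (J t))"
  have urev: "continuous_on {0..T} (\<lambda>r. u (T - r))"
    by (rule continuous_on_compose2[OF u]) (auto intro!: continuous_intros)
  have le_J: "c \<le> J t \<longleftrightarrow> (\<forall>r\<in>{t..T}. c \<le> u r)" if "0 \<le> t" "t \<le> T" for c t
  proof -
    have "c \<le> J t \<longleftrightarrow> (\<forall>r\<in>{0..T - t}. c \<le> u (T - r))"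
      unfolding J_def using that by (intro le_run_inf_iff[OF urev]) auto
    also have "\<dots> \<longleftrightarrow> (\<forall>r\<in>{t..T}. c \<le> u r)"
    proof
      assume *: "\<forall>r\<in>{0..T - t}. c \<le> u (T - r)"
      show "\<forall>r\<in>{t..T}. c \<le> u r"
      proof
        fix r assume "r \<in> {t..T}"
        then show "c \<le> u r" using bspec[OF *, of "T - r"] by simp
      qed
    qed simp
    finally show ?thesis .
  qed
  have J_le: "J t \<le> u r" if "0 \<le> t" "t \<le> r" "r \<le> T" for t r
    using le_J[of t "J t"] that by simp
  have J_mono: "J t \<le> J t'" if "0 \<le> t" "t \<le> t'" "t' \<le> T" for t t'
    using le_J[of t' "J t"] J_le that by simp
  have "continuous_on {0..T} J"
    unfolding J_def
    by (rule continuous_on_compose2[OF continuous_run_inf[OF urev]]) (auto intro!: continuous_intros)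
  then have M_cont: "continuous_on {0..T} M" unfolding M_def by (intro continuous_intros)
  have M_mono: "M t \<le> M t'" if "0 \<le> t" "t \<le> t'" "t' \<le> T" for t t'
    using J_mono[OF that] by (auto simp: M_def)
  have M_le: "M t \<le> u t" if "0 \<le> t" "t \<le> T" for t
    using J_le[of t t] that by (auto simp: M_def)
  have M_nonneg: "0 \<le> M t" if "0 \<le> t" "t \<le> T" for t
    using le_J[of t 0] u_nonneg that x by (auto simp: M_def)
  have M0: "M 0 = 0" using M_nonneg[of 0] M_le[of 0] u0 T by simp
  have "u T \<le> J T" using le_J[of T "u T"] T by simp
  then have MT: "M T = x" using x by (auto simp: M_def u_def)
  define \<eta> where "\<eta> = (\<lambda>t\<in>{0..T}. \<zeta> t - M t *\<^sub>R \<alpha> s)"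
  have \<eta>: "\<eta> \<in> path_space T"
    unfolding \<eta>_def
    by (rule restrict_in_path_space)
      (use \<zeta> M_cont M0 T in \<open>auto intro!: continuous_intros simp: path_space_def\<close>)
  have co_\<eta>: "co \<eta> t = u t - 2 * M t" if "0 \<le> t" "t \<le> T" for t
    using that two by (simp add: \<eta>_def u_def linear_diff[OF lin] linear_cmul[OF lin])
  have inf: "run_inf (co \<eta>) t = - M t" if t: "0 \<le> t" "t \<le> T" for t
  proof (rule antisym)
    have "- M t \<le> co \<eta> r" if "r \<in> {0..t}" for r
      using that t M_mono[of r t] M_le[of r] by (simp add: co_\<eta>)
    then show "- M t \<le> run_inf (co \<eta>) t" using le_run_inf_iff[OF co_continuous[OF \<eta>] t] by simp
    let ?K = "{r \<in> {0..t}. u r \<le> M t}"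
    have ut: "continuous_on {0..t} u" using u t by (auto intro: continuous_on_subset)
    have "compact ?K"
      using continuous_closed_preimage[OF ut, of "{..M t}"]
      by (auto simp: compact_eq_bounded_closed vimage_def Int_def conj_commute
          intro: bounded_subset[of "{0..t}"])
    moreover have "0 \<in> ?K" using t u0 M_nonneg by simp
    \<comment> \<open>The last time up to t at which u is at most M(t). From there on u is at least
      M(t), so M(r) = M(t) = u(r), and the coroot along the new path takes the value -M(t) at
      r.\<close>
    ultimately obtain r where r: "r \<in> ?K" "\<And>r'. r' \<in> ?K \<Longrightarrow> r' \<le> r"
      using compact_attains_sup[of ?K] by blast
    have "continuous_on {r..t} u" using ut r(1) by (auto intro: continuous_on_subset)
    then obtain r' where r': "r \<le> r'" "r' \<le> t" "u r' = M t"
      using IVT'[of u r "M t" t] r(1) M_le[OF t] by auto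
    then have ur: "u r = M t" using r(2)[of r'] r(1) by auto
    have "M t \<le> J r"
    proof -
      have "M t \<le> u q" if "q \<in> {r..T}" for q
      proof (cases "q \<le> t")
        case True
        then show ?thesis using r(2)[of q] r(1) that ur by force
      next
        case False
        then show ?thesis using J_le[of t q] that t by (auto simp: M_def)
      qed
      then show ?thesis using le_J[of r "M t"] r(1) t by simp
    qed
    then have "M r = M t" using M_mono[of r t] r(1) t by (auto simp: M_def)
    then have "co \<eta> r = - M t" using co_\<eta>[of r] ur r(1) t by simp
    then show "run_inf (co \<eta>) t \<le> - M t"
      using run_inf_le[OF co_continuous[OF \<eta>], of r t] r(1) t by simp
  qed
  have "P \<eta> = \<zeta>"
    using inf by (intro path_space_eqI[OF pitman_path[OF \<eta>] \<zeta>]) (simp add: pitman_apply \<eta>_def)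
  moreover have "path_eps T \<alpha>v s \<eta> = x" using inf[of T] T MT by (simp add: path_eps_eq)
  ultimately show ?thesis using \<eta> by blast
qed

text \<open>Existence comes from \<open>pitman_surj\<close> with the new depth eps - r: the two
  bounds on r say exactly that this depth is nonnegative and at most the end value of the coroot
  along the transform.\<close>

lemma path_op_Some_iff:
  assumes \<eta>: "\<eta> \<in> path_space T"
  shows "path_op T \<alpha> \<alpha>v s r (Some \<eta>) = Some \<theta> \<longleftrightarrow>
    - path_phi T \<alpha>v s \<eta> \<le> r \<and> r \<le> path_eps T \<alpha>v s \<eta> \<and>
    \<theta> \<in> path_space T \<and> P \<theta> = P \<eta> \<and> \<theta> T = \<eta> T + r *\<^sub>R \<alpha> s"
proof (cases "- path_phi T \<alpha>v s \<eta> \<le> r \<and> r \<le> path_eps T \<alpha>v s \<eta>")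
  case True
  let ?Q = "\<lambda>\<theta>. \<theta> \<in> path_space T \<and> P \<theta> = P \<eta> \<and> \<theta> T = \<eta> T + r *\<^sub>R \<alpha> s"
  let ?x = "path_eps T \<alpha>v s \<eta> - r"
  have "co (P \<eta>) T = co \<eta> T + 2 * path_eps T \<alpha>v s \<eta>"
    using T by (simp add: co_pitman path_eps_eq)
  then have "?x \<le> co (P \<eta>) T" using True by (simp add: path_phi_eq)
  moreover have "P (P \<eta>) = P \<eta>"
    using dominant_fixed(1)[OF pitman_path[OF \<eta>] co_pitman_nonneg[OF \<eta>]] .
  ultimately obtain \<theta>' where \<theta>': "\<theta>' \<in> path_space T" "P \<theta>' = P \<eta>" "path_eps T \<alpha>v s \<theta>' = ?x"
    using pitman_surj[OF pitman_path[OF \<eta>], of ?x] True by auto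
  have "\<eta> T + path_eps T \<alpha>v s \<eta> *\<^sub>R \<alpha> s = \<theta>' T + ?x *\<^sub>R \<alpha> s"
    using pitman_end[of \<theta>'] pitman_end[of \<eta>] \<theta>'(2) unfolding \<theta>'(3) by simp
  then have Q: "?Q \<theta>'" using \<theta>' by (simp add: scaleR_left_diff_distrib algebra_simps)
  have uniq: "\<xi> = \<theta>'" if "\<xi> \<in> path_space T" "P \<xi> = P \<eta>" "\<xi> T = \<eta> T + r *\<^sub>R \<alpha> s" for \<xi>
    using that Q by (intro pitman_end_inject[of \<xi> \<theta>']) simp_all
  have the: "(THE \<theta>. ?Q \<theta>) = \<theta>'"
    by (rule the_equality, fact Q) (blast intro: uniq)
  have "\<theta>' = \<theta> \<longleftrightarrow> ?Q \<theta>"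
  proof
    assume "\<theta>' = \<theta>"
    then show "?Q \<theta>" using Q by blast
  next
    assume "?Q \<theta>"
    then show "\<theta>' = \<theta>" using uniq[of \<theta>] by blast
  qed
  then show ?thesis using True by (simp add: path_op_def the)
qed (auto simp: path_op_def)

end

section \<open>Rescaling one simple root\<close>

lemma run_inf_scale:
  assumes "continuous_on {0..T} f" "0 \<le> t" "t \<le> T" "0 < k"
  shows "run_inf (\<lambda>s. k * f s) t = k * run_inf f t"
proof (rule real_eq_by_lower_bounds)
  fix c
  have *: "c \<le> k * z \<longleftrightarrow> c / k \<le> z" for z using assms(4) by (auto simp: field_simps)
  show "c \<le> run_inf (\<lambda>s. k * f s) t \<longleftrightarrow> c \<le> k * run_inf f t"
    unfolding * using le_run_inf_iff[OF continuous_on_mult_left[OF assms(1), of k] assms(2,3)]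
      le_run_inf_iff[OF assms(1-3)] by (simp add: *)
qed

text \<open>Rescaling a coroot by \<open>k\<close> and the root by \<open>1/k\<close> leaves the Pitman transform unchanged; this
  reduces to a symmetric Cartan matrix.\<close>

context
  fixes T :: real and \<alpha> :: "'i \<Rightarrow> 'v::euclidean_space" and \<alpha>v :: "'i \<Rightarrow> 'v \<Rightarrow> real" and t :: 'i and k :: real
    and \<alpha>' \<alpha>v'
  defines "\<alpha>' \<equiv> \<alpha>(t := (1 / k) *\<^sub>R \<alpha> t)" and "\<alpha>v' \<equiv> \<alpha>v(t := \<lambda>v. k * \<alpha>v t v)"
  assumes k: "0 < k" and lin: "linear (\<alpha>v t)" and T: "0 \<le> T"
begin

lemma pitman_rescale:
  assumes "\<eta> \<in> path_space T"
  shows "pitman T \<alpha>' \<alpha>v' s \<eta> = pitman T \<alpha> \<alpha>v s \<eta>"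
  using run_inf_scale[OF continuous_linear_path[OF assms lin] _ _ k] k
  by (auto simp: pitman_def \<alpha>'_def \<alpha>v'_def run_inf_def[symmetric] fun_eq_iff)

lemma path_eps_rescale:
  assumes "\<eta> \<in> path_space T"
  shows "path_eps T \<alpha>v' s \<eta> = (if s = t then k else 1) * path_eps T \<alpha>v s \<eta>"
  using run_inf_scale[OF continuous_linear_path[OF assms lin] T _ k]
  by (auto simp: path_eps_eq \<alpha>v'_def)

lemma pitman_word_rescale:
  assumes "\<eta> \<in> path_space T" "\<And>s. s \<in> set ws \<Longrightarrow> linear (\<alpha>v s)"
  shows "pitman_word T \<alpha>' \<alpha>v' ws \<eta> = pitman_word T \<alpha> \<alpha>v ws \<eta>"
  using assms T by (induction ws) (auto simp: pitman_rescale pitman_word_in_path_space)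

text \<open>Entries for the letter t are multiplied by k, which is not 0, so equality of strings is
  unaffected.\<close>

lemma strings_rescale:
  assumes "\<eta> \<in> path_space T" "\<eta>' \<in> path_space T" "\<And>s. s \<in> set ws \<Longrightarrow> linear (\<alpha>v s)"
  shows "strings T \<alpha>' \<alpha>v' ws \<eta> = strings T \<alpha>' \<alpha>v' ws \<eta>' \<longleftrightarrow> strings T \<alpha> \<alpha>v ws \<eta> = strings T \<alpha> \<alpha>v ws \<eta>'"
  using assms T k
  by (induction ws) (auto simp: pitman_word_rescale path_eps_rescale pitman_word_in_path_space)

end

section \<open>Strings along the longest element\<close>

context finite_coxeter_realization
begin

lemma simple_root: "0 \<le> T \<Longrightarrow> s \<in> S \<Longrightarrow> simple_root T \<alpha> \<alpha>v s"
  using linear_coroot coroot_root by (simp add: simple_root_def)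

lemma dihedral_rescaled:
  assumes st: "s \<in> S" "t \<in> S" "s \<noteq> t" and T: "0 \<le> T"
  shows "\<exists>k>0. dihedral_paths T (\<alpha>(t := (1 / k) *\<^sub>R \<alpha> t)) (\<alpha>v(t := \<lambda>v. k * \<alpha>v t v)) s t (ord (s \<otimes> t))"
proof -
  let ?m = "ord (s \<otimes> t)"
  have lin: "linear (\<alpha>v s)" "linear (\<alpha>v t)" and two: "\<alpha>v s (\<alpha> s) = 2" "\<alpha>v t (\<alpha> t) = 2"
    using linear_coroot coroot_root st by auto
  have "?m \<noteq> 1"
  proof
    assume "?m = 1"
    then have "s \<otimes> t = \<one>" using pow_ord_eq_1[of "s \<otimes> t"] st by simp
    then have "s = t" using st by (metis S_carrier S_inv inv_equality)
    with st show False by simp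
  qed
  moreover have "1 \<le> ?m" using ord_ge_1[OF finite_W] st by simp
  ultimately have m: "2 \<le> ?m" by simp
  show ?thesis
  proof (cases "?m = 2")
    case True
    then show ?thesis
      using cartan_orthogonal[OF st True] st lin two T
      by (intro exI[of _ 1]) (simp add: dihedral_paths_def)
  next
    case False
    define p q where "p = - \<alpha>v s (\<alpha> t)" and "q = - \<alpha>v t (\<alpha> s)"
    define c where "c = cos (pi / real ?m)"
    have pq: "0 < p" "0 < q" "p * q = 4 * c\<^sup>2"
      using cartan_negative[OF st False] by (auto simp: p_def q_def c_def)
    have "0 < c" unfolding c_def using m False by (intro cos_gt_zero) (auto simp: field_simps)
    \<comment> \<open>Solves k q = 2 c; then p / k = 2 c follows from p q = 4 c^2.\<close>
    define k where "k = 2 * c / q"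
    have k: "0 < k" using \<open>0 < c\<close> pq by (simp add: k_def)
    have "p / k = 2 * c" using pq \<open>0 < c\<close> by (simp add: k_def field_simps power2_eq_square)
    moreover have "k * q = 2 * c" using pq by (simp add: k_def)
    moreover have "\<alpha>v s ((1 / k) *\<^sub>R \<alpha> t) = - (p / k)" "k * \<alpha>v t (\<alpha> s) = - (k * q)"
      using linear_cmul[OF lin(1)] by (simp_all add: p_def q_def)
    moreover have "linear (\<lambda>v. k * \<alpha>v t v)"
      using lin(2) by (intro linearI) (simp_all add: linear_add linear_cmul algebra_simps)
    moreover have "k * \<alpha>v t ((1 / k) *\<^sub>R \<alpha> t) = 2" using k two linear_cmul[OF lin(2)] by simp
    ultimately have "dihedral_paths T (\<alpha>(t := (1 / k) *\<^sub>R \<alpha> t)) (\<alpha>v(t := \<lambda>v. k * \<alpha>v t v)) s t ?m"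
      unfolding dihedral_paths_def c_def[symmetric] using st lin two T m by simp
    then show ?thesis using k by blast
  qed
qed

lemma pitman_word_path:
  "0 \<le> T \<Longrightarrow> ws \<in> lists S \<Longrightarrow> \<eta> \<in> path_space T \<Longrightarrow> pitman_word T \<alpha> \<alpha>v ws \<eta> \<in> path_space T"
  using linear_coroot by (intro pitman_word_in_path_space) auto

lemma dihedral_braid:
  assumes st: "s \<in> S" "t \<in> S" "s \<noteq> t" and T: "0 \<le> T" and \<eta>: "\<eta> \<in> path_space T"
  shows "pitman_word T \<alpha> \<alpha>v (alt_word (ord (s \<otimes> t)) s t) \<eta> = pitman_word T \<alpha> \<alpha>v (alt_word (ord (s \<otimes> t)) t s) \<eta>"
    and "\<eta>' \<in> path_space T \<Longrightarrow> \<eta> T = \<eta>' T \<Longrightarrow>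
      strings T \<alpha> \<alpha>v (alt_word (ord (s \<otimes> t)) s t) \<eta> = strings T \<alpha> \<alpha>v (alt_word (ord (s \<otimes> t)) s t) \<eta>' \<Longrightarrow>
      strings T \<alpha> \<alpha>v (alt_word (ord (s \<otimes> t)) t s) \<eta> = strings T \<alpha> \<alpha>v (alt_word (ord (s \<otimes> t)) t s) \<eta>'"
proof -
  let ?m = "ord (s \<otimes> t)"
  obtain k where k: "0 < k"
    and d: "dihedral_paths T (\<alpha>(t := (1 / k) *\<^sub>R \<alpha> t)) (\<alpha>v(t := \<lambda>v. k * \<alpha>v t v)) s t ?m"
    using dihedral_rescaled[OF st T] by blast
  have "alt_word ?m s t \<in> lists S" "alt_word ?m t s \<in> lists S"
    using st by (intro alt_word_in_lists; simp)+
  then have lin: "\<And>r. r \<in> set (alt_word ?m s t) \<Longrightarrow> linear (\<alpha>v r)" "\<And>r. r \<in> set (alt_word ?m t s) \<Longrightarrow> linear (\<alpha>v r)"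
    using linear_coroot by auto
  note pw = pitman_word_rescale[where t = t and \<alpha> = \<alpha> and \<alpha>v = \<alpha>v, OF k linear_coroot[OF st(2)] T \<eta>]
    and str = strings_rescale[where t = t and \<alpha> = \<alpha> and \<alpha>v = \<alpha>v, OF k linear_coroot[OF st(2)] T \<eta>]
  show "pitman_word T \<alpha> \<alpha>v (alt_word ?m s t) \<eta> = pitman_word T \<alpha> \<alpha>v (alt_word ?m t s) \<eta>"
    using dihedral_paths.pitman_braid[OF d \<eta>] pw lin by simp
  show "strings T \<alpha> \<alpha>v (alt_word ?m t s) \<eta> = strings T \<alpha> \<alpha>v (alt_word ?m t s) \<eta>'"
    if "\<eta>' \<in> path_space T" "\<eta> T = \<eta>' T"
      "strings T \<alpha> \<alpha>v (alt_word ?m s t) \<eta> = strings T \<alpha> \<alpha>v (alt_word ?m s t) \<eta>'"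
    using dihedral_paths.strings_braid[OF d _ that(2) \<eta> that(1)] str[OF that(1)] lin that(3) by simp
qed

text \<open>Each transform moves the end point by its string entry times the root, so equal strings
  move both end points by the same vector. This carries the end point condition of the rank two
  result past the letters that act before a braid move.\<close>

lemma strings_end_iff:
  assumes T: "0 \<le> T"
  shows "ws \<in> lists S \<Longrightarrow> strings T \<alpha> \<alpha>v ws \<eta> = strings T \<alpha> \<alpha>v ws \<eta>' \<Longrightarrow>
    pitman_word T \<alpha> \<alpha>v ws \<eta> T = pitman_word T \<alpha> \<alpha>v ws \<eta>' T \<longleftrightarrow> \<eta> T = \<eta>' T"
proof (induction ws)
  case (Cons s ws)
  then show ?case using simple_root.pitman_end[OF simple_root[OF T], of s] by simp
qed simp

text \<open>In a braid move the suffix v acts first, so its strings agree, and by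
  \<open>strings_end_iff\<close> so do the end points after it. Rank two treats the alternating
  block, and u then acts on the same path for both forms of the block.\<close>

lemma braid_eq_transfer:
  assumes T: "0 \<le> T"
  shows "braid_eq G S u v \<Longrightarrow> \<eta> \<in> path_space T \<Longrightarrow>
    pitman_word T \<alpha> \<alpha>v u \<eta> = pitman_word T \<alpha> \<alpha>v v \<eta> \<and>
    (\<forall>\<eta>'\<in>path_space T. \<eta> T = \<eta>' T \<longrightarrow> strings T \<alpha> \<alpha>v u \<eta> = strings T \<alpha> \<alpha>v u \<eta>' \<longrightarrow>
      strings T \<alpha> \<alpha>v v \<eta> = strings T \<alpha> \<alpha>v v \<eta>')"
proof (induction rule: braid_eq.induct)
  case (braid_move u v s t)
  have v: "pitman_word T \<alpha> \<alpha>v v \<zeta> \<in> path_space T" if "\<zeta> \<in> path_space T" for \<zeta>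
    using pitman_word_path[OF T] that braid_move by blast
  note d = dihedral_braid[OF braid_move(3-5) T]
  show ?case
  proof (intro conjI ballI impI)
    show "pitman_word T \<alpha> \<alpha>v (u @ alt_word (ord (s \<otimes> t)) s t @ v) \<eta> =
        pitman_word T \<alpha> \<alpha>v (u @ alt_word (ord (s \<otimes> t)) t s @ v) \<eta>"
      using d(1)[OF v[OF braid_move.prems]] by simp
    fix \<eta>' assume \<eta>': "\<eta>' \<in> path_space T" "\<eta> T = \<eta>' T"
      and str: "strings T \<alpha> \<alpha>v (u @ alt_word (ord (s \<otimes> t)) s t @ v) \<eta> =
        strings T \<alpha> \<alpha>v (u @ alt_word (ord (s \<otimes> t)) s t @ v) \<eta>'"
    then have strv: "strings T \<alpha> \<alpha>v v \<eta> = strings T \<alpha> \<alpha>v v \<eta>'" by (simp add: strings_append_eq_iff)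
    have "pitman_word T \<alpha> \<alpha>v v \<eta> T = pitman_word T \<alpha> \<alpha>v v \<eta>' T"
      using strings_end_iff[OF T braid_move(2) strv] \<eta>' by simp
    from d(2)[OF v[OF braid_move.prems] v[OF \<eta>'(1)] this]
    show "strings T \<alpha> \<alpha>v (u @ alt_word (ord (s \<otimes> t)) t s @ v) \<eta> =
        strings T \<alpha> \<alpha>v (u @ alt_word (ord (s \<otimes> t)) t s @ v) \<eta>'"
      using str d(1)[OF v[OF braid_move.prems]] d(1)[OF v[OF \<eta>'(1)]]
      by (simp add: strings_append_eq_iff)
  qed
next
  case (braid_trans u v w)
  then show ?case by metis
qed simp

text \<open>Letters are undone starting with the one that acted last: the transform and its eps
  determine the path before it.\<close>

lemma strings_inject:
  assumes T: "0 \<le> T" and \<eta>: "\<eta> \<in> path_space T" "\<eta>' \<in> path_space T"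
  shows "ws \<in> lists S \<Longrightarrow> strings T \<alpha> \<alpha>v ws \<eta> = strings T \<alpha> \<alpha>v ws \<eta>' \<Longrightarrow>
    pitman_word T \<alpha> \<alpha>v ws \<eta> = pitman_word T \<alpha> \<alpha>v ws \<eta>' \<Longrightarrow> \<eta> = \<eta>'"
proof (induction ws)
  case (Cons s ws)
  then have "pitman_word T \<alpha> \<alpha>v ws \<eta> = pitman_word T \<alpha> \<alpha>v ws \<eta>'"
    using simple_root.pitman_eps_inject[OF simple_root[OF T, of s]]
      pitman_word_path[OF T, of ws] \<eta> by simp
  with Cons show ?case by simp
qed simp

lemma dominant_path_fixed:
  assumes T: "0 \<le> T" and \<pi>: "dominant_path T S \<alpha>v \<pi>"
  shows "ws \<in> lists S \<Longrightarrow> pitman_word T \<alpha> \<alpha>v ws \<pi> = \<pi> \<and> strings T \<alpha> \<alpha>v ws \<pi> = replicate (length ws) 0"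
proof (induction ws)
  case (Cons s ws)
  have "pitman T \<alpha> \<alpha>v s \<pi> = \<pi>" "path_eps T \<alpha>v s \<pi> = 0"
    using simple_root.dominant_fixed[OF simple_root[OF T, of s], of \<pi>] \<pi> Cons.prems
    by (auto simp: dominant_path_def closed_chamber_def)
  with Cons show ?case by simp
qed simp

end

section \<open>Pairing the paths of two dominant ends\<close>

locale longest_word = finite_coxeter_realization G S \<rho> \<alpha> \<alpha>v
  for G :: "('w, 'm) monoid_scheme" (structure) and S :: "'w set"
    and \<rho> :: "'w \<Rightarrow> 'v::euclidean_space \<Rightarrow> 'v" and \<alpha> :: "'w \<Rightarrow> 'v" and \<alpha>v :: "'w \<Rightarrow> 'v \<Rightarrow> real" +
  fixes w0 :: 'w and ws :: "'w list" and T :: real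
  assumes longest: "longest_element G S w0"
    and decomposition: "reduced_decomposition G S ws w0"
    and T_pos: "0 < T"
begin

lemma T: "0 \<le> T"
  using T_pos by simp

lemma ws: "ws \<in> lists S"
  using decomposition by (simp add: reduced_decomposition_def)

text \<open>The common end point is part of the relation: it gives equal weights, and passing to
  another word by braid moves relies on it.\<close>

definition same_strings :: "(real \<Rightarrow> 'v) \<Rightarrow> (real \<Rightarrow> 'v) \<Rightarrow> bool" where
  "same_strings \<eta> \<eta>' \<longleftrightarrow> \<eta> \<in> path_space T \<and> \<eta>' \<in> path_space T \<and> \<eta> T = \<eta>' T \<and>
    strings T \<alpha> \<alpha>v ws \<eta> = strings T \<alpha> \<alpha>v ws \<eta>'"

lemma same_strings_sym: "same_strings \<eta> \<eta>' \<Longrightarrow> same_strings \<eta>' \<eta>"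
  by (simp add: same_strings_def)

definition initial_part :: "'w \<Rightarrow> 'w list" where
  "initial_part s = (SOME v. v \<in> lists S \<and> braid_eq G S ws (v @ [s]) \<and> braid_eq G S (v @ [s]) ws)"

lemma initial_part:
  assumes "s \<in> S"
  shows "braid_eq G S ws (initial_part s @ [s])" "braid_eq G S (initial_part s @ [s]) ws"
proof -
  have "\<exists>v. v \<in> lists S \<and> braid_eq G S ws (v @ [s]) \<and> braid_eq G S (v @ [s]) ws"
    using longest_word_ending[OF finite_W longest decomposition assms] by blast
  from someI_ex[OF this] show "braid_eq G S ws (initial_part s @ [s])" "braid_eq G S (initial_part s @ [s]) ws"
    unfolding initial_part_def by blast+
qed

lemma pitman_word_initial_part:
  assumes "s \<in> S" "\<eta> \<in> path_space T"
  shows "pitman_word T \<alpha> \<alpha>v ws \<eta> = pitman_word T \<alpha> \<alpha>v (initial_part s) (pitman T \<alpha> \<alpha>v s \<eta>)"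
  using braid_eq_transfer[OF T initial_part(1)[OF assms(1)] assms(2)] by simp

lemma strings_initial_part:
  assumes s: "s \<in> S" and \<eta>: "\<eta> \<in> path_space T" "\<eta>' \<in> path_space T" "\<eta> T = \<eta>' T"
  shows "strings T \<alpha> \<alpha>v ws \<eta> = strings T \<alpha> \<alpha>v ws \<eta>' \<longleftrightarrow>
    path_eps T \<alpha>v s \<eta> = path_eps T \<alpha>v s \<eta>' \<and>
    strings T \<alpha> \<alpha>v (initial_part s) (pitman T \<alpha> \<alpha>v s \<eta>) = strings T \<alpha> \<alpha>v (initial_part s) (pitman T \<alpha> \<alpha>v s \<eta>')"
proof -
  have "strings T \<alpha> \<alpha>v ws \<eta> = strings T \<alpha> \<alpha>v ws \<eta>' \<longleftrightarrow>
      strings T \<alpha> \<alpha>v (initial_part s @ [s]) \<eta> = strings T \<alpha> \<alpha>v (initial_part s @ [s]) \<eta>'"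
    using braid_eq_transfer[OF T initial_part(1)[OF s] \<eta>(1)]
      braid_eq_transfer[OF T initial_part(2)[OF s] \<eta>(1)] \<eta>(2,3) by blast
  then show ?thesis by (auto simp: strings_append_eq_iff)
qed

lemma same_strings_eps:
  assumes "same_strings \<eta> \<eta>'" "s \<in> S"
  shows "path_eps T \<alpha>v s \<eta> = path_eps T \<alpha>v s \<eta>'" "path_phi T \<alpha>v s \<eta> = path_phi T \<alpha>v s \<eta>'"
proof -
  interpret simple_root T \<alpha> \<alpha>v s by (rule simple_root[OF T assms(2)])
  show eps: "path_eps T \<alpha>v s \<eta> = path_eps T \<alpha>v s \<eta>'"
    using strings_initial_part[OF assms(2), of \<eta> \<eta>'] assms(1) by (simp add: same_strings_def)
  show "path_phi T \<alpha>v s \<eta> = path_phi T \<alpha>v s \<eta>'"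
    using assms(1) eps by (simp add: path_phi_eq same_strings_def)
qed

text \<open>For a word ending in s, the string consists of eps for s and a rest that depends only on
  the transform for s. Exchanging both paths for others with the same transforms and with equal new
  eps therefore keeps the strings equal, and the end product stays the same.\<close>

lemma same_strings_string:
  assumes same: "same_strings \<eta> \<eta>'" and s: "s \<in> S" and \<theta>: "\<theta> \<in> path_space T" "\<theta>' \<in> path_space T"
    and P: "pitman T \<alpha> \<alpha>v s \<theta> = pitman T \<alpha> \<alpha>v s \<eta>" "pitman T \<alpha> \<alpha>v s \<theta>' = pitman T \<alpha> \<alpha>v s \<eta>'"
    and eps: "path_eps T \<alpha>v s \<theta> = path_eps T \<alpha>v s \<theta>'"
  shows "same_strings \<theta> \<theta>'" "pitman_word T \<alpha> \<alpha>v ws \<theta> = pitman_word T \<alpha> \<alpha>v ws \<eta>"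
proof -
  interpret simple_root T \<alpha> \<alpha>v s by (rule simple_root[OF T s])
  have \<eta>: "\<eta> \<in> path_space T" "\<eta>' \<in> path_space T" "\<eta> T = \<eta>' T"
    "strings T \<alpha> \<alpha>v ws \<eta> = strings T \<alpha> \<alpha>v ws \<eta>'" using same by (auto simp: same_strings_def)
  have end_eq: "\<theta> T = \<theta>' T"
    using pitman_end[of \<theta>] pitman_end[of \<theta>'] pitman_end[of \<eta>] pitman_end[of \<eta>'] P eps \<eta>(3)
      same_strings_eps[OF same s] by simp
  show "same_strings \<theta> \<theta>'"
    unfolding same_strings_def
    using \<theta> end_eq strings_initial_part[OF s \<theta> end_eq] strings_initial_part[OF s \<eta>(1-3)] \<eta>(4) P eps by simp
  show "pitman_word T \<alpha> \<alpha>v ws \<theta> = pitman_word T \<alpha> \<alpha>v ws \<eta>"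
    using pitman_word_initial_part[OF s] \<theta>(1) \<eta>(1) P(1) by simp
qed

text \<open>The partner is built back from the dominant end, where all entries are 0. If the
  transform zeta of eta has a partner zeta', then zeta' has eps 0 like zeta, so it is fixed by the
  transform and has preimages; the one with the eps of eta is wanted. There is room for it because
  zeta and zeta' end at the same point. The word \<open>us\<close> shrinks while strings are always
  compared along \<open>ws\<close>, so each letter in turn can be treated as acting first.\<close>

lemma ex_same_strings:
  assumes \<pi>: "dominant_path T S \<alpha>v \<pi>" "dominant_path T S \<alpha>v \<pi>'" "\<pi> T = \<pi>' T"
  shows "us \<in> lists S \<Longrightarrow> \<eta> \<in> path_space T \<Longrightarrow> pitman_word T \<alpha> \<alpha>v us \<eta> = \<pi> \<Longrightarrow>
    \<exists>\<eta>'. same_strings \<eta> \<eta>' \<and> pitman_word T \<alpha> \<alpha>v ws \<eta>' = \<pi>'"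
proof (induction us arbitrary: \<eta> rule: rev_induct)
  case Nil
  then have "same_strings \<eta> \<pi>'"
    using \<pi> dominant_path_fixed[OF T \<pi>(1) ws] dominant_path_fixed[OF T \<pi>(2) ws]
    by (simp add: same_strings_def dominant_path_def)
  then show ?case using dominant_path_fixed[OF T \<pi>(2) ws] by blast
next
  case (snoc s us)
  have s: "s \<in> S" using snoc.prems by simp
  interpret simple_root T \<alpha> \<alpha>v s by (rule simple_root[OF T s])
  let ?\<zeta> = "pitman T \<alpha> \<alpha>v s \<eta>"
  have \<zeta>: "?\<zeta> \<in> path_space T" by (rule pitman_path[OF snoc.prems(2)])
  have "us \<in> lists S" "pitman_word T \<alpha> \<alpha>v us ?\<zeta> = \<pi>" using snoc.prems by auto
  from snoc.IH[OF this(1) \<zeta> this(2)] obtain \<zeta>' where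
    \<zeta>': "same_strings ?\<zeta> \<zeta>'" "pitman_word T \<alpha> \<alpha>v ws \<zeta>' = \<pi>'" by blast
  have \<zeta>'p: "\<zeta>' \<in> path_space T" "?\<zeta> T = \<zeta>' T" using \<zeta>'(1) by (auto simp: same_strings_def)
  have fix1: "P ?\<zeta> = ?\<zeta>" and eps0: "path_eps T \<alpha>v s ?\<zeta> = 0"
    using dominant_fixed[OF \<zeta> co_pitman_nonneg[OF snoc.prems(2)]] by auto
  have fix2: "P \<zeta>' = \<zeta>'"
    using path_eps_0_imp_fixed[OF \<zeta>'p(1)] same_strings_eps(1)[OF \<zeta>'(1) s] eps0 by simp
  have "path_eps T \<alpha>v s \<eta> \<le> co \<zeta>' T" using path_eps_le[OF snoc.prems(2)] \<zeta>'p(2) by simp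
  from pitman_surj[OF \<zeta>'p(1) fix2 path_eps_nonneg[OF snoc.prems(2)] this]
  obtain \<eta>' where \<eta>': "\<eta>' \<in> path_space T" "P \<eta>' = \<zeta>'" "path_eps T \<alpha>v s \<eta>' = path_eps T \<alpha>v s \<eta>" by blast
  have "same_strings \<eta> \<eta>'"
    by (rule same_strings_string(1)[OF \<zeta>'(1) s snoc.prems(2) \<eta>'(1)]) (use fix1 fix2 \<eta>' in simp_all)
  moreover have "pitman_word T \<alpha> \<alpha>v ws \<eta>' = pitman_word T \<alpha> \<alpha>v ws \<zeta>'"
    by (rule same_strings_string(2)[OF same_strings_sym[OF \<zeta>'(1)] s \<eta>'(1) snoc.prems(2)])
      (use fix1 fix2 \<eta>' in simp_all)
  ultimately show ?case using \<zeta>'(2) by auto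
qed

definition twin :: "(real \<Rightarrow> 'v) \<Rightarrow> (real \<Rightarrow> 'v) \<Rightarrow> real \<Rightarrow> 'v" where
  "twin \<pi>' \<eta> = (THE \<eta>'. same_strings \<eta> \<eta>' \<and> pitman_word T \<alpha> \<alpha>v ws \<eta>' = \<pi>')"

lemma twin_eqI:
  assumes "same_strings \<eta> \<eta>'" "pitman_word T \<alpha> \<alpha>v ws \<eta>' = \<pi>'"
  shows "twin \<pi>' \<eta> = \<eta>'"
  unfolding twin_def
proof (rule the_equality)
  fix \<theta> assume "same_strings \<eta> \<theta> \<and> pitman_word T \<alpha> \<alpha>v ws \<theta> = \<pi>'"
  then have "\<theta> \<in> path_space T" "\<eta>' \<in> path_space T" "strings T \<alpha> \<alpha>v ws \<theta> = strings T \<alpha> \<alpha>v ws \<eta>'"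
    "pitman_word T \<alpha> \<alpha>v ws \<theta> = pitman_word T \<alpha> \<alpha>v ws \<eta>'"
    using assms by (simp_all add: same_strings_def)
  then show "\<theta> = \<eta>'" by (rule strings_inject[OF T _ _ ws])
qed (use assms in simp)

abbreviation "L \<pi> \<equiv> {\<eta> \<in> path_space T. pitman_word T \<alpha> \<alpha>v ws \<eta> = \<pi>}"

lemma L_crystal_simps:
  "elems (L_crystal T \<alpha> \<alpha>v ws \<pi>) = L \<pi>"
  "wt (L_crystal T \<alpha> \<alpha>v ws \<pi>) \<eta> = \<eta> T"
  "eps (L_crystal T \<alpha> \<alpha>v ws \<pi>) = path_eps T \<alpha>v"
  "phi (L_crystal T \<alpha> \<alpha>v ws \<pi>) = path_phi T \<alpha>v"
  "cop (L_crystal T \<alpha> \<alpha>v ws \<pi>) = path_op T \<alpha> \<alpha>v"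
  by (simp_all add: L_crystal_def path_crystal_def)

context
  fixes \<pi> \<pi>'
  assumes dominant: "dominant_path T S \<alpha>v \<pi>" "dominant_path T S \<alpha>v \<pi>'" and end_eq: "\<pi> T = \<pi>' T"
begin

lemma twin:
  assumes "\<eta> \<in> L \<pi>"
  shows "same_strings \<eta> (twin \<pi>' \<eta>)" "twin \<pi>' \<eta> \<in> L \<pi>'" "twin \<pi> (twin \<pi>' \<eta>) = \<eta>"
proof -
  obtain \<eta>' where \<eta>': "same_strings \<eta> \<eta>'" "pitman_word T \<alpha> \<alpha>v ws \<eta>' = \<pi>'"
    using ex_same_strings[OF dominant end_eq ws] assms by blast
  have eq: "twin \<pi>' \<eta> = \<eta>'" by (rule twin_eqI[OF \<eta>'])
  show "same_strings \<eta> (twin \<pi>' \<eta>)" "twin \<pi>' \<eta> \<in> L \<pi>'"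
    unfolding eq using \<eta>' by (auto simp: same_strings_def)
  show "twin \<pi> (twin \<pi>' \<eta>) = \<eta>"
    unfolding eq using twin_eqI[OF same_strings_sym[OF \<eta>'(1)]] assms by simp
qed

text \<open>The operator keeps the transform for s and moves both end points by the same multiple of
  the root, so the two results have equal eps. They then have equal strings, and uniqueness of the
  partner identifies the image.\<close>

lemma twin_path_op:
  assumes \<eta>: "\<eta> \<in> L \<pi>" and s: "s \<in> S" and op: "path_op T \<alpha> \<alpha>v s r (Some \<eta>) = Some \<theta>" and \<theta>: "\<theta> \<in> L \<pi>"
  shows "path_op T \<alpha> \<alpha>v s r (Some (twin \<pi>' \<eta>)) = Some (twin \<pi>' \<theta>)"
proof -
  interpret simple_root T \<alpha> \<alpha>v s by (rule simple_root[OF T s])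
  let ?\<eta>' = "twin \<pi>' \<eta>"
  have \<eta>p: "\<eta> \<in> path_space T" and \<eta>': "same_strings \<eta> ?\<eta>'" "?\<eta>' \<in> path_space T" "pitman_word T \<alpha> \<alpha>v ws ?\<eta>' = \<pi>'"
    using twin[OF \<eta>] \<eta> by auto
  have r: "- path_phi T \<alpha>v s \<eta> \<le> r" "r \<le> path_eps T \<alpha>v s \<eta>" "\<theta> \<in> path_space T" "P \<theta> = P \<eta>"
    "\<theta> T = \<eta> T + r *\<^sub>R \<alpha> s"
    using op unfolding path_op_Some_iff[OF \<eta>p] by auto
  have "\<exists>\<theta>'. path_op T \<alpha> \<alpha>v s r (Some ?\<eta>') = Some \<theta>'"
    using r(1,2) same_strings_eps[OF \<eta>'(1) s] by (simp add: path_op_def)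
  then obtain \<theta>' where op': "path_op T \<alpha> \<alpha>v s r (Some ?\<eta>') = Some \<theta>'" by blast
  then have r': "\<theta>' \<in> path_space T" "P \<theta>' = P ?\<eta>'" "\<theta>' T = ?\<eta>' T + r *\<^sub>R \<alpha> s"
    unfolding path_op_Some_iff[OF \<eta>'(2)] by auto
  have "(path_eps T \<alpha>v s \<theta> - path_eps T \<alpha>v s \<theta>') *\<^sub>R \<alpha> s = 0"
  proof -
    have "P \<eta> T = P ?\<eta>' T + (\<eta> T - ?\<eta>' T)"
      using pitman_end[of \<eta>] pitman_end[of ?\<eta>'] same_strings_eps(1)[OF \<eta>'(1) s] by simp
    then show ?thesis
      using pitman_end[of \<theta>] pitman_end[of \<theta>'] r(4,5) r'(2,3) by (simp add: algebra_simps)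
  qed
  then have eps: "path_eps T \<alpha>v s \<theta> = path_eps T \<alpha>v s \<theta>'" using root_neq_0 by simp
  have "same_strings \<theta> \<theta>'"
    by (rule same_strings_string(1)[OF \<eta>'(1) s r(3) r'(1) r(4) r'(2) eps])
  moreover have "pitman_word T \<alpha> \<alpha>v ws \<theta>' = \<pi>'"
    using same_strings_string(2)[OF same_strings_sym[OF \<eta>'(1)] s r'(1) r(3) r'(2) r(4) eps[symmetric]] \<eta>'(3)
    by simp
  ultimately have "twin \<pi>' \<theta> = \<theta>'" by (rule twin_eqI)
  with op' show ?thesis by simp
qed

lemma twin_morphism:
  "crystal_morphism S (L_crystal T \<alpha> \<alpha>v ws \<pi>) (L_crystal T \<alpha> \<alpha>v ws \<pi>') (map_option (twin \<pi>'))"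
  unfolding crystal_morphism_def with_ghost_def L_crystal_simps
proof (intro conjI ballI allI impI)
  show "map_option (twin \<pi>') ` insert None (Some ` L \<pi>) \<subseteq> insert None (Some ` L \<pi>')"
    using twin(2) by auto
  fix \<eta> assume \<eta>: "\<eta> \<in> L \<pi>"
  show "\<exists>c\<in>L \<pi>'. map_option (twin \<pi>') (Some \<eta>) = Some c \<and> c T = \<eta> T \<and>
      (\<forall>s\<in>S. path_eps T \<alpha>v s c = path_eps T \<alpha>v s \<eta> \<and> path_phi T \<alpha>v s c = path_phi T \<alpha>v s \<eta>)"
    using twin(1,2)[OF \<eta>] same_strings_eps[OF twin(1)[OF \<eta>]]
    by (intro bexI[of _ "twin \<pi>' \<eta>"]) (auto simp: same_strings_def)
next
  fix s r \<eta>
  assume *: "s \<in> S" "\<eta> \<in> L \<pi>" "path_op T \<alpha> \<alpha>v s r (Some \<eta>) \<in> Some ` L \<pi>"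
  then obtain \<theta> where \<theta>: "path_op T \<alpha> \<alpha>v s r (Some \<eta>) = Some \<theta>" "\<theta> \<in> L \<pi>" by blast
  show "path_op T \<alpha> \<alpha>v s r (map_option (twin \<pi>') (Some \<eta>)) =
      map_option (twin \<pi>') (path_op T \<alpha> \<alpha>v s r (Some \<eta>))"
    using twin_path_op[OF *(2,1) \<theta>] \<theta>(1) by simp
qed simp

end

lemma L_crystal_isomorphic:
  assumes "dominant_path T S \<alpha>v \<pi>" "dominant_path T S \<alpha>v \<pi>'" "\<pi> T = \<pi>' T"
  shows "crystal_isomorphic S (L_crystal T \<alpha> \<alpha>v ws \<pi>) (L_crystal T \<alpha> \<alpha>v ws \<pi>')"
  unfolding crystal_isomorphic_def
proof (intro exI conjI ballI)
  note sym_assms = assms(2,1) assms(3)[symmetric]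
  show "crystal_morphism S (L_crystal T \<alpha> \<alpha>v ws \<pi>) (L_crystal T \<alpha> \<alpha>v ws \<pi>') (map_option (twin \<pi>'))"
    by (rule twin_morphism[OF assms])
  show "crystal_morphism S (L_crystal T \<alpha> \<alpha>v ws \<pi>') (L_crystal T \<alpha> \<alpha>v ws \<pi>) (map_option (twin \<pi>))"
    by (rule twin_morphism[OF sym_assms])
  show "map_option (twin \<pi>) (map_option (twin \<pi>') b) = b"
    if "b \<in> with_ghost (L_crystal T \<alpha> \<alpha>v ws \<pi>)" for b
    using that twin(3)[OF assms] by (auto simp: with_ghost_def L_crystal_simps)
  show "map_option (twin \<pi>') (map_option (twin \<pi>) c) = c"
    if "c \<in> with_ghost (L_crystal T \<alpha> \<alpha>v ws \<pi>')" for c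
    using that twin(3)[OF sym_assms] by (auto simp: with_ghost_def L_crystal_simps)
qed

end

theorem theorem4p9:
  fixes G :: "('w, 'm) monoid_scheme"
    and S :: "'w set"
    and \<rho> :: "'w \<Rightarrow> 'v::euclidean_space \<Rightarrow> 'v"
    and \<alpha> :: "'w \<Rightarrow> 'v"
    and \<alpha>v :: "'w \<Rightarrow> 'v \<Rightarrow> real"
    and T :: real
    and \<pi> \<pi>' :: "real \<Rightarrow> 'v"
  assumes "finite_coxeter_realization G S \<rho> \<alpha> \<alpha>v"
    and "longest_element G S w0"
    and "reduced_decomposition G S ws w0"
    and "T > 0"
    and "dominant_path T S \<alpha>v \<pi>"
    and "dominant_path T S \<alpha>v \<pi>'"
    and "\<pi> T = \<pi>' T"
  shows "crystal_isomorphic S (L_crystal T \<alpha> \<alpha>v ws \<pi>) (L_crystal T \<alpha> \<alpha>v ws \<pi>')"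
proof -
  have "longest_word G S \<rho> \<alpha> \<alpha>v w0 ws T"
    using assms(1-4) by (simp add: longest_word_def longest_word_axioms_def)
  then show ?thesis using assms(5-7) by (rule longest_word.L_crystal_isomorphic)
qed

end
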